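(* Let $d\ge 2$ and let $\Omega$ be a bounded domain in $\mathbb R^d$. Let $\{\lambda_j\}_{j\ge1}$ be the Dirichlet eigenvalues of the Laplacian on $\Omega$ and $\{u_j\}_{j\ge 1}$ a corresponding $L^2(\Omega)$-orthonormal set of eigenfunctions. Then for any nonzero $\phi\in H^1_0(\Omega)\cap L^{\infty}(\Omega)$ and any $z>0$, $$\sum_{j}(z-\lambda_{j})_{+}\|\phi u_j\|_2^2\geq \frac{2}{d+2}\,(2\pi)^{-d}\omega_d\|\phi\|_2^2\left(z-\frac{\|\nabla\phi\|_2^2}{\|\phi\|_2^2}\right)_{+}^{\frac{d}{2}+1}.$$ Moreover, for all positive integers $k$, $$\frac1{k}\sum_{j=1}^k\lambda_{j}\leq \frac{\|\nabla\phi\|_2^2}{\|\phi\|_2^2} +\frac{d}{d+2}\,C_d\left(\frac{k}{|\Omega|}\right)^{\frac{2}{d}}\rho(\phi)^{-2/d},$$ where $\rho(\phi):=\dfrac{\|\phi\|_2^2}{|\Omega|\cdot\|\phi\|_{\infty}^2}<1$.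
   Context: $-\Delta_\Omega^D$ is the (nonnegative) self-adjoint realization of the Laplacian in $L^2(\Omega)$ with Dirichlet boundary conditions (form domain $H^1_0(\Omega)$); $0<\lambda_1\le\lambda_2\le\dots$ are its eigenvalues repeated according to multiplicity. $\|\cdot\|_2$, $\|\cdot\|_\infty$ are the norms of $L^2(\Omega)$, $L^\infty(\Omega)$; functions $\phi$ are real-valued; $x_+=\max\{x,0\}$; $\sum_j$ is the sum over all positive integers; $|\Omega|$ is Lebesgue measure; $\omega_d=\pi^{d/2}/\Gamma(1+d/2)$ is the volume of the unit ball in $\mathbb R^d$; $C_d=4\pi^2\omega_d^{-2/d}$. *)

theory Defs
  imports "HOL-Analysis.Analysis" "HOL-Probability.Essential_Supremum"
begin

text \<open>
  Elements of \<open>L\<^sup>2(\<Omega>)\<close> and \<open>H\<^sup>1\<^sub>0(\<Omega>)\<close> are represented by functions on the whole space, of which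
  only the values almost everywhere on \<open>\<Omega>\<close> matter. The space \<open>\<real>\<^sup>d\<close> is a Euclidean space
  \<open>'a\<close> with \<open>d = DIM('a)\<close>, and the coordinate directions are the elements of \<open>Basis\<close>.
  The codomain \<open>'b\<close> is \<open>real\<close> or \<open>complex\<close>.
\<close>

subsection \<open>Lebesgue spaces\<close>

definition L2 :: "'a::euclidean_space set \<Rightarrow> ('a \<Rightarrow> 'b::euclidean_space) set" where
  "L2 \<Omega> = {f. f \<in> borel_measurable (lebesgue_on \<Omega>) \<and>
               integrable (lebesgue_on \<Omega>) (\<lambda>x. (norm (f x))\<^sup>2)}"

definition L2_norm :: "'a::euclidean_space set \<Rightarrow> ('a \<Rightarrow> 'b::euclidean_space) \<Rightarrow> real" where
  "L2_norm \<Omega> f = sqrt (\<integral>x. (norm (f x))\<^sup>2 \<partial>lebesgue_on \<Omega>)"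

definition L2_inner :: "'a::euclidean_space set \<Rightarrow> ('a \<Rightarrow> complex) \<Rightarrow> ('a \<Rightarrow> complex) \<Rightarrow> complex" where
  "L2_inner \<Omega> f g = (\<integral>x. f x * cnj (g x) \<partial>lebesgue_on \<Omega>)"

definition Linfty :: "'a::euclidean_space set \<Rightarrow> ('a \<Rightarrow> real) set" where
  "Linfty \<Omega> = {f. f \<in> borel_measurable (lebesgue_on \<Omega>) \<and>
                   esssup (lebesgue_on \<Omega>) (\<lambda>x. ereal \<bar>f x\<bar>) < \<infinity>}"

definition Linfty_norm :: "'a::euclidean_space set \<Rightarrow> ('a \<Rightarrow> real) \<Rightarrow> real" where
  "Linfty_norm \<Omega> f = real_of_ereal (esssup (lebesgue_on \<Omega>) (\<lambda>x. ereal \<bar>f x\<bar>))"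

subsection \<open>Test functions, weak derivatives, Sobolev spaces\<close>

definition partial_deriv ::
    "'a::euclidean_space \<Rightarrow> ('a \<Rightarrow> 'b::euclidean_space) \<Rightarrow> 'a \<Rightarrow> 'b" where
  "partial_deriv i f x = frechet_derivative f (at x) i"

primrec Ck :: "nat \<Rightarrow> ('a::euclidean_space \<Rightarrow> 'b::euclidean_space) \<Rightarrow> bool" where
  "Ck 0 f \<longleftrightarrow> continuous_on UNIV f"
| "Ck (Suc k) f \<longleftrightarrow> (\<forall>x. f differentiable (at x)) \<and> (\<forall>i\<in>Basis. Ck k (partial_deriv i f))"

text \<open>The space \<open>C\<^sub>c\<^sup>\<infinity>(\<Omega>)\<close>, its members being extended by zero outside \<open>\<Omega>\<close>:\<close>

definition test_functions :: "'a::euclidean_space set \<Rightarrow> ('a \<Rightarrow> 'b::euclidean_space) set" where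
  "test_functions \<Omega> = {\<psi>. (\<forall>k. Ck k \<psi>) \<and>
     compact (closure {x. \<psi> x \<noteq> 0}) \<and> closure {x. \<psi> x \<noteq> 0} \<subseteq> \<Omega>}"

definition has_weak_partial ::
    "'a::euclidean_space set \<Rightarrow> 'a \<Rightarrow> ('a \<Rightarrow> 'b::euclidean_space) \<Rightarrow> ('a \<Rightarrow> 'b) \<Rightarrow> bool" where
  "has_weak_partial \<Omega> i f g \<longleftrightarrow> f \<in> L2 \<Omega> \<and> g \<in> L2 \<Omega> \<and>
     (\<forall>\<psi> :: 'a \<Rightarrow> real. \<psi> \<in> test_functions \<Omega> \<longrightarrow>
        (\<integral>x. partial_deriv i \<psi> x *\<^sub>R f x \<partial>lebesgue_on \<Omega>) =
        - (\<integral>x. \<psi> x *\<^sub>R g x \<partial>lebesgue_on \<Omega>))"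

text \<open>For \<open>f\<close> in \<open>H\<^sup>1(\<Omega>)\<close> the weak partial derivative is unique almost everywhere on \<open>\<Omega>\<close>;
  \<open>weak_partial\<close> picks a representative.\<close>

definition weak_partial ::
    "'a::euclidean_space set \<Rightarrow> 'a \<Rightarrow> ('a \<Rightarrow> 'b::euclidean_space) \<Rightarrow> 'a \<Rightarrow> 'b" where
  "weak_partial \<Omega> i f = (SOME g. has_weak_partial \<Omega> i f g)"

definition H1 :: "'a::euclidean_space set \<Rightarrow> ('a \<Rightarrow> 'b::euclidean_space) set" where
  "H1 \<Omega> = {f. f \<in> L2 \<Omega> \<and> (\<forall>i\<in>Basis. \<exists>g. has_weak_partial \<Omega> i f g)}"

text \<open>The closure of the test functions in the norm of \<open>H\<^sup>1(\<Omega>)\<close>:\<close>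

definition H10 :: "'a::euclidean_space set \<Rightarrow> ('a \<Rightarrow> 'b::euclidean_space) set" where
  "H10 \<Omega> = {f \<in> H1 \<Omega>. \<exists>\<psi> :: nat \<Rightarrow> 'a \<Rightarrow> 'b. (\<forall>n. \<psi> n \<in> test_functions \<Omega>) \<and>
     (\<lambda>n. L2_norm \<Omega> (\<lambda>x. \<psi> n x - f x)) \<longlonglongrightarrow> 0 \<and>
     (\<forall>i\<in>Basis. (\<lambda>n. L2_norm \<Omega> (\<lambda>x. partial_deriv i (\<psi> n) x - weak_partial \<Omega> i f x)) \<longlonglongrightarrow> 0)}"

text \<open>\<open>grad_norm \<Omega> f\<close> is \<open>\<parallel>\<nabla>f\<parallel>\<^sub>2\<close>.\<close>

definition grad_norm :: "'a::euclidean_space set \<Rightarrow> ('a \<Rightarrow> 'b::euclidean_space) \<Rightarrow> real" where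
  "grad_norm \<Omega> f = sqrt (\<Sum>i\<in>Basis. (L2_norm \<Omega> (weak_partial \<Omega> i f))\<^sup>2)"

subsection \<open>The Dirichlet Laplacian and its eigenvalues\<close>

text \<open>The graph of the self-adjoint operator \<open>-\<Delta>\<close> in the complex space \<open>L\<^sup>2(\<Omega>)\<close> that is associated
  with the closed form \<open>(u, v) \<mapsto> \<integral> \<nabla>u \<cdot> cnj (\<nabla>v)\<close> with form domain \<open>H\<^sup>1\<^sub>0(\<Omega>)\<close>:
  \<open>u\<close> is in the domain and \<open>-\<Delta>u = f\<close>.\<close>

definition dirichlet_laplacian ::
    "'a::euclidean_space set \<Rightarrow> ('a \<Rightarrow> complex) \<Rightarrow> ('a \<Rightarrow> complex) \<Rightarrow> bool" where
  "dirichlet_laplacian \<Omega> u f \<longleftrightarrow> u \<in> H10 \<Omega> \<and> f \<in> L2 \<Omega> \<and>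
     (\<forall>v\<in>H10 \<Omega>. (\<Sum>i\<in>Basis. L2_inner \<Omega> (weak_partial \<Omega> i u) (weak_partial \<Omega> i v)) = L2_inner \<Omega> f v)"

definition eigenspace :: "'a::euclidean_space set \<Rightarrow> real \<Rightarrow> ('a \<Rightarrow> complex) set" where
  "eigenspace \<Omega> \<mu> = {u. dirichlet_laplacian \<Omega> u (\<lambda>x. complex_of_real \<mu> * u x)}"

text \<open>The eigenspace, as a subspace of \<open>L\<^sup>2(\<Omega>)\<close>, has a basis of \<open>n\<close> elements. For \<open>n = 0\<close>
  this says that \<open>\<mu>\<close> is not an eigenvalue.\<close>

definition has_multiplicity :: "'a::euclidean_space set \<Rightarrow> real \<Rightarrow> nat \<Rightarrow> bool" where
  "has_multiplicity \<Omega> \<mu> n \<longleftrightarrow> (\<exists>v :: nat \<Rightarrow> 'a \<Rightarrow> complex.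
     (\<forall>i<n. v i \<in> eigenspace \<Omega> \<mu>) \<and>
     (\<forall>c. (AE x in lebesgue_on \<Omega>. (\<Sum>i<n. c i * v i x) = 0) \<longrightarrow> (\<forall>i<n. c i = 0)) \<and>
     (\<forall>w\<in>eigenspace \<Omega> \<mu>. \<exists>c. AE x in lebesgue_on \<Omega>. w x = (\<Sum>i<n. c i * v i x)))"

text \<open>\<open>ev 1 \<le> ev 2 \<le> \<dots>\<close> lists all eigenvalues, each as often as its multiplicity;
  \<open>ev 0\<close> is irrelevant.\<close>

definition dirichlet_eigenvalues :: "'a::euclidean_space set \<Rightarrow> (nat \<Rightarrow> real) \<Rightarrow> bool" where
  "dirichlet_eigenvalues \<Omega> ev \<longleftrightarrow> mono_on {1..} ev \<and>
     (\<forall>\<mu>. finite {j. 1 \<le> j \<and> ev j = \<mu>} \<and> has_multiplicity \<Omega> \<mu> (card {j. 1 \<le> j \<and> ev j = \<mu>}))"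

definition orthonormal_eigenfunctions ::
    "'a::euclidean_space set \<Rightarrow> (nat \<Rightarrow> real) \<Rightarrow> (nat \<Rightarrow> 'a \<Rightarrow> complex) \<Rightarrow> bool" where
  "orthonormal_eigenfunctions \<Omega> ev u \<longleftrightarrow>
     (\<forall>j\<ge>1. u j \<in> eigenspace \<Omega> (ev j)) \<and>
     (\<forall>i\<ge>1. \<forall>j\<ge>1. L2_inner \<Omega> (u i) (u j) = (if i = j then 1 else 0))"

subsection \<open>Constants\<close>

definition weyl_const :: "nat \<Rightarrow> real" where
  "weyl_const d = 4 * pi\<^sup>2 * unit_ball_vol (real d) powr (- 2 / real d)"

definition rho :: "'a::euclidean_space set \<Rightarrow> ('a \<Rightarrow> real) \<Rightarrow> real" where
  "rho \<Omega> \<phi> = (L2_norm \<Omega> \<phi>)\<^sup>2 / (measure lebesgue \<Omega> * (Linfty_norm \<Omega> \<phi>)\<^sup>2)"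

end

theory Submission
  imports Defs "HOL-Complex_Analysis.Great_Picard" "HOL-Real_Asymp.Real_Asymp"
begin

text \<open>
  The trial functions are \<open>\<phi> e\<^sub>p\<close> with \<open>e\<^sub>p(x) = exp(i p \<bullet> x)\<close>. They lie in \<open>H\<^sup>1\<^sub>0(\<Omega>)\<close>, have the
  norm of \<open>\<phi>\<close>, and, since \<open>\<phi>\<close> is real, their energy is \<open>\<parallel>\<nabla>\<phi>\<parallel>\<^sup>2 + |p|\<^sup>2 \<parallel>\<phi>\<parallel>\<^sup>2\<close>. The spectral theorem gives
  \<open>\<Sum>\<^sub>j (z - \<lambda>\<^sub>j)\<^sub>+ |\<langle>\<phi> e\<^sub>p, u\<^sub>j\<rangle>|\<^sup>2 \<ge> z \<parallel>\<phi>\<parallel>\<^sup>2 - \<parallel>\<nabla>\<phi>\<parallel>\<^sup>2 - |p|\<^sup>2 \<parallel>\<phi>\<parallel>\<^sup>2\<close>. This is integrated over the ball of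
  those \<open>p\<close> for which the right-hand side is nonnegative. On the left only the inequality half of
  Plancherel's theorem for \<open>\<phi> cnj(u\<^sub>j)\<close> is needed, and for functions of bounded support that is Bessel's
  inequality for Fourier series, averaged over a cell of the dual lattice. The bound on the
  eigenvalue means follows with \<open>z = \<lambda>\<^sub>k\<close> and Young's inequality.

  Of the spectral theorem one needs that the energy is at least \<open>z\<close> times the squared norm on the
  orthogonal complement of the \<open>u\<^sub>j\<close> with \<open>\<lambda>\<^sub>j < z\<close>. Otherwise, by compactness, a minimizer of the
  Rayleigh quotient there would be an eigenfunction not accounted for by the multiplicities.
\<close>

section \<open>The space \<open>L\<^sup>2\<close>\<close>

text \<open>\<open>dirichlet_eigenvalues\<close> records only a monotone list whose repetitions
  match the multiplicities. That the list is unbounded, and that the \<open>u j\<close> exhaust the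
  low part of the spectrum, must be extracted from compactness; hence Rellich's theorem and the
  closedness of \<open>H10\<close> come first. A second obstacle is that gradients enter through the
  arbitrary choice \<open>weak_partial\<close>. The fundamental lemma shows that the choice matters
  only on null sets, after which a function and any gradient of it are handled as a pair. Half-open
  cubes serve twice: for cube means in the compactness proof and as cells of the dual lattice in the
  Fourier estimate. Constants: \<open>2 / (d + 2) * unit_ball_vol d * R ^ (d + 2)\<close> is the
  integral of \<open>R\<^sup>2 - (norm p)\<^sup>2\<close> over the ball of radius \<open>R\<close>,
  and \<open>(2 * pi) ^ d\<close> is the volume of a cube times that of its dual cell. The Weyl term
  comes from the point where the Riesz mean bound has slope \<open>k\<close>. Strictness in
  \<open>rho < 1\<close> is a separate matter: equality would make the modulus of \<phi> constant,
  which the boundary condition in \<open>H10\<close> excludes.\<close>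

lemma L2_I:
  "f \<in> borel_measurable (lebesgue_on \<Omega>) \<Longrightarrow>
   integrable (lebesgue_on \<Omega>) (\<lambda>x. (norm (f x))\<^sup>2) \<Longrightarrow> f \<in> L2 \<Omega>"
  by (simp add: L2_def)

lemma L2_measurable: "f \<in> L2 \<Omega> \<Longrightarrow> f \<in> borel_measurable (lebesgue_on \<Omega>)"
  by (simp add: L2_def)

lemma L2_integrable: "f \<in> L2 \<Omega> \<Longrightarrow> integrable (lebesgue_on \<Omega>) (\<lambda>x. (norm (f x))\<^sup>2)"
  by (simp add: L2_def)

text \<open>The two codomains are independent, so a coordinate, a product or a modulated function
  can be dominated by a function of another type.\<close>

lemma L2_dominated:
  fixes f :: "'a::euclidean_space \<Rightarrow> 'b::euclidean_space" and g :: "'a \<Rightarrow> 'c::euclidean_space"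
  assumes f: "f \<in> borel_measurable (lebesgue_on \<Omega>)" and g: "g \<in> L2 \<Omega>"
    and le: "AE x in lebesgue_on \<Omega>. norm (f x) \<le> C * norm (g x)"
  shows "f \<in> L2 \<Omega>"
proof (rule L2_I[OF f])
  show "integrable (lebesgue_on \<Omega>) (\<lambda>x. (norm (f x))\<^sup>2)"
  proof (rule Bochner_Integration.integrable_bound)
    show "integrable (lebesgue_on \<Omega>) (\<lambda>x. C\<^sup>2 * (norm (g x))\<^sup>2)"
      using L2_integrable[OF g] by simp
    show "(\<lambda>x. (norm (f x))\<^sup>2) \<in> borel_measurable (lebesgue_on \<Omega>)"
      using f by measurable
    show "AE x in lebesgue_on \<Omega>. norm ((norm (f x))\<^sup>2) \<le> norm (C\<^sup>2 * (norm (g x))\<^sup>2)"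
      using le by eventually_elim
        (simp add: power_mult_distrib[symmetric] power_mono)
  qed
qed

lemma L2_add:
  fixes f g :: "'a::euclidean_space \<Rightarrow> 'b::euclidean_space"
  assumes f: "f \<in> L2 \<Omega>" and g: "g \<in> L2 \<Omega>"
  shows "(\<lambda>x. f x + g x) \<in> L2 \<Omega>"
proof (rule L2_I)
  show m: "(\<lambda>x. f x + g x) \<in> borel_measurable (lebesgue_on \<Omega>)"
    using L2_measurable[OF f] L2_measurable[OF g] by measurable
  show "integrable (lebesgue_on \<Omega>) (\<lambda>x. (norm (f x + g x))\<^sup>2)"
  proof (rule Bochner_Integration.integrable_bound)
    show "integrable (lebesgue_on \<Omega>) (\<lambda>x. 2 * (norm (f x))\<^sup>2 + 2 * (norm (g x))\<^sup>2)"
      using L2_integrable[OF f] L2_integrable[OF g] by simp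
    show "(\<lambda>x. (norm (f x + g x))\<^sup>2) \<in> borel_measurable (lebesgue_on \<Omega>)"
      using m by measurable
    have "(norm (f x + g x))\<^sup>2 \<le> 2 * (norm (f x))\<^sup>2 + 2 * (norm (g x))\<^sup>2" for x
    proof -
      have "(norm (f x + g x))\<^sup>2 \<le> (norm (f x) + norm (g x))\<^sup>2"
        by (simp add: norm_triangle_ineq power_mono)
      also have "\<dots> \<le> 2 * (norm (f x))\<^sup>2 + 2 * (norm (g x))\<^sup>2"
        using zero_le_power2[of "norm (f x) - norm (g x)"]
        by (simp add: power2_eq_square algebra_simps)
      finally show ?thesis .
    qed
    then show "AE x in lebesgue_on \<Omega>. norm ((norm (f x + g x))\<^sup>2)
        \<le> norm (2 * (norm (f x))\<^sup>2 + 2 * (norm (g x))\<^sup>2)"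
      by simp
  qed
qed

lemma L2_zero [simp]: "(\<lambda>x. 0) \<in> L2 \<Omega>"
  by (simp add: L2_def)

lemma L2_scaleR: "f \<in> L2 \<Omega> \<Longrightarrow> (\<lambda>x. c *\<^sub>R f x) \<in> L2 \<Omega>"
  by (rule L2_dominated[of _ _ f "\<bar>c\<bar>"]) (auto dest: L2_measurable)

lemma L2_diff: "f \<in> L2 \<Omega> \<Longrightarrow> g \<in> L2 \<Omega> \<Longrightarrow> (\<lambda>x. f x - g x) \<in> L2 \<Omega>"
  using L2_add[of f \<Omega> "\<lambda>x. (-1) *\<^sub>R g x"] L2_scaleR[of g \<Omega> "-1"] by simp

lemma L2_cmult:
  fixes f :: "'a::euclidean_space \<Rightarrow> complex"
  shows "f \<in> L2 \<Omega> \<Longrightarrow> (\<lambda>x. c * f x) \<in> L2 \<Omega>"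
  by (rule L2_dominated[of _ _ f "cmod c"]) (auto dest: L2_measurable simp: norm_mult)

lemma L2_sum: "(\<And>i. i \<in> I \<Longrightarrow> f i \<in> L2 \<Omega>) \<Longrightarrow> (\<lambda>x. \<Sum>i\<in>I. f i x) \<in> L2 \<Omega>"
  by (induction I rule: infinite_finite_induct) (auto intro: L2_add)

lemma L2_norm_nonneg [simp]: "0 \<le> L2_norm \<Omega> f"
  by (simp add: L2_norm_def)

lemma L2_norm_power2: "(L2_norm \<Omega> f)\<^sup>2 = (\<integral>x. (norm (f x))\<^sup>2 \<partial>lebesgue_on \<Omega>)"
  by (simp add: L2_norm_def)

lemma L2_norm_zero [simp]: "L2_norm \<Omega> (\<lambda>x. 0) = 0"
  by (simp add: L2_norm_def)

lemma L2_norm_minus_commute: "L2_norm \<Omega> (\<lambda>x. f x - g x) = L2_norm \<Omega> (\<lambda>x. g x - f x)"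
  by (simp add: L2_norm_def norm_minus_commute)

lemma L2_norm_scaleR: "L2_norm \<Omega> (\<lambda>x. c *\<^sub>R f x) = \<bar>c\<bar> * L2_norm \<Omega> f"
  by (simp add: L2_norm_def power_mult_distrib real_sqrt_mult)

lemma L2_norm_cmult:
  fixes f :: "'a::euclidean_space \<Rightarrow> complex"
  shows "L2_norm \<Omega> (\<lambda>x. c * f x) = cmod c * L2_norm \<Omega> f"
  by (simp add: L2_norm_def power_mult_distrib real_sqrt_mult norm_mult)

lemma L2_norm_cong_AE:
  assumes "f \<in> borel_measurable (lebesgue_on \<Omega>)" "g \<in> borel_measurable (lebesgue_on \<Omega>)"
    and "AE x in lebesgue_on \<Omega>. f x = g x"
  shows "L2_norm \<Omega> f = L2_norm \<Omega> g"
  unfolding L2_norm_def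
  by (rule arg_cong[of _ _ sqrt], rule integral_cong_AE) (use assms in auto)

lemma L2_norm_eq_0_iff:
  assumes "f \<in> L2 \<Omega>"
  shows "L2_norm \<Omega> f = 0 \<longleftrightarrow> (AE x in lebesgue_on \<Omega>. f x = 0)"
  using integral_nonneg_eq_0_iff_AE[OF L2_integrable[OF assms]]
  by (simp add: L2_norm_def)

lemma L2_norm_mono:
  fixes f :: "'a::euclidean_space \<Rightarrow> 'b::euclidean_space" and g :: "'a \<Rightarrow> 'c::euclidean_space"
  assumes "f \<in> borel_measurable (lebesgue_on \<Omega>)" "g \<in> L2 \<Omega>" "0 \<le> C"
    and "AE x in lebesgue_on \<Omega>. norm (f x) \<le> C * norm (g x)"
  shows "L2_norm \<Omega> f \<le> C * L2_norm \<Omega> g"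
proof -
  have "f \<in> L2 \<Omega>" using assms L2_dominated by blast
  moreover have "AE x in lebesgue_on \<Omega>. (norm (f x))\<^sup>2 \<le> C\<^sup>2 * (norm (g x))\<^sup>2"
    using assms(4) by eventually_elim (simp add: power_mult_distrib[symmetric] power_mono)
  ultimately have "(\<integral>x. (norm (f x))\<^sup>2 \<partial>lebesgue_on \<Omega>) \<le> (\<integral>x. C\<^sup>2 * (norm (g x))\<^sup>2 \<partial>lebesgue_on \<Omega>)"
    using L2_integrable[of f] L2_integrable[OF assms(2)] by (intro integral_mono_AE) auto
  then have "(L2_norm \<Omega> f)\<^sup>2 \<le> (C * L2_norm \<Omega> g)\<^sup>2"
    by (simp add: L2_norm_power2 power_mult_distrib)
  then show ?thesis
    by (rule power2_le_imp_le) (simp add: assms)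
qed

lemma L2_integrable_prod:
  fixes f :: "'a::euclidean_space \<Rightarrow> 'b::euclidean_space" and g :: "'a \<Rightarrow> 'c::euclidean_space"
  assumes f: "f \<in> L2 \<Omega>" and g: "g \<in> L2 \<Omega>"
  shows "integrable (lebesgue_on \<Omega>) (\<lambda>x. norm (f x) * norm (g x))"
proof (rule Bochner_Integration.integrable_bound)
  show "integrable (lebesgue_on \<Omega>) (\<lambda>x. (norm (f x))\<^sup>2 + (norm (g x))\<^sup>2)"
    using L2_integrable[OF f] L2_integrable[OF g] by simp
  show "(\<lambda>x. norm (f x) * norm (g x)) \<in> borel_measurable (lebesgue_on \<Omega>)"
    using L2_measurable[OF f] L2_measurable[OF g] by measurable
  have "a * b \<le> a\<^sup>2 + b\<^sup>2" if "0 \<le> a" "0 \<le> b" for a b :: real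
    using sum_squares_bound[of a b] that mult_nonneg_nonneg[OF that] by linarith
  then show "AE x in lebesgue_on \<Omega>. norm (norm (f x) * norm (g x)) \<le> norm ((norm (f x))\<^sup>2 + (norm (g x))\<^sup>2)"
    by simp
qed

lemma nn_integral_L2:
  assumes "f \<in> L2 \<Omega>"
  shows "(\<integral>\<^sup>+x. ennreal ((norm (f x))\<^sup>2) \<partial>lebesgue_on \<Omega>) = ennreal ((L2_norm \<Omega> f)\<^sup>2)"
  unfolding L2_norm_power2 by (rule nn_integral_eq_integral[OF L2_integrable[OF assms]]) simp

lemma L2_Cauchy_Schwarz:
  fixes f :: "'a::euclidean_space \<Rightarrow> 'b::euclidean_space" and g :: "'a \<Rightarrow> 'c::euclidean_space"
  assumes f: "f \<in> L2 \<Omega>" and g: "g \<in> L2 \<Omega>"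
  shows "(\<integral>x. norm (f x) * norm (g x) \<partial>lebesgue_on \<Omega>) \<le> L2_norm \<Omega> f * L2_norm \<Omega> g"
proof -
  let ?M = "lebesgue_on \<Omega>"
  have [measurable]: "f \<in> borel_measurable ?M" "g \<in> borel_measurable ?M"
    using f g by (auto dest: L2_measurable)
  have "(\<integral>\<^sup>+x. ennreal (norm (f x)) * ennreal (norm (g x)) \<partial>?M)\<^sup>2
      \<le> (\<integral>\<^sup>+x. ennreal (norm (f x))^2 \<partial>?M) * (\<integral>\<^sup>+x. ennreal (norm (g x))^2 \<partial>?M)"
    by (rule Cauchy_Schwarz_nn_integral) auto
  moreover have "(\<integral>\<^sup>+x. ennreal (norm (f x)) * ennreal (norm (g x)) \<partial>?M)
      = ennreal (\<integral>x. norm (f x) * norm (g x) \<partial>?M)"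
    by (subst nn_integral_eq_integral[symmetric, OF L2_integrable_prod[OF f g]])
       (auto simp: ennreal_mult)
  ultimately have "ennreal ((\<integral>x. norm (f x) * norm (g x) \<partial>?M)\<^sup>2)
      \<le> ennreal ((L2_norm \<Omega> f)\<^sup>2 * (L2_norm \<Omega> g)\<^sup>2)"
    by (simp add: ennreal_power ennreal_mult nn_integral_L2[OF f] nn_integral_L2[OF g])
  then have "(\<integral>x. norm (f x) * norm (g x) \<partial>?M)\<^sup>2 \<le> (L2_norm \<Omega> f * L2_norm \<Omega> g)\<^sup>2"
    by (simp add: power_mult_distrib)
  then show ?thesis
    by (rule power2_le_imp_le) simp
qed

lemma L2_norm_triangle:
  fixes f g :: "'a::euclidean_space \<Rightarrow> 'b::euclidean_space"
  assumes f: "f \<in> L2 \<Omega>" and g: "g \<in> L2 \<Omega>"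
  shows "L2_norm \<Omega> (\<lambda>x. f x + g x) \<le> L2_norm \<Omega> f + L2_norm \<Omega> g"
proof (rule power2_le_imp_le)
  let ?M = "lebesgue_on \<Omega>"
  have "(L2_norm \<Omega> (\<lambda>x. f x + g x))\<^sup>2
      \<le> (\<integral>x. (norm (f x))\<^sup>2 + (norm (g x))\<^sup>2 + 2 * (norm (f x) * norm (g x)) \<partial>?M)"
    unfolding L2_norm_power2
  proof (rule integral_mono)
    show "integrable ?M (\<lambda>x. (norm (f x + g x))\<^sup>2)"
      using L2_integrable[OF L2_add[OF f g]] .
    show "integrable ?M (\<lambda>x. (norm (f x))\<^sup>2 + (norm (g x))\<^sup>2 + 2 * (norm (f x) * norm (g x)))"
      using L2_integrable[OF f] L2_integrable[OF g] L2_integrable_prod[OF f g] by simp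
    show "(norm (f x + g x))\<^sup>2 \<le> (norm (f x))\<^sup>2 + (norm (g x))\<^sup>2 + 2 * (norm (f x) * norm (g x))" for x
      using power_mono[OF norm_triangle_ineq[of "f x" "g x"], of 2]
      by (simp add: power2_eq_square algebra_simps)
  qed
  also have "\<dots> = (L2_norm \<Omega> f)\<^sup>2 + (L2_norm \<Omega> g)\<^sup>2 + 2 * (\<integral>x. norm (f x) * norm (g x) \<partial>?M)"
    using L2_integrable[OF f] L2_integrable[OF g] L2_integrable_prod[OF f g]
    by (simp add: L2_norm_power2)
  also have "\<dots> \<le> (L2_norm \<Omega> f + L2_norm \<Omega> g)\<^sup>2"
    using L2_Cauchy_Schwarz[OF f g] by (simp add: power2_eq_square algebra_simps)
  finally show "(L2_norm \<Omega> (\<lambda>x. f x + g x))\<^sup>2 \<le> (L2_norm \<Omega> f + L2_norm \<Omega> g)\<^sup>2" .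
qed simp

lemma L2_norm_triangle_diff:
  fixes f g h :: "'a::euclidean_space \<Rightarrow> 'b::euclidean_space"
  assumes "f \<in> L2 \<Omega>" "g \<in> L2 \<Omega>" "h \<in> L2 \<Omega>"
  shows "L2_norm \<Omega> (\<lambda>x. f x - g x) \<le> L2_norm \<Omega> (\<lambda>x. f x - h x) + L2_norm \<Omega> (\<lambda>x. h x - g x)"
  using L2_norm_triangle[OF L2_diff[OF assms(1,3)] L2_diff[OF assms(3,2)]] by simp

lemma L2_norm_diff_le:
  fixes f g :: "'a::euclidean_space \<Rightarrow> 'b::euclidean_space"
  assumes f: "f \<in> L2 \<Omega>" and g: "g \<in> L2 \<Omega>"
  shows "\<bar>L2_norm \<Omega> f - L2_norm \<Omega> g\<bar> \<le> L2_norm \<Omega> (\<lambda>x. f x - g x)"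
  using L2_norm_triangle[OF L2_diff[OF f g] g] L2_norm_triangle[OF L2_diff[OF g f] f]
    L2_norm_minus_commute[of \<Omega> f g] by simp

lemma L2_norm_tendsto:
  fixes f :: "'a::euclidean_space \<Rightarrow> 'b::euclidean_space"
  assumes "\<And>n. s n \<in> L2 \<Omega>" "f \<in> L2 \<Omega>"
    and "(\<lambda>n. L2_norm \<Omega> (\<lambda>x. s n x - f x)) \<longlonglongrightarrow> 0"
  shows "(\<lambda>n. L2_norm \<Omega> (s n)) \<longlonglongrightarrow> L2_norm \<Omega> f"
proof -
  have "(\<lambda>n. L2_norm \<Omega> (s n) - L2_norm \<Omega> f) \<longlonglongrightarrow> 0"
    by (rule tendsto_rabs_zero_cancel, rule tendsto_sandwich[OF _ _ tendsto_const assms(3)])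
       (use L2_norm_diff_le[OF assms(1,2)] in auto)
  then show ?thesis by (simp add: LIM_zero_iff)
qed

section \<open>Pairings of square integrable functions\<close>

lemma L2_integrable_bilinear:
  fixes f :: "'a::euclidean_space \<Rightarrow> 'b::euclidean_space" and g :: "'a \<Rightarrow> 'c::euclidean_space"
    and p :: "'b \<Rightarrow> 'c \<Rightarrow> 'd::euclidean_space"
  assumes p: "bounded_bilinear p" and f: "f \<in> L2 \<Omega>" and g: "g \<in> L2 \<Omega>"
  shows "integrable (lebesgue_on \<Omega>) (\<lambda>x. p (f x) (g x))"
proof -
  obtain K where K: "\<And>a b. norm (p a b) \<le> norm a * norm b * K"
    using bounded_bilinear.nonneg_bounded[OF p] by blast
  show ?thesis
  proof (rule Bochner_Integration.integrable_bound)
    show "integrable (lebesgue_on \<Omega>) (\<lambda>x. norm (f x) * norm (g x) * K)"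
      using L2_integrable_prod[OF f g] by simp
    show "(\<lambda>x. p (f x) (g x)) \<in> borel_measurable (lebesgue_on \<Omega>)"
      using L2_measurable[OF f] L2_measurable[OF g]
      by (rule borel_measurable_continuous_Pair)
         (intro bounded_bilinear.continuous_on[OF p] continuous_intros)
    show "AE x in lebesgue_on \<Omega>. norm (p (f x) (g x)) \<le> norm (norm (f x) * norm (g x) * K)"
      by (intro AE_I2, unfold real_norm_def) (rule order_trans[OF K abs_ge_self])
  qed
qed

text \<open>An arbitrary pairing with constant one covers \<open>*\<close>, \<open>*\<^sub>R\<close>
  and the Hermitian product \<open>a * cnj b\<close> at once.\<close>

lemma L2_bilinear_bound:
  fixes f :: "'a::euclidean_space \<Rightarrow> 'b::euclidean_space" and g :: "'a \<Rightarrow> 'c::euclidean_space"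
    and p :: "'b \<Rightarrow> 'c \<Rightarrow> 'd::euclidean_space"
  assumes bp: "bounded_bilinear p" and p: "\<And>a b. norm (p a b) \<le> norm a * norm b"
    and f: "f \<in> L2 \<Omega>" and g: "g \<in> L2 \<Omega>"
  shows "norm (\<integral>x. p (f x) (g x) \<partial>lebesgue_on \<Omega>) \<le> L2_norm \<Omega> f * L2_norm \<Omega> g"
proof -
  have "norm (\<integral>x. p (f x) (g x) \<partial>lebesgue_on \<Omega>) \<le> (\<integral>x. norm (f x) * norm (g x) \<partial>lebesgue_on \<Omega>)"
    by (rule Bochner_Integration.integral_norm_bound_integral
          [OF L2_integrable_bilinear[OF bp f g] L2_integrable_prod[OF f g]]) (rule p)
  also have "\<dots> \<le> L2_norm \<Omega> f * L2_norm \<Omega> g"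
    by (rule L2_Cauchy_Schwarz[OF f g])
  finally show ?thesis .
qed

lemma L2_bilinear_tendsto:
  fixes f :: "'a::euclidean_space \<Rightarrow> 'b::euclidean_space" and g :: "'a \<Rightarrow> 'c::euclidean_space"
    and p :: "'b \<Rightarrow> 'c \<Rightarrow> 'd::euclidean_space"
  assumes p: "bounded_bilinear p" "\<And>a b. norm (p a b) \<le> norm a * norm b"
    and f: "f \<in> L2 \<Omega>" and s: "\<And>n. s n \<in> L2 \<Omega>" and g: "g \<in> L2 \<Omega>"
    and lim: "(\<lambda>n. L2_norm \<Omega> (\<lambda>x. s n x - g x)) \<longlonglongrightarrow> 0"
  shows "(\<lambda>n. \<integral>x. p (f x) (s n x) \<partial>lebesgue_on \<Omega>) \<longlonglongrightarrow> (\<integral>x. p (f x) (g x) \<partial>lebesgue_on \<Omega>)"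
proof -
  have "norm ((\<integral>x. p (f x) (s n x) \<partial>lebesgue_on \<Omega>) - (\<integral>x. p (f x) (g x) \<partial>lebesgue_on \<Omega>))
     \<le> L2_norm \<Omega> f * L2_norm \<Omega> (\<lambda>x. s n x - g x)" for n
    using L2_bilinear_bound[OF p f L2_diff[OF s[of n] g]]
      L2_integrable_bilinear[OF p(1) f s[of n]] L2_integrable_bilinear[OF p(1) f g]
    by (simp add: bounded_bilinear.diff_right[OF p(1)])
  moreover have "(\<lambda>n. L2_norm \<Omega> f * L2_norm \<Omega> (\<lambda>x. s n x - g x)) \<longlonglongrightarrow> 0"
    using tendsto_mult[OF tendsto_const lim] by simp
  ultimately have "(\<lambda>n. (\<integral>x. p (f x) (s n x) \<partial>lebesgue_on \<Omega>) - (\<integral>x. p (f x) (g x) \<partial>lebesgue_on \<Omega>)) \<longlonglongrightarrow> 0"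
    by (rule Lim_null_comparison[OF always_eventually, OF allI])
  then show ?thesis by (rule LIM_zero_cancel)
qed

lemma integrable_const_lebesgue_on:
  "\<Omega> \<in> lmeasurable \<Longrightarrow> integrable (lebesgue_on \<Omega>) (\<lambda>x. c)"
  by (rule finite_measure.integrable_const[OF finite_measure_lebesgue_on])

lemma L2_const: "\<Omega> \<in> lmeasurable \<Longrightarrow> (\<lambda>x. c) \<in> L2 \<Omega>"
  by (rule L2_I) (auto intro: integrable_const_lebesgue_on)

lemma L2_bounded:
  assumes "\<Omega> \<in> lmeasurable" "f \<in> borel_measurable (lebesgue_on \<Omega>)" "\<And>x. x \<in> \<Omega> \<Longrightarrow> norm (f x) \<le> C"
  shows "f \<in> L2 \<Omega>"
proof -
  have "AE x in lebesgue_on \<Omega>. norm (f x) \<le> 1 * norm C"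
    using assms(3) by (intro AE_I2) (simp, metis abs_ge_self order_trans)
  then show ?thesis
    using L2_dominated[OF assms(2) L2_const[OF assms(1), of C]] by blast
qed

lemma L2_imp_integrable:
  assumes "\<Omega> \<in> lmeasurable" "f \<in> L2 \<Omega>"
  shows "integrable (lebesgue_on \<Omega>) f"
  using L2_integrable_bilinear[OF bounded_bilinear_scaleR L2_const[OF assms(1), of 1] assms(2)] by simp

text \<open>Completeness is reduced to \<open>L\<^sup>1\<close>, where a Cauchy sequence has a subsequence converging almost
  everywhere; Fatou's lemma then bounds the distance to the limit.\<close>

lemma L2_complete:
  fixes s :: "nat \<Rightarrow> 'a::euclidean_space \<Rightarrow> 'b::euclidean_space"
  assumes \<Omega>: "\<Omega> \<in> lmeasurable" and s: "\<And>n. s n \<in> L2 \<Omega>"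
    and cau: "\<And>e. e > 0 \<Longrightarrow> \<exists>N. \<forall>m\<ge>N. \<forall>n\<ge>N. L2_norm \<Omega> (\<lambda>x. s m x - s n x) < e"
  obtains f where "f \<in> L2 \<Omega>" "(\<lambda>n. L2_norm \<Omega> (\<lambda>x. s n x - f x)) \<longlonglongrightarrow> 0"
proof -
  let ?M = "lebesgue_on \<Omega>"
  have [measurable]: "s n \<in> borel_measurable ?M" for n
    using s by (rule L2_measurable)
  have L1: "(\<integral>x. norm (s i x - s j x) \<partial>?M) \<le> L2_norm \<Omega> (\<lambda>x. 1::real) * L2_norm \<Omega> (\<lambda>x. s i x - s j x)" for i j
    using L2_Cauchy_Schwarz[OF L2_const[OF \<Omega>, of "1::real"] L2_diff[OF s s], of i j] by simp
  \<comment> \<open>The added 1 keeps \<open>c\<close> positive when \<Omega> is a null set.\<close>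
  define c where "c = L2_norm \<Omega> (\<lambda>x::'a. 1::real) + 1"
  have c: "c > 0" unfolding c_def by (simp add: add_nonneg_pos)
  have "\<exists>N. \<forall>i\<ge>N. \<forall>j\<ge>N. (\<integral>x. norm (s i x - s j x) \<partial>?M) < e" if "e > 0" for e
  proof -
    obtain N where N: "\<And>m n. m \<ge> N \<Longrightarrow> n \<ge> N \<Longrightarrow> L2_norm \<Omega> (\<lambda>x. s m x - s n x) < e / c"
      using cau[of "e / c"] \<open>e > 0\<close> c by auto
    have "(\<integral>x. norm (s i x - s j x) \<partial>?M) < e" if "i \<ge> N" "j \<ge> N" for i j
    proof -
      have "(\<integral>x. norm (s i x - s j x) \<partial>?M) \<le> c * L2_norm \<Omega> (\<lambda>x. s i x - s j x)"
        using L1[of i j] by (simp add: c_def distrib_right add_increasing2)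
      also have "\<dots> < c * (e / c)" using mult_strict_left_mono[OF N[OF that] c] .
      also have "\<dots> = e" using c by simp
      finally show ?thesis .
    qed
    then show ?thesis by blast
  qed
  then obtain r where r: "strict_mono r" and AE: "AE x in ?M. Cauchy (\<lambda>i. s (r i) x)"
    using cauchy_L1_AE_cauchy_subseq[of ?M s] L2_imp_integrable[OF \<Omega> s] by blast
  define f where "f x = lim (\<lambda>i. s (r i) x)" for x
  have [measurable]: "f \<in> borel_measurable ?M" unfolding f_def by measurable
  have lim: "AE x in ?M. (\<lambda>i. s (r i) x) \<longlonglongrightarrow> f x"
    using AE by eventually_elim (simp add: f_def Cauchy_convergent_iff convergent_LIMSEQ_iff)
  have bnd: "(\<integral>\<^sup>+x. ennreal ((norm (s m x - f x))\<^sup>2) \<partial>?M) \<le> ennreal (e\<^sup>2)"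
    if m: "\<And>n. n \<ge> N \<Longrightarrow> L2_norm \<Omega> (\<lambda>x. s m x - s n x) < e" for m N e
  proof -
    have "(\<integral>\<^sup>+x. ennreal ((norm (s m x - f x))\<^sup>2) \<partial>?M)
        = (\<integral>\<^sup>+x. liminf (\<lambda>i. ennreal ((norm (s m x - s (r i) x))\<^sup>2)) \<partial>?M)"
    proof (rule nn_integral_cong_AE, use lim in eventually_elim)
      case (elim x)
      then have "(\<lambda>i. ennreal ((norm (s m x - s (r i) x))\<^sup>2)) \<longlonglongrightarrow> ennreal ((norm (s m x - f x))\<^sup>2)"
        by (intro tendsto_intros tendsto_ennrealI)
      then show ?case by (rule lim_imp_Liminf[symmetric, rotated]) simp
    qed
    also have "\<dots> \<le> liminf (\<lambda>i. \<integral>\<^sup>+x. ennreal ((norm (s m x - s (r i) x))\<^sup>2) \<partial>?M)"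
      by (rule nn_integral_liminf) measurable
    also have "\<dots> \<le> ennreal (e\<^sup>2)"
    proof (rule order_trans[OF Liminf_mono[where g = "\<lambda>_. ennreal (e\<^sup>2)"]], rule eventually_sequentiallyI[of N])
      fix i assume "N \<le> i"
      then have "N \<le> r i" using seq_suble[OF r, of i] by simp
      then have "(L2_norm \<Omega> (\<lambda>x. s m x - s (r i) x))\<^sup>2 \<le> e\<^sup>2"
        using m[of "r i"] by (intro power_mono) auto
      then show "(\<integral>\<^sup>+x. ennreal ((norm (s m x - s (r i) x))\<^sup>2) \<partial>?M) \<le> ennreal (e\<^sup>2)"
        by (subst nn_integral_eq_integral[OF L2_integrable[OF L2_diff[OF s s]]])
           (auto simp: L2_norm_power2 intro!: ennreal_leI)
    qed (simp add: Liminf_const)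
    finally show ?thesis .
  qed
  have diff: "(\<lambda>x. s m x - f x) \<in> L2 \<Omega> \<and> L2_norm \<Omega> (\<lambda>x. s m x - f x) \<le> e"
    if m: "\<And>n. n \<ge> N \<Longrightarrow> L2_norm \<Omega> (\<lambda>x. s m x - s n x) < e" and "0 < e" for m N e
  proof -
    have int: "integrable ?M (\<lambda>x. (norm (s m x - f x))\<^sup>2)"
      using le_less_trans[OF bnd[OF m] ennreal_less_top] by (intro integrableI_bounded) auto
    then have L2: "(\<lambda>x. s m x - f x) \<in> L2 \<Omega>"
      by (auto intro!: L2_I)
    have "ennreal ((L2_norm \<Omega> (\<lambda>x. s m x - f x))\<^sup>2) \<le> ennreal (e\<^sup>2)"
      using bnd[OF m] unfolding L2_norm_power2
      by (subst (asm) nn_integral_eq_integral[OF int]) auto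
    then have "(L2_norm \<Omega> (\<lambda>x. s m x - f x))\<^sup>2 \<le> e\<^sup>2" by simp
    with L2 \<open>0 < e\<close> show ?thesis by (auto intro: power2_le_imp_le)
  qed
  have "\<exists>N. \<forall>m\<ge>N. (\<lambda>x. s m x - f x) \<in> L2 \<Omega> \<and> L2_norm \<Omega> (\<lambda>x. s m x - f x) \<le> e" if "e > 0" for e
    using cau[OF that] diff[OF _ that] by meson
  note ev = this
  \<comment> \<open>A single index with a square integrable error places \<open>f\<close> itself in
    \<open>L2\<close>.\<close>
  obtain m where "(\<lambda>x. s m x - f x) \<in> L2 \<Omega>" using ev[of 1] by auto
  from L2_diff[OF s[of m] this] have f: "f \<in> L2 \<Omega>" by simp
  show thesis
  proof (rule that[OF f], rule LIMSEQ_I)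
    fix e :: real assume "e > 0"
    then obtain N where "\<And>m. m \<ge> N \<Longrightarrow> L2_norm \<Omega> (\<lambda>x. s m x - f x) \<le> e / 2"
      using ev[of "e / 2"] by auto
    then show "\<exists>no. \<forall>n\<ge>no. norm (L2_norm \<Omega> (\<lambda>x. s n x - f x) - 0) < e"
      using \<open>e > 0\<close> by (intro exI[of _ N]) force
  qed
qed

section \<open>Calculus of compactly supported functions\<close>

lemma partial_deriv_eq: "(f has_derivative f') (at x) \<Longrightarrow> partial_deriv i f x = f' i"
  by (simp add: partial_deriv_def frechet_derivative_at[symmetric])

lemma differentiable_has_derivative:
  "f differentiable (at x) \<Longrightarrow> (f has_derivative frechet_derivative f (at x)) (at x)"
  by (simp add: frechet_derivative_works)

lemma Ck_SucD: "Ck (Suc k) f \<Longrightarrow> Ck k f"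
proof (induction k arbitrary: f)
  case 0
  then show ?case
    by (simp add: continuous_on_eq_continuous_at differentiable_imp_continuous_within)
next
  case (Suc k)
  show ?case unfolding Ck.simps(2)[of k]
  proof (intro conjI ballI)
    show "\<forall>x. f differentiable at x" using Suc.prems by simp
    fix i :: 'a assume i: "i \<in> Basis"
    have "Ck (Suc k) (partial_deriv i f)" using Suc.prems i by (subst (asm) Ck.simps(2)) blast
    then show "Ck k (partial_deriv i f)" by (rule Suc.IH)
  qed
qed

text \<open>\<open>Ck\<close> refers to \<open>frechet_derivative\<close>, which is a choice.
  Derivatives on the whole space are unique, so any explicit derivative may take its place; the
  smoothness rules below rest on this.\<close>

lemma Ck_SucI:
  assumes "\<And>x. (f has_derivative f' x) (at x)" "\<And>i. i \<in> Basis \<Longrightarrow> Ck k (\<lambda>x. f' x i)"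
  shows "Ck (Suc k) f"
proof -
  have "partial_deriv i f = (\<lambda>x. f' x i)" for i
    using partial_deriv_eq[OF assms(1)] by blast
  then show ?thesis
    using assms by (auto simp: differentiable_def)
qed

lemma Ck_Suc_has_derivative:
  "Ck (Suc k) f \<Longrightarrow> (f has_derivative frechet_derivative f (at x)) (at x)"
  by (simp add: differentiable_has_derivative)

lemma Ck_partial: "Ck (Suc k) f \<Longrightarrow> i \<in> Basis \<Longrightarrow> Ck k (partial_deriv i f)"
  by simp

lemma Ck_continuous: "Ck k f \<Longrightarrow> continuous_on UNIV f"
  by (induction k) (auto simp: continuous_on_eq_continuous_at differentiable_imp_continuous_within)

lemma Ck_const [simp]: "Ck k (\<lambda>x. c)"
  by (induction k arbitrary: c) (auto intro!: Ck_SucI[where f' = "\<lambda>_ _. 0"] simp del: Ck.simps(2))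

lemma Ck_add: "Ck k f \<Longrightarrow> Ck k g \<Longrightarrow> Ck k (\<lambda>x. f x + g x)"
proof (induction k arbitrary: f g)
  case (Suc k)
  show ?case
    using Suc.prems
    by (intro Ck_SucI[where f' = "\<lambda>x v. frechet_derivative f (at x) v + frechet_derivative g (at x) v"])
       (auto intro!: has_derivative_add Ck_Suc_has_derivative simp del: Ck.simps(2),
        auto intro!: Suc.IH simp: partial_deriv_def[symmetric] simp del: Ck.simps(2) intro: Ck_partial)
qed (auto intro: continuous_intros)

text \<open>The product rule yields two products in which one factor has lost a derivative, so the
  induction must run over all pairs \<open>f\<close>, \<open>g\<close>.\<close>

lemma Ck_bilinear:
  fixes f :: "'a::euclidean_space \<Rightarrow> 'b::euclidean_space" and g :: "'a \<Rightarrow> 'c::euclidean_space"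
    and p :: "'b \<Rightarrow> 'c \<Rightarrow> 'd::euclidean_space"
  assumes p: "bounded_bilinear p"
  shows "Ck k f \<Longrightarrow> Ck k g \<Longrightarrow> Ck k (\<lambda>x. p (f x) (g x))"
proof (induction k arbitrary: f g)
  case 0
  then show ?case by (auto intro: bounded_bilinear.continuous_on[OF p])
next
  case (Suc k)
  show ?case
  proof (rule Ck_SucI[where f' = "\<lambda>x v. p (f x) (frechet_derivative g (at x) v) + p (frechet_derivative f (at x) v) (g x)"])
    show "((\<lambda>x. p (f x) (g x)) has_derivative
        (\<lambda>v. p (f x) (frechet_derivative g (at x) v) + p (frechet_derivative f (at x) v) (g x))) (at x)" for x
      by (intro bounded_bilinear.FDERIV[OF p] Ck_Suc_has_derivative[OF Suc.prems(1)] Ck_Suc_has_derivative[OF Suc.prems(2)])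
    fix i :: 'a assume "i \<in> Basis"
    then show "Ck k (\<lambda>x. p (f x) (frechet_derivative g (at x) i) + p (frechet_derivative f (at x) i) (g x))"
      unfolding partial_deriv_def[symmetric]
      by (intro Ck_add Suc.IH Ck_SucD[OF Suc.prems(1)] Ck_SucD[OF Suc.prems(2)]
            Ck_partial[OF Suc.prems(1)] Ck_partial[OF Suc.prems(2)])
  qed
qed

lemmas Ck_mult = Ck_bilinear[OF bounded_bilinear_mult]
lemmas Ck_scaleR = Ck_bilinear[OF bounded_bilinear_scaleR]

lemma Ck_minus: "Ck k f \<Longrightarrow> Ck k (\<lambda>x. - f x)"
  using Ck_scaleR[OF Ck_const[of k "-1"]] by simp

lemma Ck_diff: "Ck k f \<Longrightarrow> Ck k g \<Longrightarrow> Ck k (\<lambda>x. f x - g x)"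
  using Ck_add[of k f "\<lambda>x. - g x"] Ck_minus[of k g] by simp

lemma Ck_prod:
  fixes f :: "'i \<Rightarrow> 'a::euclidean_space \<Rightarrow> real"
  shows "(\<And>i. i \<in> I \<Longrightarrow> Ck k (f i)) \<Longrightarrow> Ck k (\<lambda>x. \<Prod>i\<in>I. f i x)"
  by (induction I rule: infinite_finite_induct) (auto intro: Ck_mult)

lemma Ck_inner: "Ck k (\<lambda>x. x \<bullet> b)"
proof (cases k)
  case (Suc k)
  have "Ck (Suc k) (\<lambda>x. x \<bullet> b)"
    by (rule Ck_SucI[where f' = "\<lambda>x v. v \<bullet> b"]) (auto intro!: derivative_eq_intros)
  with Suc show ?thesis by simp
qed (auto intro!: continuous_intros)

lemma Ck_of_real: "Ck k f \<Longrightarrow> Ck k (\<lambda>x. complex_of_real (f x))"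
  using Ck_scaleR[of k f "\<lambda>x. 1::complex"] by (simp add: scaleR_conv_of_real)

text \<open>The whole sequence of successive derivatives is carried along, because the chain rule
  replaces \<open>g m\<close> by \<open>g (Suc m)\<close> and the induction must be free to move in
  \<open>m\<close>. For \<open>exp\<close> the sequence is constant; \<open>cis\<close> and the flat
  functions below use genuine sequences.\<close>

lemma Ck_compose_real:
  fixes g :: "nat \<Rightarrow> real \<Rightarrow> 'b::euclidean_space"
  assumes g: "\<And>m t. (g m has_vector_derivative g (Suc m) t) (at t)"
  shows "Ck k f \<Longrightarrow> Ck k (\<lambda>x. g m (f x))"
proof (induction k arbitrary: m f)
  case 0
  have "continuous_on UNIV (g m)"
    using g has_vector_derivative_continuous by (blast intro: continuous_at_imp_continuous_on)
  with 0 show ?case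
    using continuous_on_compose2[of UNIV "g m" UNIV f] by auto
next
  case (Suc k)
  show ?case
  proof (rule Ck_SucI[where f' = "\<lambda>x v. frechet_derivative f (at x) v *\<^sub>R g (Suc m) (f x)"])
    show "((\<lambda>x. g m (f x)) has_derivative (\<lambda>v. frechet_derivative f (at x) v *\<^sub>R g (Suc m) (f x))) (at x)" for x
      using has_derivative_compose[OF Ck_Suc_has_derivative[OF Suc.prems] g[unfolded has_vector_derivative_def]] .
    fix i :: 'a assume "i \<in> Basis"
    then show "Ck k (\<lambda>x. frechet_derivative f (at x) i *\<^sub>R g (Suc m) (f x))"
      unfolding partial_deriv_def[symmetric]
      by (intro Ck_scaleR Suc.IH Ck_SucD[OF Suc.prems] Ck_partial[OF Suc.prems])
  qed
qed

lemma Ck_exp: "Ck k f \<Longrightarrow> Ck k (\<lambda>x. exp (f x :: real))"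
  by (rule Ck_compose_real[where g = "\<lambda>_. exp" and m = 0])
     (auto intro!: derivative_eq_intros simp: has_real_derivative_iff_has_vector_derivative[symmetric])

lemma Ck_cis:
  assumes "Ck k f" shows "Ck k (\<lambda>x. cis (f x))"
proof -
  have "((\<lambda>t. \<i> ^ m * cis t) has_vector_derivative \<i> ^ Suc m * cis t) (at t)" for m t
    by (auto intro!: derivative_eq_intros simp: has_vector_derivative_def scaleR_conv_of_real)
  from Ck_compose_real[where g = "\<lambda>m t. \<i> ^ m * cis t", OF this assms, of 0] show ?thesis by simp
qed

lemma Ck_linear:
  assumes "bounded_linear L" "Ck k f" shows "Ck k (\<lambda>x. L (f x))"
  using assms(2)
proof (induction k arbitrary: f)
  case 0
  then show ?case by (auto intro: bounded_linear.continuous_on[OF assms(1)])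
next
  case (Suc k)
  then show ?case
    by (intro Ck_SucI[where f' = "\<lambda>x v. L (frechet_derivative f (at x) v)"]
          bounded_linear.has_derivative[OF assms(1)] Ck_Suc_has_derivative)
       (auto simp: partial_deriv_def[symmetric] simp del: Ck.simps(2) intro: Ck_partial)
qed

lemma Ck_cos: "Ck k f \<Longrightarrow> Ck k (\<lambda>x. cos (f x :: real))"
  using Ck_linear[OF bounded_linear_Re Ck_cis] by simp

lemma partial_deriv_bilinear:
  assumes "bounded_bilinear p" "f differentiable (at x)" "g differentiable (at x)"
  shows "partial_deriv i (\<lambda>x. p (f x) (g x)) x = p (f x) (partial_deriv i g x) + p (partial_deriv i f x) (g x)"
  using partial_deriv_eq[OF bounded_bilinear.FDERIV[OF assms(1) assms(2,3)[THEN differentiable_has_derivative]], of i]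
  by (simp add: partial_deriv_def)

lemma Ck_Suc_differentiable: "Ck (Suc k) f \<Longrightarrow> f differentiable (at x)"
  by simp

section \<open>C^1 functions of bounded support on the whole space\<close>

lemma partial_deriv_zero:
  assumes "x \<notin> closure {x. f x \<noteq> 0}"
  shows "partial_deriv i f x = 0"
proof -
  have "eventually (\<lambda>y. y \<in> - closure {x. f x \<noteq> 0}) (nhds x)"
    using assms by (intro eventually_nhds_in_open) auto
  then have "eventually (\<lambda>y. f y = 0) (at x)"
    unfolding eventually_at_filter by eventually_elim (use closure_subset[of "{x. f x \<noteq> 0}"] in auto)
  moreover have "f x = 0" using assms closure_subset[of "{x. f x \<noteq> 0}"] by auto
  ultimately have "(f has_derivative (\<lambda>_. 0)) (at x)"
    by (intro has_derivative_transform_eventually[OF has_derivative_const[of 0]]) (auto elim: eventually_mono)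
  then show ?thesis by (rule partial_deriv_eq)
qed

definition Cc1 :: "('a::euclidean_space \<Rightarrow> 'b::euclidean_space) \<Rightarrow> bool" where
  "Cc1 f \<longleftrightarrow> Ck 1 f \<and> bounded {x. f x \<noteq> 0}"

lemma Cc1_Ck: "Cc1 f \<Longrightarrow> Ck (Suc 0) f"
  by (simp add: Cc1_def)

lemma Cc1_differentiable: "Cc1 f \<Longrightarrow> f differentiable (at x)"
  using Ck_Suc_differentiable[OF Cc1_Ck] .

lemma Cc1_continuous: "Cc1 f \<Longrightarrow> continuous_on UNIV f"
  using Ck_continuous[OF Cc1_Ck] .

lemma Cc1_continuous_partial: "Cc1 f \<Longrightarrow> i \<in> Basis \<Longrightarrow> continuous_on UNIV (partial_deriv i f)"
  using Ck_partial[OF Cc1_Ck] by force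

lemma Cc1_diff: "Cc1 f \<Longrightarrow> Cc1 g \<Longrightarrow> Cc1 (\<lambda>x. f x - g x)"
  unfolding Cc1_def
  by (auto intro!: Ck_diff simp del: Ck.simps(2))
     (rule bounded_subset[of "{x. f x \<noteq> 0} \<union> {x. g x \<noteq> 0}"], auto)

lemma partial_deriv_diff:
  assumes "f differentiable (at x)" "g differentiable (at x)"
  shows "partial_deriv i (\<lambda>x. f x - g x) x = partial_deriv i f x - partial_deriv i g x"
  using partial_deriv_eq[OF has_derivative_diff[OF assms[THEN differentiable_has_derivative]], of i]
  by (simp add: partial_deriv_def)

lemma Cc1_bilinear:
  assumes "bounded_bilinear p" "Ck (Suc 0) f" "Cc1 g"
  shows "Cc1 (\<lambda>x. p (f x) (g x))"
proof -
  have "{x. p (f x) (g x) \<noteq> 0} \<subseteq> {x. g x \<noteq> 0}"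
    using bounded_bilinear.zero_right[OF assms(1)] by force
  with assms(3) have "bounded {x. p (f x) (g x) \<noteq> 0}"
    unfolding Cc1_def by (blast intro: bounded_subset)
  then show ?thesis
    using Ck_bilinear[OF assms(1,2) Cc1_Ck[OF assms(3)]] unfolding Cc1_def by simp
qed

text \<open>Expanded in partial derivatives, from which it inherits continuity and support;
  \<open>frechet_derivative_dir_deriv\<close> identifies it with the derivative applied to
  \<open>v\<close>.\<close>

definition dir_deriv :: "'a::euclidean_space \<Rightarrow> ('a \<Rightarrow> 'b::euclidean_space) \<Rightarrow> 'a \<Rightarrow> 'b" where
  "dir_deriv v f x = (\<Sum>i\<in>Basis. (v \<bullet> i) *\<^sub>R partial_deriv i f x)"

lemma dir_deriv_Basis: "i \<in> Basis \<Longrightarrow> dir_deriv i f = partial_deriv i f"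
  unfolding dir_deriv_def
  by (rule ext, subst sum.remove[of _ i]) (auto simp: inner_Basis intro!: sum.neutral split: if_splits)

lemma frechet_derivative_dir_deriv:
  assumes "f differentiable (at x)"
  shows "frechet_derivative f (at x) v = dir_deriv v f x"
proof -
  have "linear (frechet_derivative f (at x))"
    using differentiable_has_derivative[OF assms] has_derivative_linear by blast
  then have "frechet_derivative f (at x) (\<Sum>i\<in>Basis. (v \<bullet> i) *\<^sub>R i) = (\<Sum>i\<in>Basis. (v \<bullet> i) *\<^sub>R frechet_derivative f (at x) i)"
    by (simp add: linear_sum linear_scale)
  then show ?thesis by (simp add: dir_deriv_def partial_deriv_def euclidean_representation)
qed

lemma Cc1_line_derivative:
  assumes "Cc1 f"
  shows "((\<lambda>t. f (x + t *\<^sub>R v)) has_vector_derivative dir_deriv v f (x + t *\<^sub>R v)) (at t within S)"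
proof -
  have "((\<lambda>t. x + t *\<^sub>R v) has_derivative (\<lambda>s. s *\<^sub>R v)) (at t within S)"
    by (auto intro!: derivative_eq_intros)
  from has_derivative_compose[OF this differentiable_has_derivative[OF Cc1_differentiable[OF assms]]]
  have "((\<lambda>t. f (x + t *\<^sub>R v)) has_derivative (\<lambda>s. frechet_derivative f (at (x + t *\<^sub>R v)) (s *\<^sub>R v))) (at t within S)" .
  moreover have "frechet_derivative f (at (x + t *\<^sub>R v)) (s *\<^sub>R v) = s *\<^sub>R dir_deriv v f (x + t *\<^sub>R v)" for s
    by (subst frechet_derivative_dir_deriv[OF Cc1_differentiable[OF assms]])
       (simp add: dir_deriv_def scaleR_sum_right)
  ultimately show ?thesis by (simp add: has_vector_derivative_def)
qed

lemma Cc1_continuous_dir_deriv: "Cc1 f \<Longrightarrow> continuous_on UNIV (dir_deriv v f)"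
  unfolding dir_deriv_def by (intro continuous_intros Cc1_continuous_partial)

lemma continuous_bounded_support_bound:
  fixes f :: "'a::euclidean_space \<Rightarrow> 'b::euclidean_space"
  assumes "continuous_on UNIV f" "bounded S" "\<And>x. x \<notin> S \<Longrightarrow> f x = 0"
  obtains M where "M > 0" "\<And>x. norm (f x) \<le> M"
proof -
  have "compact (f ` closure S)"
    using assms by (intro compact_continuous_image) (auto intro: continuous_on_subset simp: compact_closure)
  then obtain M where M: "M > 0" "\<And>y. y \<in> f ` closure S \<Longrightarrow> norm y \<le> M"
    using compact_imp_bounded bounded_pos by metis
  have "norm (f x) \<le> M" for x
    using M assms(3)[of x] closure_subset[of S] by (cases "x \<in> S") auto
  with M(1) that show thesis by blast
qed

lemma Cc1_dir_deriv_zero: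
  assumes "x \<notin> closure {x. f x \<noteq> 0}" shows "dir_deriv v f x = 0"
  using partial_deriv_zero[OF assms] by (simp add: dir_deriv_def)

lemma integrable_continuous_bounded_support:
  fixes f :: "'a::euclidean_space \<Rightarrow> 'b::euclidean_space"
  assumes "continuous_on UNIV f" "bounded S" "\<And>x. x \<notin> S \<Longrightarrow> f x = 0"
  shows "integrable lborel f"
proof -
  obtain M where M: "M > 0" "\<And>x. norm (f x) \<le> M"
    using continuous_bounded_support_bound[OF assms] by blast
  obtain R where R: "S \<subseteq> cball 0 R" using assms(2) by (auto simp: bounded_iff subset_eq)
  show ?thesis
  proof (rule Bochner_Integration.integrable_bound)
    show "integrable lborel (\<lambda>x::'a. M * indicat_real (cball 0 R) x)"
      by (intro integrable_mult_right integrable_real_indicator emeasure_lborel_cball_finite) simp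
    show "f \<in> borel_measurable lborel"
      using borel_measurable_continuous_onI[OF assms(1)] by simp
    show "AE x in lborel. norm (f x) \<le> norm (M * indicat_real (cball 0 R) x)"
    proof (rule AE_I2)
      fix x show "norm (f x) \<le> norm (M * indicat_real (cball 0 R) x)"
        using M(1) M(2)[of x] assms(3)[of x] subsetD[OF R, of x] by (cases "x \<in> S") (auto simp: indicator_def)
    qed
  qed
qed

lemma has_vector_derivative_quotient_limit:
  assumes "(g has_vector_derivative D) (at 0)"
  shows "((\<lambda>h. (g h - g 0) /\<^sub>R h) \<longlongrightarrow> D) (at 0)"
proof -
  have "((\<lambda>h. norm (g h - g 0 - h *\<^sub>R D) / norm h) \<longlongrightarrow> 0) (at 0)"
    using assms by (simp add: has_vector_derivative_def has_derivative_iff_norm)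
  then have "((\<lambda>h. norm ((g h - g 0) /\<^sub>R h - D)) \<longlongrightarrow> 0) (at 0)"
  proof (rule Lim_transform_eventually)
    have "norm (g h - g 0 - h *\<^sub>R D) / norm h = norm ((g h - g 0) /\<^sub>R h - D)" if "h \<noteq> 0" for h
    proof -
      have "(g h - g 0) /\<^sub>R h - D = (g h - g 0 - h *\<^sub>R D) /\<^sub>R h"
        using that by (simp add: scaleR_diff_right)
      then show ?thesis by (simp add: divide_inverse mult.commute)
    qed
    then show "\<forall>\<^sub>F h in at 0. norm (g h - g 0 - h *\<^sub>R D) / norm h = norm ((g h - g 0) /\<^sub>R h - D)"
      by (simp add: eventually_at_filter)
  qed
  then show ?thesis by (simp add: tendsto_norm_zero_iff LIM_zero_iff)
qed

text \<open>Dominated convergence: by the mean value inequality all difference quotients obey the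
  bound of the directional derivative, and since the increments are at most \<open>norm v\<close>
  they vanish outside one common ball, where \<open>F 0 = 0\<close> gives \<open>0\<close>. The
  identity as \<open>F\<close> yields integration by parts, the squared norm yields the translation
  estimate.\<close>

lemma Cc1_quotient_limit:
  fixes f :: "'a::euclidean_space \<Rightarrow> 'b::euclidean_space"
    and F :: "'b \<Rightarrow> 'c::euclidean_space"
  assumes f: "Cc1 f" and F: "continuous_on UNIV F" "F 0 = 0"
  shows "(\<lambda>n. \<integral>x. F (real (Suc n) *\<^sub>R (f (x + (1 / real (Suc n)) *\<^sub>R v) - f x)) \<partial>lborel)
     \<longlonglongrightarrow> (\<integral>x. F (dir_deriv v f x) \<partial>lborel)"
proof -
  define S where "S = {x. f x \<noteq> 0}"
  have bS: "bounded S" using f by (simp add: S_def Cc1_def)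
  obtain R where R: "S \<subseteq> cball 0 R" using bS by (auto simp: bounded_iff subset_eq)
  have cont_d: "continuous_on UNIV (dir_deriv v f)" by (rule Cc1_continuous_dir_deriv[OF f])
  obtain M where M: "M > 0" "\<And>x. norm (dir_deriv v f x) \<le> M"
    using continuous_bounded_support_bound[OF cont_d bounded_closure[OF bS]] Cc1_dir_deriv_zero
    unfolding S_def by metis
  define D where "D n x = real (Suc n) *\<^sub>R (f (x + (1 / real (Suc n)) *\<^sub>R v) - f x)" for n x
  have D_bound: "norm (D n x) \<le> M" for n x
  proof -
    have "norm ((f (x + (1 / real (Suc n)) *\<^sub>R v)) - f (x + 0 *\<^sub>R v)) \<le> M * norm (1 / real (Suc n) - 0)"
    proof (rule differentiable_bound[OF convex_UNIV])
      show "((\<lambda>t. f (x + t *\<^sub>R v)) has_derivative (\<lambda>s. s *\<^sub>R dir_deriv v f (x + t *\<^sub>R v))) (at t within UNIV)" for t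
        using Cc1_line_derivative[OF f] by (simp add: has_vector_derivative_def)
      show "onorm (\<lambda>s. s *\<^sub>R dir_deriv v f (x + t *\<^sub>R v)) \<le> M" for t
        by (rule onorm_bound) (use M in \<open>auto simp: mult.commute[of M] intro: mult_left_mono\<close>)
    qed auto
    then show ?thesis
      by (simp add: D_def del: of_nat_Suc) (simp add: field_simps del: of_nat_Suc)
  qed
  have D_zero: "D n x = 0" if "x \<notin> cball 0 (R + norm v)" for n x
  proof -
    have "norm ((1 / real (Suc n)) *\<^sub>R v) \<le> norm v"
      by (simp add: divide_le_eq mult_le_cancel_left1)
    moreover have "norm x > R + norm v" using that by simp
    moreover have "norm x - norm ((1 / real (Suc n)) *\<^sub>R v) \<le> norm (x + (1 / real (Suc n)) *\<^sub>R v)"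
      by (rule norm_diff_ineq)
    ultimately have "norm (x + (1 / real (Suc n)) *\<^sub>R v) > R" "norm x > R"
      using norm_ge_zero[of v] by linarith+
    then have "x + (1 / real (Suc n)) *\<^sub>R v \<notin> S" "x \<notin> S"
      using R by auto
    then show ?thesis by (simp add: D_def S_def)
  qed
  have D_lim: "(\<lambda>n. D n x) \<longlonglongrightarrow> dir_deriv v f x" for x
  proof -
    have "((\<lambda>t. f (x + t *\<^sub>R v)) has_vector_derivative dir_deriv v f (x + 0 *\<^sub>R v)) (at 0)"
      by (rule Cc1_line_derivative[OF f])
    then have "((\<lambda>h. (f (x + h *\<^sub>R v) - f x) /\<^sub>R h) \<longlongrightarrow> dir_deriv v f x) (at 0)"
      by (auto dest: has_vector_derivative_quotient_limit)
    moreover have "filterlim (\<lambda>n. 1 / real (Suc n)) (at 0) sequentially"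
      by real_asymp
    ultimately have "(\<lambda>n. (f (x + (1 / real (Suc n)) *\<^sub>R v) - f x) /\<^sub>R (1 / real (Suc n))) \<longlonglongrightarrow> dir_deriv v f x"
      by (rule filterlim_compose)
    then show ?thesis by (simp add: D_def)
  qed
  have F_cont: "continuous_on UNIV (\<lambda>x. F (D n x))" for n
    unfolding D_def
    by (intro continuous_on_compose2[OF F(1)] continuous_intros continuous_on_compose2[OF Cc1_continuous[OF f]]) auto
  have cF: "continuous_on (cball 0 M) F" using F(1) continuous_on_subset by blast
  then have "compact (F ` cball 0 M)" by (intro compact_continuous_image) auto
  then obtain B where B: "B > 0" "\<And>y. y \<in> F ` cball 0 M \<Longrightarrow> norm y \<le> B"
    using compact_imp_bounded bounded_pos by metis
  show ?thesis
    unfolding D_def[symmetric]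
  proof (rule integral_dominated_convergence)
    show "(\<lambda>x. F (dir_deriv v f x)) \<in> borel_measurable lborel"
      using borel_measurable_continuous_onI[OF continuous_on_compose2[OF F(1) cont_d]] by simp
    show "(\<lambda>x. F (D n x)) \<in> borel_measurable lborel" for n
      using borel_measurable_continuous_onI[OF F_cont] by simp
    show "integrable lborel (\<lambda>x::'a. B * indicat_real (cball 0 (R + norm v)) x)"
      by (intro integrable_mult_right integrable_real_indicator emeasure_lborel_cball_finite) simp
    show "AE x in lborel. (\<lambda>n. F (D n x)) \<longlonglongrightarrow> F (dir_deriv v f x)"
      using F(1) D_lim by (intro AE_I2 continuous_on_tendsto_compose[OF F(1)]) auto
    show "AE x in lborel. norm (F (D n x)) \<le> B * indicat_real (cball 0 (R + norm v)) x" for n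
    proof (rule AE_I2)
      fix x
      show "norm (F (D n x)) \<le> B * indicat_real (cball 0 (R + norm v)) x"
      proof (cases "x \<in> cball 0 (R + norm v)")
        case True
        then show ?thesis using B(2)[of "F (D n x)"] D_bound[of n x] by (auto simp: indicator_def)
      qed (simp add: D_zero F)
    qed
  qed
qed

lemma lborel_integral_translation:
  fixes f :: "'a::euclidean_space \<Rightarrow> 'b::euclidean_space"
  assumes [measurable]: "f \<in> borel_measurable borel"
  shows "(\<integral>x. f (x + a) \<partial>lborel) = (\<integral>x. f x \<partial>lborel)"
proof -
  have "(\<integral>x. f x \<partial>lborel) = (\<integral>x. f x \<partial>distr lborel borel ((+) a))"
    by (simp add: lborel_distr_plus)
  also have "\<dots> = (\<integral>x. f (a + x) \<partial>lborel)"
    by (rule integral_distr) auto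
  finally show ?thesis by (simp add: add.commute)
qed

lemma Cc1_integrable:
  assumes "Cc1 f" shows "integrable lborel f"
  using assms by (intro integrable_continuous_bounded_support[OF Cc1_continuous]) (auto simp: Cc1_def)

lemma Cc1_integrable_translation:
  fixes f :: "'a::euclidean_space \<Rightarrow> 'b::euclidean_space"
  assumes "Cc1 f" shows "integrable lborel (\<lambda>x. f (x + a))"
proof -
  have "integrable (distr lborel borel ((+) a)) f"
    using Cc1_integrable[OF assms] by (simp add: lborel_distr_plus)
  then have "integrable lborel (\<lambda>x. f (a + x))"
    by (subst (asm) integrable_distr_eq) (auto intro: borel_measurable_continuous_onI Cc1_continuous[OF assms])
  then show ?thesis by (simp add: add.commute)
qed

text \<open>By translation invariance every difference quotient has integral \<open>0\<close>, and
  the derivative is their limit.\<close>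

lemma integral_partial_deriv_eq_0:
  fixes f :: "'a::euclidean_space \<Rightarrow> 'b::euclidean_space"
  assumes f: "Cc1 f" and i: "i \<in> Basis"
  shows "(\<integral>x. partial_deriv i f x \<partial>lborel) = 0"
proof -
  have "(\<integral>x. real (Suc n) *\<^sub>R (f (x + (1 / real (Suc n)) *\<^sub>R i) - f x) \<partial>lborel) = 0" for n
    using lborel_integral_translation[OF borel_measurable_continuous_onI[OF Cc1_continuous[OF f]]]
    by (simp add: Bochner_Integration.integral_diff[OF Cc1_integrable_translation[OF f] Cc1_integrable[OF f]])
  then show ?thesis
    using Cc1_quotient_limit[OF f continuous_on_id, of i] i
    by (simp add: dir_deriv_Basis LIMSEQ_const_iff)
qed

text \<open>Only \<open>f\<close> carries the bounded support. This leaves room for a coordinate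
  function as \<eta>, which is how the case of constant modulus is excluded later.\<close>

lemma integral_by_parts:
  fixes \<eta> :: "'a::euclidean_space \<Rightarrow> real" and f :: "'a \<Rightarrow> 'b::euclidean_space"
  assumes \<eta>: "Ck (Suc 0) \<eta>" and f: "Cc1 f" and i: "i \<in> Basis"
  shows "(\<integral>x. partial_deriv i \<eta> x *\<^sub>R f x \<partial>lborel) = - (\<integral>x. \<eta> x *\<^sub>R partial_deriv i f x \<partial>lborel)"
proof -
  have p: "partial_deriv i (\<lambda>x. \<eta> x *\<^sub>R f x) x = \<eta> x *\<^sub>R partial_deriv i f x + partial_deriv i \<eta> x *\<^sub>R f x" for x
    by (rule partial_deriv_bilinear[OF bounded_bilinear_scaleR Ck_Suc_differentiable[OF \<eta>] Cc1_differentiable[OF f]])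
  have b: "bounded (closure {x. f x \<noteq> 0})" using f by (simp add: Cc1_def bounded_closure)
  have 1: "integrable lborel (\<lambda>x. \<eta> x *\<^sub>R partial_deriv i f x)"
    by (rule integrable_continuous_bounded_support[OF _ b])
       (auto intro!: continuous_intros Ck_continuous[OF \<eta>] Cc1_continuous_partial[OF f i] simp: partial_deriv_zero)
  have 2: "integrable lborel (\<lambda>x. partial_deriv i \<eta> x *\<^sub>R f x)"
    using \<eta> i closure_subset[of "{x. f x \<noteq> 0}"]
    by (intro integrable_continuous_bounded_support[OF _ b])
       (auto intro!: continuous_intros Cc1_continuous[OF f])
  have "(\<integral>x. partial_deriv i (\<lambda>x. \<eta> x *\<^sub>R f x) x \<partial>lborel) = 0"
    by (rule integral_partial_deriv_eq_0[OF Cc1_bilinear[OF bounded_bilinear_scaleR \<eta> f] i])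
  then show ?thesis
    unfolding p using 1 2 by (simp add: add_eq_0_iff)
qed

section \<open>Norms over the whole space and translations\<close>

lemma L2_UNIV_norm:
  assumes "f \<in> borel_measurable borel"
  shows "(L2_norm UNIV f)\<^sup>2 = (\<integral>x. (norm (f x))\<^sup>2 \<partial>lborel)"
  unfolding L2_norm_power2 lebesgue_on_UNIV_eq by (rule integral_completion) (use assms in measurable)

lemma L2_UNIV_I:
  assumes "f \<in> borel_measurable borel" "integrable lborel (\<lambda>x. (norm (f x))\<^sup>2)"
  shows "f \<in> L2 UNIV"
proof (rule L2_I; unfold lebesgue_on_UNIV_eq)
  show "f \<in> borel_measurable lebesgue"
    using assms(1) by (simp add: measurable_completion)
  show "integrable lebesgue (\<lambda>x. (norm (f x))\<^sup>2)"
    using assms by (subst integrable_completion) measurable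
qed

lemma L2_UNIV_continuous:
  fixes f :: "'a::euclidean_space \<Rightarrow> 'b::euclidean_space"
  assumes "continuous_on UNIV f" "bounded S" "\<And>x. x \<notin> S \<Longrightarrow> f x = 0"
  shows "f \<in> L2 UNIV"
proof (rule L2_UNIV_I[OF borel_measurable_continuous_onI[OF assms(1)]])
  show "integrable lborel (\<lambda>x. (norm (f x))\<^sup>2)"
    by (rule integrable_continuous_bounded_support[OF _ assms(2)]) (auto intro!: continuous_intros assms)
qed

lemma bounded_translated_support:
  fixes f :: "'a::euclidean_space \<Rightarrow> 'b::zero"
  assumes "bounded {x. f x \<noteq> 0}" shows "bounded {x. f (x + a) \<noteq> 0}"
proof -
  have "{x. f (x + a) \<noteq> 0} = (\<lambda>x. - a + x) ` {x. f x \<noteq> 0}"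
    by (auto simp: image_iff intro!: exI[of _ "_ + a"])
  then show ?thesis using bounded_translation[OF assms, of "- a"] by simp
qed

lemma Cc1_translation_L2:
  assumes f: "Cc1 f"
  shows "(\<lambda>x. f (x + a)) \<in> L2 UNIV"
proof (rule L2_UNIV_continuous)
  show "continuous_on UNIV (\<lambda>x. f (x + a))"
    by (intro continuous_on_compose2[OF Cc1_continuous[OF f]] continuous_intros) auto
  show "bounded {x. f (x + a) \<noteq> 0}"
    using f by (intro bounded_translated_support) (simp add: Cc1_def)
qed simp

lemma L2_UNIV_norm_translation:
  fixes f :: "'a::euclidean_space \<Rightarrow> 'b::euclidean_space"
  assumes [measurable]: "f \<in> borel_measurable borel"
  shows "L2_norm UNIV (\<lambda>x. f (x + a)) = L2_norm UNIV f"
proof -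
  have "(L2_norm UNIV (\<lambda>x. f (x + a)))\<^sup>2 = (L2_norm UNIV f)\<^sup>2"
    using lborel_integral_translation[of "\<lambda>x. (norm (f x))\<^sup>2" a] by (simp add: L2_UNIV_norm)
  then show ?thesis by simp
qed

text \<open>The increment along \<open>v\<close> is split into \<open>n\<close> increments along \<open>v / n\<close>; letting \<open>n \<rightarrow> \<infinity>\<close> brings in
  the derivative.\<close>

lemma L2_translation_le:
  fixes f :: "'a::euclidean_space \<Rightarrow> 'b::euclidean_space"
  assumes f: "Cc1 f"
  shows "L2_norm UNIV (\<lambda>x. f (x + v) - f x) \<le> L2_norm UNIV (dir_deriv v f)"
proof -
  have [measurable]: "f \<in> borel_measurable borel"
    by (rule borel_measurable_continuous_onI[OF Cc1_continuous[OF f]])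
  have L: "(\<lambda>x. f (x + a)) \<in> L2 UNIV" for a by (rule Cc1_translation_L2[OF f])
  have L0: "f \<in> L2 UNIV" using L[of 0] by simp
  have step: "L2_norm UNIV (\<lambda>x. f (x + real k *\<^sub>R w) - f x) \<le> real k * L2_norm UNIV (\<lambda>x. f (x + w) - f x)" for k w
  proof (induction k)
    case (Suc k)
    have "L2_norm UNIV (\<lambda>x. f (x + real (Suc k) *\<^sub>R w) - f x)
       \<le> L2_norm UNIV (\<lambda>x. f (x + real (Suc k) *\<^sub>R w) - f (x + real k *\<^sub>R w)) + L2_norm UNIV (\<lambda>x. f (x + real k *\<^sub>R w) - f x)"
      by (rule L2_norm_triangle_diff[OF L L0 L])
    also have "L2_norm UNIV (\<lambda>x. f (x + real (Suc k) *\<^sub>R w) - f (x + real k *\<^sub>R w)) = L2_norm UNIV (\<lambda>x. f (x + w) - f x)"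
      using L2_UNIV_norm_translation[of "\<lambda>x. f (x + w) - f x" "real k *\<^sub>R w"] by (simp add: algebra_simps)
    finally show ?case using Suc by (simp add: algebra_simps)
  qed simp
  have "(L2_norm UNIV (\<lambda>x. f (x + v) - f x))\<^sup>2 \<le>
      (\<integral>x. (norm (real (Suc n) *\<^sub>R (f (x + (1 / real (Suc n)) *\<^sub>R v) - f x)))\<^sup>2 \<partial>lborel)" for n
  proof -
    have "L2_norm UNIV (\<lambda>x. f (x + v) - f x) \<le> L2_norm UNIV (\<lambda>x. real (Suc n) *\<^sub>R (f (x + (1 / real (Suc n)) *\<^sub>R v) - f x))"
      using step[of "Suc n" "(1 / real (Suc n)) *\<^sub>R v"] by (simp add: L2_norm_scaleR del: of_nat_Suc)
    then have "(L2_norm UNIV (\<lambda>x. f (x + v) - f x))\<^sup>2 \<le> (L2_norm UNIV (\<lambda>x. real (Suc n) *\<^sub>R (f (x + (1 / real (Suc n)) *\<^sub>R v) - f x)))\<^sup>2"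
      by (intro power_mono) auto
    then show ?thesis by (subst (asm) (2) L2_UNIV_norm) auto
  qed
  moreover have "(\<lambda>n. \<integral>x. (norm (real (Suc n) *\<^sub>R (f (x + (1 / real (Suc n)) *\<^sub>R v) - f x)))\<^sup>2 \<partial>lborel)
     \<longlonglongrightarrow> (\<integral>x. (norm (dir_deriv v f x))\<^sup>2 \<partial>lborel)"
    by (rule Cc1_quotient_limit[OF f]) (auto intro!: continuous_intros)
  ultimately have "(L2_norm UNIV (\<lambda>x. f (x + v) - f x))\<^sup>2 \<le> (\<integral>x. (norm (dir_deriv v f x))\<^sup>2 \<partial>lborel)"
    by (intro LIMSEQ_le_const) auto
  also have "\<dots> = (L2_norm UNIV (dir_deriv v f))\<^sup>2"
    by (rule L2_UNIV_norm[symmetric, OF borel_measurable_continuous_onI[OF Cc1_continuous_dir_deriv[OF f]]])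
  finally show ?thesis by (rule power2_le_imp_le) simp
qed

section \<open>Bump functions and the fundamental lemma\<close>

lemma poly_over_exp_tendsto_0: "((\<lambda>x::real. poly P x / exp x) \<longlongrightarrow> 0) at_top"
proof -
  have "((\<lambda>x::real. \<Sum>i\<le>degree P. coeff P i * (x ^ i / exp x)) \<longlongrightarrow> (\<Sum>i\<le>degree P. coeff P i * 0)) at_top"
    by (intro tendsto_intros tendsto_power_div_exp_0)
  then show ?thesis by (simp add: poly_altdef sum_divide_distrib)
qed

text \<open>The classical function \<open>exp (- 1 / t)\<close>, extended by \<open>0\<close>. The
  polynomial factor in \<open>1 / t\<close> makes the family closed under differentiation.\<close>

definition flat_exp :: "real poly \<Rightarrow> real \<Rightarrow> real" where
  "flat_exp P t = (if t > 0 then poly P (1 / t) * exp (- (1 / t)) else 0)"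

text \<open>With \<open>s = 1 / t\<close>, whose derivative is \<open>- s\<^sup>2\<close>, the
  derivative of \<open>P s * exp (- s)\<close> is
  \<open>(P - P') s * s\<^sup>2 * exp (- s)\<close>.\<close>

definition flat_step :: "real poly \<Rightarrow> real poly" where
  "flat_step P = (P - pderiv P) * [:0, 0, 1:]"

lemma flat_exp_derivative:
  "(flat_exp P has_real_derivative flat_exp (flat_step P) t) (at t)"
proof -
  consider "t > 0" | "t < 0" | "t = 0" by linarith
  then show ?thesis
  proof cases
    case 1
    have "((\<lambda>t. poly P (1 / t) * exp (- (1 / t))) has_real_derivative flat_exp (flat_step P) t) (at t)"
      using 1 by (auto intro!: derivative_eq_intros
          simp: flat_exp_def flat_step_def power2_eq_square field_simps)
    then show ?thesis
      by (rule has_field_derivative_transform_within_open[where S = "{0<..}"])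
         (use 1 in \<open>auto simp: flat_exp_def\<close>)
  next
    case 2
    have "((\<lambda>t. 0) has_real_derivative flat_exp (flat_step P) t) (at t)"
      using 2 by (auto simp: flat_exp_def)
    then show ?thesis
      by (rule has_field_derivative_transform_within_open[where S = "{..<0}"])
         (use 2 in \<open>auto simp: flat_exp_def\<close>)
  next
    case 3
    \<comment> \<open>With \<open>s = 1 / h\<close> the right-hand quotient is
      \<open>s * poly P s / exp s\<close>, a polynomial over the exponential as \<open>s\<close>
      grows.\<close>
    have "((\<lambda>h. flat_exp P h / h) \<longlongrightarrow> 0) (at_right 0)"
    proof (rule Lim_transform_eventually)
      show "((\<lambda>h. poly (P * [:0, 1:]) (inverse h) / exp (inverse h)) \<longlongrightarrow> 0) (at_right (0::real))"
        by (rule filterlim_compose[OF poly_over_exp_tendsto_0 filterlim_inverse_at_top_right])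
      show "\<forall>\<^sub>F h in at_right 0. poly (P * [:0, 1:]) (inverse h) / exp (inverse h) = flat_exp P h / h"
        by (auto simp: eventually_at_filter flat_exp_def exp_minus field_simps)
    qed
    moreover have "((\<lambda>h. flat_exp P h / h) \<longlongrightarrow> 0) (at_left 0)"
      by (rule Lim_transform_eventually[OF tendsto_const]) (auto simp: eventually_at_filter flat_exp_def)
    ultimately have "((\<lambda>h. flat_exp P h / h) \<longlongrightarrow> 0) (at 0)"
      by (rule filterlim_split_at[rotated])
    then show ?thesis
      using 3 by (simp add: DERIV_def flat_exp_def)
  qed
qed

lemma Ck_flat_exp: "Ck k f \<Longrightarrow> Ck k (\<lambda>x. flat_exp P (f x))"
  using Ck_compose_real[where g = "\<lambda>m. flat_exp ((flat_step ^^ m) P)" and m = 0]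
  by (simp add: flat_exp_derivative has_real_derivative_iff_has_vector_derivative[symmetric])

definition bump :: "'a::euclidean_space \<Rightarrow> 'a \<Rightarrow> 'a \<Rightarrow> real" where
  "bump a b x = (\<Prod>i\<in>Basis. flat_exp 1 (x \<bullet> i - a \<bullet> i) * flat_exp 1 (b \<bullet> i - x \<bullet> i))"

lemma bump_nonneg: "0 \<le> bump a b x"
  by (auto simp: bump_def flat_exp_def intro!: prod_nonneg)

lemma bump_pos_iff: "0 < bump a b x \<longleftrightarrow> x \<in> box a b"
proof
  show "0 < bump a b x" if "x \<in> box a b"
    using that by (auto simp: bump_def flat_exp_def mem_box intro!: prod_pos)
  show "x \<in> box a b" if "0 < bump a b x"
  proof (rule ccontr)
    assume "x \<notin> box a b"
    then obtain i where "i \<in> Basis" "flat_exp 1 (x \<bullet> i - a \<bullet> i) * flat_exp 1 (b \<bullet> i - x \<bullet> i) = 0"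
      by (auto simp: mem_box flat_exp_def)
    then have "bump a b x = 0" unfolding bump_def by (intro prod_zero) auto
    with that show False by simp
  qed
qed

lemma Ck_bump: "Ck k (bump a b)"
  unfolding bump_def by (intro Ck_prod Ck_mult Ck_flat_exp Ck_diff Ck_inner Ck_const)

lemma test_functions_I:
  assumes "\<And>k. Ck k \<psi>" "bounded S" "closed S" "S \<subseteq> \<Omega>" "\<And>x. x \<notin> S \<Longrightarrow> \<psi> x = 0"
  shows "\<psi> \<in> test_functions \<Omega>"
proof -
  have "closure {x. \<psi> x \<noteq> 0} \<subseteq> S"
    using assms by (intro closure_minimal) auto
  with assms show ?thesis
    unfolding test_functions_def by (auto simp: compact_eq_bounded_closed intro: bounded_subset)
qed

lemma test_functions_Cc1: "\<psi> \<in> test_functions \<Omega> \<Longrightarrow> Cc1 \<psi>"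
  unfolding test_functions_def Cc1_def
  by (auto intro: bounded_subset[OF compact_imp_bounded closure_subset] simp del: One_nat_def)

text \<open>These functions take values between \<open>0\<close> and \<open>1\<close>, have support
  in one fixed closed box, and tend to the indicator of the open box. Testing against them therefore
  turns vanishing pairings into vanishing box integrals.\<close>

lemma bump_indicator_test:
  assumes "cbox a b \<subseteq> \<Omega>"
  shows "(\<lambda>x. 1 - exp (- (real n * bump a b x))) \<in> test_functions \<Omega>"
proof (rule test_functions_I[OF _ _ _ assms])
  show "Ck k (\<lambda>x. 1 - exp (- (real n * bump a b x)))" for k
    by (intro Ck_diff Ck_const Ck_exp Ck_minus Ck_mult Ck_bump)
  fix x assume "x \<notin> cbox a b"
  then have "x \<notin> box a b" using box_subset_cbox by blast
  then have "bump a b x = 0" using bump_pos_iff[of a b x] bump_nonneg[of a b x] by linarith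
  then show "1 - exp (- (real n * bump a b x)) = 0" by simp
qed auto

lemma bump_indicator_tendsto:
  "(\<lambda>n. 1 - exp (- (real n * bump a b x))) \<longlonglongrightarrow> indicat_real (box a b) x"
proof (cases "x \<in> box a b")
  case True
  then have "bump a b x > 0" by (simp add: bump_pos_iff)
  then have "(\<lambda>n. 1 - exp (- (real n * bump a b x))) \<longlonglongrightarrow> 1" by real_asymp
  with True show ?thesis by simp
next
  case False
  then have "bump a b x = 0" using bump_pos_iff[of a b x] bump_nonneg[of a b x] by linarith
  with False show ?thesis by simp
qed

text \<open>Open boxes are stable under intersection and generate the Borel sets, so a Dynkin
  argument extends the vanishing to all Borel sets, where \<open>density_zero\<close>
  applies.\<close>

lemma AE_zero_if_box_integrals_zero:
  fixes G :: "'a::euclidean_space \<Rightarrow> 'b::{banach, second_countable_topology}"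
  assumes G: "integrable lborel G"
    and box0: "\<And>a b. (\<integral>x\<in>box a b. G x \<partial>lborel) = 0"
  shows "AE x in lborel. G x = 0"
proof (rule sigma_finite_measure.density_zero[OF sigma_finite_lborel G])
  have Gm[measurable]: "G \<in> borel_measurable lborel" using G by simp
  have set_int: "set_integrable lborel A G" if "A \<in> sets borel" for A
    using G that unfolding set_integrable_def by (intro integrable_mult_indicator) auto
  \<comment> \<open>The complement step of the Dynkin argument needs the total integral; it is the
    limit over an exhaustion by boxes.\<close>
  have UNIV0: "(\<integral>x. G x \<partial>lborel) = 0"
  proof -
    have "(\<lambda>n. \<integral>x. indicat_real (box (- (real n *\<^sub>R One)) (real n *\<^sub>R One)) x *\<^sub>R G x \<partial>lborel) \<longlonglongrightarrow> (\<integral>x. G x \<partial>lborel)"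
    proof (rule integral_dominated_convergence)
      show "integrable lborel (\<lambda>x. norm (G x))" using G by simp
      show "AE x in lborel. (\<lambda>n. indicat_real (box (- (real n *\<^sub>R One)) (real n *\<^sub>R One)) x *\<^sub>R G x) \<longlonglongrightarrow> G x"
      proof (rule AE_I2, rule tendsto_eventually)
        fix x :: 'a
        obtain N where N: "norm x < real N" using reals_Archimedean2 by blast
        show "\<forall>\<^sub>F n in sequentially. indicat_real (box (- (real n *\<^sub>R One)) (real n *\<^sub>R One)) x *\<^sub>R G x = G x"
        proof (rule eventually_sequentiallyI[of N])
          fix n assume "N \<le> n"
          then have "\<bar>x \<bullet> i\<bar> < real n" if "i \<in> Basis" for i
            using Basis_le_norm[OF that, of x] N by linarith
          then have "x \<in> box (- (real n *\<^sub>R One)) (real n *\<^sub>R One)"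
            by (auto simp: mem_box abs_less_iff minus_less_iff)
          then show "indicat_real (box (- (real n *\<^sub>R One)) (real n *\<^sub>R One)) x *\<^sub>R G x = G x" by simp
        qed
      qed
    qed (auto simp: indicator_def)
    then show ?thesis
      using box0 by (simp add: set_lebesgue_integral_def LIMSEQ_const_iff)
  qed
  show "set_lebesgue_integral lborel A G = 0" if "A \<in> sets lborel" for A
  proof -
    have stable: "Int_stable (range (\<lambda>(a, b). box a b :: 'a set))"
      by (auto simp: Int_stable_def box_Int_box)
    have sub: "range (\<lambda>(a, b). box a b :: 'a set) \<subseteq> Pow UNIV" by simp
    have "A \<in> sigma_sets UNIV (range (\<lambda>(a, b). box a b :: 'a set))"
      using that by (simp add: borel_eq_box)
    with stable sub show ?thesis
    proof (induct rule: sigma_sets_induct_disjoint)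
      case (basic A)
      then show ?case using box0 by auto
    next
      case empty
      then show ?case by (simp add: set_lebesgue_integral_def)
    next
      case (compl A)
      then have A: "A \<in> sets borel" by (simp add: borel_eq_box)
      have "(\<integral>x\<in>(UNIV - A) \<union> A. G x \<partial>lborel) = (\<integral>x\<in>UNIV - A. G x \<partial>lborel) + (\<integral>x\<in>A. G x \<partial>lborel)"
        by (rule set_integral_Un) (use A in \<open>auto intro!: set_int\<close>)
      then show ?case using compl UNIV0 by (simp add: set_lebesgue_integral_def)
    next
      case (union A)
      then have A: "A i \<in> sets borel" for i by (auto simp: borel_eq_box)
      have "(\<integral>x\<in>(\<Union>i. A i). G x \<partial>lborel) = (\<Sum>i. \<integral>x\<in>A i. G x \<partial>lborel)"
        by (rule lebesgue_integral_countable_add)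
           (use A union(1) in \<open>auto intro!: set_int simp: disjoint_family_on_def\<close>)
      then show ?case using union by simp
    qed
  qed
qed

lemma AE_lebesgue_on_iff:
  assumes "\<Omega> \<in> sets lebesgue"
  shows "(AE x in lebesgue_on \<Omega>. P x) \<longleftrightarrow> (AE x in lebesgue. x \<in> \<Omega> \<longrightarrow> P x)"
  using assms by (subst AE_restrict_space_iff) auto

lemma lebesgue_on_integral:
  fixes f :: "'a::euclidean_space \<Rightarrow> 'b::{banach, second_countable_topology}"
  assumes "\<Omega> \<in> sets lebesgue"
  shows "(\<integral>x. f x \<partial>lebesgue_on \<Omega>) = (\<integral>x. indicat_real \<Omega> x *\<^sub>R f x \<partial>lebesgue)"
  using assms by (subst integral_restrict_space) auto

lemma lebesgue_on_integrable:
  fixes f :: "'a::euclidean_space \<Rightarrow> 'b::{banach, second_countable_topology}"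
  assumes "\<Omega> \<in> sets lebesgue"
  shows "integrable (lebesgue_on \<Omega>) f \<longleftrightarrow> integrable lebesgue (\<lambda>x. indicat_real \<Omega> x *\<^sub>R f x)"
  using assms by (subst integrable_restrict_space) auto

text \<open>Boxes whose closure lies in \<Omega> have integral \<open>0\<close> by
  \<open>bump_indicator_tendsto\<close>. On one such box the function, cut off to it, has integral
  \<open>0\<close> over every box of the space, since intersections of boxes are boxes. Countably
  many of these boxes cover \<Omega>.\<close>

lemma fundamental_lemma_real:
  fixes g :: "'a::euclidean_space \<Rightarrow> real"
  assumes op: "open \<Omega>" and \<Omega>: "\<Omega> \<in> lmeasurable" and g: "g \<in> L2 \<Omega>"
    and zero: "\<And>\<eta>. \<eta> \<in> test_functions \<Omega> \<Longrightarrow> (\<integral>x. \<eta> x * g x \<partial>lebesgue_on \<Omega>) = 0"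
  shows "AE x in lebesgue_on \<Omega>. g x = 0"
proof -
  have \<Omega>s: "\<Omega> \<in> sets lebesgue" using \<Omega> by blast
  have int: "integrable (lebesgue_on \<Omega>) g" by (rule L2_imp_integrable[OF \<Omega> g])
  have box0: "(\<integral>x. indicat_real (box a b) x * g x \<partial>lebesgue_on \<Omega>) = 0" if ab: "cbox a b \<subseteq> \<Omega>" for a b
  proof -
    have "(\<lambda>n. \<integral>x. (1 - exp (- (real n * bump a b x))) * g x \<partial>lebesgue_on \<Omega>)
        \<longlonglongrightarrow> (\<integral>x. indicat_real (box a b) x * g x \<partial>lebesgue_on \<Omega>)"
    proof (rule integral_dominated_convergence)
      show "integrable (lebesgue_on \<Omega>) (\<lambda>x. \<bar>g x\<bar>)" using int by simp
      have [measurable]: "bump a b \<in> borel_measurable (lebesgue_on \<Omega>)"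
        using borel_measurable_continuous_onI[OF Ck_continuous[OF Ck_bump[of 0 a b]]]
        by (simp add: measurable_completion measurable_restrict_space1)
      have [measurable]: "indicat_real (box a b) \<in> borel_measurable (lebesgue_on \<Omega>)"
        using borel_measurable_indicator[of "box a b" borel]
        by (simp add: measurable_completion measurable_restrict_space1)
      have [measurable]: "g \<in> borel_measurable (lebesgue_on \<Omega>)" using int by simp
      show "(\<lambda>x. indicat_real (box a b) x * g x) \<in> borel_measurable (lebesgue_on \<Omega>)"
        by measurable
      show "(\<lambda>x. (1 - exp (- (real n * bump a b x))) * g x) \<in> borel_measurable (lebesgue_on \<Omega>)" for n
        by measurable
      show "AE x in lebesgue_on \<Omega>. (\<lambda>n. (1 - exp (- (real n * bump a b x))) * g x) \<longlonglongrightarrow> indicat_real (box a b) x * g x"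
        by (intro AE_I2 tendsto_mult bump_indicator_tendsto tendsto_const)
      show "AE x in lebesgue_on \<Omega>. norm ((1 - exp (- (real n * bump a b x))) * g x) \<le> \<bar>g x\<bar>" for n
      proof (rule AE_I2)
        fix x
        have "exp (- (real n * bump a b x)) \<le> 1" using bump_nonneg[of a b x] by simp
        then have "\<bar>1 - exp (- (real n * bump a b x))\<bar> \<le> 1" by (simp add: abs_le_iff)
        then show "norm ((1 - exp (- (real n * bump a b x))) * g x) \<le> \<bar>g x\<bar>"
          by (simp add: abs_mult mult_left_le_one_le)
      qed
    qed
    then show ?thesis
      using zero[OF bump_indicator_test[OF ab]] by (simp add: LIMSEQ_const_iff)
  qed
  have local: "AE x in lebesgue. x \<in> box c d \<longrightarrow> g x = 0" if cd: "cbox c d \<subseteq> \<Omega>" for c d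
  proof -
    have "integrable lebesgue (\<lambda>x. indicat_real \<Omega> x *\<^sub>R g x)"
      using int by (simp only: lebesgue_on_integrable[OF \<Omega>s])
    then have "integrable lebesgue (\<lambda>x. indicat_real (box c d) x *\<^sub>R (indicat_real \<Omega> x *\<^sub>R g x))"
      by (rule integrable_mult_indicator[rotated]) simp
    moreover have "indicat_real (box c d) x *\<^sub>R (indicat_real \<Omega> x *\<^sub>R g x) = indicat_real (box c d) x * g x" for x
      using cd box_subset_cbox[of c d] by (auto simp: indicator_def)
    ultimately have int': "integrable lebesgue (\<lambda>x. indicat_real (box c d) x * g x)" by (simp only:)
    \<comment> \<open>The generator argument works with Borel sets and \<open>lborel\<close>, hence
      the passage to a Borel representative.\<close>
    obtain G where G[measurable]: "G \<in> borel_measurable lborel"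
      and GA: "AE x in lborel. indicat_real (box c d) x * g x = G x"
      using completion_ex_borel_measurable_real[OF borel_measurable_integrable[OF int']] by blast
    have GA': "AE x in lebesgue. indicat_real (box c d) x * g x = G x"
      using GA by (rule AE_completion)
    have Gint: "integrable lborel G"
    proof -
      have "integrable lebesgue G"
        by (rule integrable_cong_AE_imp[OF int'])
           (use GA' in \<open>auto simp: measurable_completion elim: eventually_mono\<close>)
      then show ?thesis by (subst (asm) integrable_completion) auto
    qed
    have "(\<integral>x\<in>box a b. G x \<partial>lborel) = 0" for a b
    proof -
      obtain a' b' where ab': "box a b \<inter> box c d = box a' b'" by (simp add: box_Int_box)
      \<comment> \<open>A nonempty open box has the closed box as its closure, so the inclusion
        passes to \<open>cbox a' b'\<close>; over an empty box the integral is trivially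
        \<open>0\<close>.\<close>
      have sub: "cbox a' b' \<subseteq> \<Omega> \<or> box a' b' = {}"
      proof (cases "box a' b' = {}")
        case False
        have "box a' b' \<subseteq> cbox c d" using ab' box_subset_cbox[of c d] by blast
        then have "cbox a' b' \<subseteq> cbox c d"
          using False closure_box[of a' b'] closure_minimal[OF _ closed_cbox] by metis
        with cd show ?thesis by blast
      qed simp
      have "(\<integral>x\<in>box a b. G x \<partial>lborel) = (\<integral>x\<in>box a b. G x \<partial>lebesgue)"
        unfolding set_lebesgue_integral_def by (rule integral_completion[symmetric]) measurable
      also have "\<dots> = (\<integral>x\<in>box a b. (indicat_real (box c d) x * g x) \<partial>lebesgue)"
        unfolding set_lebesgue_integral_def
      proof (rule integral_cong_AE)
        show "(\<lambda>x. indicat_real (box a b) x *\<^sub>R (indicat_real (box c d) x * g x)) \<in> borel_measurable lebesgue"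
          by (rule borel_measurable_scaleR[OF borel_measurable_indicator borel_measurable_integrable[OF int']]) auto
        show "(\<lambda>x. indicat_real (box a b) x *\<^sub>R G x) \<in> borel_measurable lebesgue"
          by (intro borel_measurable_scaleR borel_measurable_indicator measurable_completion G) auto
      qed (use GA' in \<open>auto elim: eventually_mono\<close>)
      also have "\<dots> = (\<integral>x. indicat_real \<Omega> x *\<^sub>R (indicat_real (box a' b') x * g x) \<partial>lebesgue)"
        unfolding set_lebesgue_integral_def
      proof (rule Bochner_Integration.integral_cong[OF refl])
        fix x
        have "indicat_real (box a b) x * indicat_real (box c d) x = indicat_real (box a' b') x"
          by (simp add: ab'[symmetric] indicator_inter_arith)
        moreover have "x \<in> box a' b' \<Longrightarrow> x \<in> \<Omega>" using ab' cd box_subset_cbox[of c d] by blast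
        ultimately show "indicat_real (box a b) x *\<^sub>R (indicat_real (box c d) x * g x)
            = indicat_real \<Omega> x *\<^sub>R (indicat_real (box a' b') x * g x)"
          by (cases "x \<in> box a' b'") (auto simp: mult.assoc[symmetric])
      qed
      also have "\<dots> = (\<integral>x. indicat_real (box a' b') x * g x \<partial>lebesgue_on \<Omega>)"
        by (rule lebesgue_on_integral[OF \<Omega>s, symmetric])
      also have "\<dots> = 0" using sub box0 by auto
      finally show ?thesis .
    qed
    then have "AE x in lborel. G x = 0" by (rule AE_zero_if_box_integrals_zero[OF Gint])
    then have "AE x in lebesgue. G x = 0" by (rule AE_completion)
    with GA' show ?thesis by eventually_elim (auto simp: indicator_def)
  qed
  \<comment> \<open>Lindelof's theorem reduces the cover to countably many boxes, so that the
    exceptional null sets can be united.\<close>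
  define F where "F = {box c d |c d. cbox c d \<subseteq> \<Omega>}"
  have "\<Omega> \<subseteq> \<Union>F"
  proof
    fix x assume "x \<in> \<Omega>"
    then obtain e where e: "e > 0" "ball x e \<subseteq> \<Omega>" using op open_contains_ball by blast
    obtain c d where "x \<in> box c d" "cbox c d \<subseteq> ball x e"
      using open_contains_cbox[OF open_ball centre_in_ball[THEN iffD2, OF e(1)]] by blast
    with e show "x \<in> \<Union>F" unfolding F_def by blast
  qed
  obtain F' where F': "F' \<subseteq> F" "countable F'" "\<Union>F' = \<Union>F"
    using Lindelof[of F] unfolding F_def by blast
  have "AE x in lebesgue. \<forall>B\<in>F'. x \<in> B \<longrightarrow> g x = 0"
    using F' local unfolding F_def by (subst AE_ball_countable) auto
  moreover have "\<Omega> \<subseteq> \<Union>F'" using F'(3) \<open>\<Omega> \<subseteq> \<Union>F\<close> by simp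
  ultimately have "AE x in lebesgue. x \<in> \<Omega> \<longrightarrow> g x = 0"
    by (auto elim!: eventually_mono)
  then show ?thesis by (simp add: AE_lebesgue_on_iff[OF \<Omega>s])
qed

lemma fundamental_lemma:
  fixes g :: "'a::euclidean_space \<Rightarrow> 'b::euclidean_space"
  assumes op: "open \<Omega>" and \<Omega>: "\<Omega> \<in> lmeasurable" and g: "g \<in> L2 \<Omega>"
    and zero: "\<And>\<eta>. \<eta> \<in> test_functions \<Omega> \<Longrightarrow> (\<integral>x. \<eta> x *\<^sub>R g x \<partial>lebesgue_on \<Omega>) = 0"
  shows "AE x in lebesgue_on \<Omega>. g x = 0"
proof -
  have [measurable]: "g \<in> borel_measurable (lebesgue_on \<Omega>)" by (rule L2_measurable[OF g])
  have "AE x in lebesgue_on \<Omega>. g x \<bullet> b = 0" if b: "b \<in> Basis" for b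
  proof (rule fundamental_lemma_real[OF op \<Omega>])
    show "(\<lambda>x. g x \<bullet> b) \<in> L2 \<Omega>"
      by (rule L2_dominated[OF _ g, of _ 1]) (use Basis_le_norm[OF b] in auto)
    fix \<eta> :: "'a \<Rightarrow> real" assume \<eta>: "\<eta> \<in> test_functions \<Omega>"
    then have c: "continuous_on UNIV \<eta>" using Cc1_continuous[OF test_functions_Cc1] by blast
    obtain M where M: "M > 0" "\<And>x. norm (\<eta> x) \<le> M"
      using continuous_bounded_support_bound[OF c] test_functions_Cc1[OF \<eta>] unfolding Cc1_def by blast
    have "\<eta> \<in> L2 \<Omega>"
      by (rule L2_bounded[OF \<Omega> _ M(2)])
         (use borel_measurable_continuous_onI[OF c] in \<open>simp add: measurable_completion measurable_restrict_space1\<close>)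
    then have "integrable (lebesgue_on \<Omega>) (\<lambda>x. \<eta> x *\<^sub>R g x)"
      by (rule L2_integrable_bilinear[OF bounded_bilinear_scaleR _ g])
    then have "(\<integral>x. \<eta> x *\<^sub>R g x \<partial>lebesgue_on \<Omega>) \<bullet> b = (\<integral>x. (\<eta> x *\<^sub>R g x) \<bullet> b \<partial>lebesgue_on \<Omega>)"
      by (rule Bochner_Integration.integral_inner_left[symmetric])
    then show "(\<integral>x. \<eta> x * (g x \<bullet> b) \<partial>lebesgue_on \<Omega>) = 0"
      using zero[OF \<eta>] by simp
  qed
  then have "AE x in lebesgue_on \<Omega>. \<forall>b\<in>Basis. g x \<bullet> b = 0"
    by (subst AE_finite_all[OF finite_Basis]) auto
  then show ?thesis by eventually_elim (simp add: euclidean_all_zero_iff)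
qed

section \<open>Limits of test functions\<close>

lemma lebesgue_on_integral_eq_lborel:
  fixes h :: "'a::euclidean_space \<Rightarrow> 'b::euclidean_space"
  assumes "\<Omega> \<in> sets lebesgue" "h \<in> borel_measurable borel" "\<And>x. x \<notin> \<Omega> \<Longrightarrow> h x = 0"
  shows "(\<integral>x. h x \<partial>lebesgue_on \<Omega>) = (\<integral>x. h x \<partial>lborel)"
proof -
  have "(\<integral>x. h x \<partial>lebesgue_on \<Omega>) = (\<integral>x. h x \<partial>lebesgue)"
    unfolding lebesgue_on_integral[OF assms(1)]
    by (rule Bochner_Integration.integral_cong) (use assms(3) in \<open>auto simp: indicator_def\<close>)
  also have "\<dots> = (\<integral>x. h x \<partial>lborel)"
    by (rule integral_completion) (use assms(2) in simp)
  finally show ?thesis .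
qed

lemma borel_measurable_lebesgue_on_borel:
  "f \<in> borel_measurable borel \<Longrightarrow> f \<in> borel_measurable (lebesgue_on \<Omega>)"
  by (simp add: measurable_completion measurable_restrict_space1)

lemma continuous_bounded_support_L2:
  fixes f :: "'a::euclidean_space \<Rightarrow> 'b::euclidean_space"
  assumes "\<Omega> \<in> lmeasurable" "continuous_on UNIV f" "bounded S" "\<And>x. x \<notin> S \<Longrightarrow> f x = 0"
  shows "f \<in> L2 \<Omega>"
proof -
  obtain M where "\<And>x. norm (f x) \<le> M"
    using continuous_bounded_support_bound[OF assms(2-4)] by blast
  then show ?thesis
    by (intro L2_bounded[OF assms(1) borel_measurable_lebesgue_on_borel])
       (auto intro: borel_measurable_continuous_onI assms(2))
qed

lemma test_functions_partial_zero:
  assumes "\<psi> \<in> test_functions \<Omega>" "x \<notin> \<Omega>"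
  shows "\<psi> x = 0" "partial_deriv i \<psi> x = 0"
proof -
  have "x \<notin> closure {x. \<psi> x \<noteq> 0}" using assms by (auto simp: test_functions_def)
  then show "partial_deriv i \<psi> x = 0" by (rule partial_deriv_zero)
  show "\<psi> x = 0" using \<open>x \<notin> closure _\<close> closure_subset[of "{x. \<psi> x \<noteq> 0}"] by auto
qed

lemma test_functions_L2:
  assumes "\<Omega> \<in> lmeasurable" "\<psi> \<in> test_functions \<Omega>"
  shows "\<psi> \<in> L2 \<Omega>" "i \<in> Basis \<Longrightarrow> partial_deriv i \<psi> \<in> L2 \<Omega>"
proof -
  note \<psi> = test_functions_Cc1[OF assms(2)]
  have b: "bounded (closure {x. \<psi> x \<noteq> 0})" using \<psi> by (simp add: Cc1_def bounded_closure)
  show "\<psi> \<in> L2 \<Omega>"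
    by (rule continuous_bounded_support_L2[OF assms(1) Cc1_continuous[OF \<psi>] b])
       (use closure_subset[of "{x. \<psi> x \<noteq> 0}"] in auto)
  show "partial_deriv i \<psi> \<in> L2 \<Omega>" if "i \<in> Basis"
    by (rule continuous_bounded_support_L2[OF assms(1) Cc1_continuous_partial[OF \<psi> that] b])
       (rule partial_deriv_zero)
qed

lemma L2_norm_test_UNIV:
  fixes f :: "'a::euclidean_space \<Rightarrow> 'b::euclidean_space"
  assumes "\<Omega> \<in> sets lebesgue" "f \<in> borel_measurable borel" "\<And>x. x \<notin> \<Omega> \<Longrightarrow> f x = 0"
  shows "L2_norm UNIV f = L2_norm \<Omega> f"
proof -
  have "(L2_norm UNIV f)\<^sup>2 = (L2_norm \<Omega> f)\<^sup>2"
    unfolding L2_norm_power2[of \<Omega>] L2_UNIV_norm[OF assms(2)]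
    by (rule lebesgue_on_integral_eq_lborel[symmetric]) (use assms in auto)
  then show ?thesis by simp
qed

section \<open>The complex inner product\<close>

lemma L2_inner_integrable: "f \<in> L2 \<Omega> \<Longrightarrow> g \<in> L2 \<Omega> \<Longrightarrow> integrable (lebesgue_on \<Omega>) (\<lambda>x. f x * cnj (g x))"
proof (rule L2_integrable_bilinear[where p = "\<lambda>a b. a * cnj b"])
  show "bounded_bilinear (\<lambda>a b. a * cnj b)"
    by (rule bounded_bilinear.comp[OF bounded_bilinear_mult bounded_linear_ident bounded_linear_cnj])
qed

lemma L2_inner_lin:
  assumes "f \<in> L2 \<Omega>" "g \<in> L2 \<Omega>" "h \<in> L2 \<Omega>"
  shows "L2_inner \<Omega> (\<lambda>x. a * f x + b * g x) h = a * L2_inner \<Omega> f h + b * L2_inner \<Omega> g h"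
  unfolding L2_inner_def using L2_inner_integrable[OF assms(1,3)] L2_inner_integrable[OF assms(2,3)]
  by (simp add: distrib_right mult.assoc)

lemma L2_inner_commute: "L2_inner \<Omega> g f = cnj (L2_inner \<Omega> f g)"
  unfolding L2_inner_def by (subst Bochner_Integration.integral_cnj[symmetric]) (simp add: mult.commute)

lemma L2_inner_self: "f \<in> L2 \<Omega> \<Longrightarrow> L2_inner \<Omega> f f = complex_of_real ((L2_norm \<Omega> f)\<^sup>2)"
  unfolding L2_inner_def L2_norm_power2
  by (simp only: complex_norm_square[symmetric] integral_complex_of_real)

lemma L2_inner_cong_AE:
  assumes "f \<in> L2 \<Omega>" "f' \<in> L2 \<Omega>" "g \<in> L2 \<Omega>" "g' \<in> L2 \<Omega>"
    and "AE x in lebesgue_on \<Omega>. f x = f' x" "AE x in lebesgue_on \<Omega>. g x = g' x"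
  shows "L2_inner \<Omega> f g = L2_inner \<Omega> f' g'"
  unfolding L2_inner_def
proof (rule integral_cong_AE)
  show "AE x in lebesgue_on \<Omega>. f x * cnj (g x) = f' x * cnj (g' x)"
    using assms(5,6) by eventually_elim simp
qed (use L2_inner_integrable[OF assms(1,3)] L2_inner_integrable[OF assms(2,4)] in auto)

lemma L2_inner_bound:
  assumes "f \<in> L2 \<Omega>" "g \<in> L2 \<Omega>"
  shows "cmod (L2_inner \<Omega> f g) \<le> L2_norm \<Omega> f * L2_norm \<Omega> g"
  unfolding L2_inner_def
  by (rule L2_bilinear_bound[where p = "\<lambda>a b. a * cnj b"])
     (auto simp: norm_mult assms intro: bounded_bilinear.comp[OF bounded_bilinear_mult bounded_linear_ident bounded_linear_cnj])

text \<open>\<open>grad_approx \<Omega> f G\<close> says that \<open>f\<close> is in \<open>H\<^sup>1\<^sub>0(\<Omega>)\<close> with gradient \<open>G\<close>. Unlike \<open>H10\<close> it does not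
  refer to the representative chosen by \<open>weak_partial\<close>.\<close>

definition grad_approx ::
  "'a::euclidean_space set \<Rightarrow> ('a \<Rightarrow> 'b::euclidean_space) \<Rightarrow> ('a \<Rightarrow> 'a \<Rightarrow> 'b) \<Rightarrow> bool" where
  "grad_approx \<Omega> f G \<longleftrightarrow> f \<in> L2 \<Omega> \<and> (\<forall>i\<in>Basis. G i \<in> L2 \<Omega>) \<and>
     (\<exists>\<psi>. (\<forall>n. \<psi> n \<in> test_functions \<Omega>) \<and>
       (\<lambda>n. L2_norm \<Omega> (\<lambda>x. \<psi> n x - f x)) \<longlonglongrightarrow> 0 \<and>
       (\<forall>i\<in>Basis. (\<lambda>n. L2_norm \<Omega> (\<lambda>x. partial_deriv i (\<psi> n) x - G i x)) \<longlonglongrightarrow> 0))"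

section \<open>Weak gradients and H10 on a bounded open set\<close>

locale bounded_open_set =
  fixes \<Omega> :: "'a::euclidean_space set"
  assumes open_\<Omega>: "open \<Omega>" and bounded_\<Omega>: "bounded \<Omega>"
begin

lemma lmeasurable_\<Omega>: "\<Omega> \<in> lmeasurable"
  using open_\<Omega> bounded_\<Omega> by (rule lmeasurable_open[rotated])

lemma sets_\<Omega>: "\<Omega> \<in> sets lebesgue"
  using lmeasurable_\<Omega> by blast

lemmas test_L2 = test_functions_L2[OF lmeasurable_\<Omega>]

lemma test_by_parts:
  fixes \<eta> :: "'a \<Rightarrow> real" and \<psi> :: "'a \<Rightarrow> 'b::euclidean_space"
  assumes \<eta>: "Ck (Suc 0) \<eta>" and \<psi>: "\<psi> \<in> test_functions \<Omega>" and i: "i \<in> Basis"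
  shows "(\<integral>x. partial_deriv i \<eta> x *\<^sub>R \<psi> x \<partial>lebesgue_on \<Omega>) = - (\<integral>x. \<eta> x *\<^sub>R partial_deriv i \<psi> x \<partial>lebesgue_on \<Omega>)"
proof -
  note \<psi>' = test_functions_Cc1[OF \<psi>]
  have c: "continuous_on UNIV \<eta>" "continuous_on UNIV (partial_deriv i \<eta>)"
    using Ck_continuous[OF \<eta>] \<eta> i by auto
  have "(\<integral>x. partial_deriv i \<eta> x *\<^sub>R \<psi> x \<partial>lebesgue_on \<Omega>) = (\<integral>x. partial_deriv i \<eta> x *\<^sub>R \<psi> x \<partial>lborel)"
    by (rule lebesgue_on_integral_eq_lborel[OF sets_\<Omega>])
       (auto intro!: borel_measurable_continuous_onI continuous_intros c Cc1_continuous[OF \<psi>']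
          simp: test_functions_partial_zero[OF \<psi>])
  moreover have "(\<integral>x. \<eta> x *\<^sub>R partial_deriv i \<psi> x \<partial>lebesgue_on \<Omega>) = (\<integral>x. \<eta> x *\<^sub>R partial_deriv i \<psi> x \<partial>lborel)"
    by (rule lebesgue_on_integral_eq_lborel[OF sets_\<Omega>])
       (auto intro!: borel_measurable_continuous_onI continuous_intros c Cc1_continuous_partial[OF \<psi>' i]
          simp: test_functions_partial_zero[OF \<psi>])
  ultimately show ?thesis
    using integral_by_parts[OF \<eta> \<psi>' i] by simp
qed

text \<open>Both sides of the integration by parts for the approximating test functions are
  continuous in \<open>L2\<close>.\<close>

lemma grad_approx_weak_partial:
  fixes f :: "'a \<Rightarrow> 'b::euclidean_space"
  assumes "grad_approx \<Omega> f G" and i: "i \<in> Basis"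
  shows "has_weak_partial \<Omega> i f (G i)"
  unfolding has_weak_partial_def
proof (intro conjI allI impI)
  show f: "f \<in> L2 \<Omega>" and G: "G i \<in> L2 \<Omega>" using assms by (auto simp: grad_approx_def)
  obtain \<psi> where \<psi>: "\<And>n. \<psi> n \<in> test_functions \<Omega>"
      "(\<lambda>n. L2_norm \<Omega> (\<lambda>x. \<psi> n x - f x)) \<longlonglongrightarrow> 0"
      "(\<lambda>n. L2_norm \<Omega> (\<lambda>x. partial_deriv i (\<psi> n) x - G i x)) \<longlonglongrightarrow> 0"
    using assms unfolding grad_approx_def by blast
  fix \<eta> :: "'a \<Rightarrow> real" assume \<eta>: "\<eta> \<in> test_functions \<Omega>"
  have "(\<lambda>n. \<integral>x. partial_deriv i \<eta> x *\<^sub>R \<psi> n x \<partial>lebesgue_on \<Omega>) \<longlonglongrightarrow> (\<integral>x. partial_deriv i \<eta> x *\<^sub>R f x \<partial>lebesgue_on \<Omega>)"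
    by (rule L2_bilinear_tendsto[OF bounded_bilinear_scaleR _ test_L2(2)[OF \<eta> i] test_L2(1)[OF \<psi>(1)] f \<psi>(2)]) simp
  moreover have "(\<lambda>n. \<integral>x. \<eta> x *\<^sub>R partial_deriv i (\<psi> n) x \<partial>lebesgue_on \<Omega>) \<longlonglongrightarrow> (\<integral>x. \<eta> x *\<^sub>R G i x \<partial>lebesgue_on \<Omega>)"
    by (rule L2_bilinear_tendsto[OF bounded_bilinear_scaleR _ test_L2(1)[OF \<eta>] test_L2(2)[OF \<psi>(1) i] G \<psi>(3)]) simp
  moreover have "(\<integral>x. partial_deriv i \<eta> x *\<^sub>R \<psi> n x \<partial>lebesgue_on \<Omega>) = - (\<integral>x. \<eta> x *\<^sub>R partial_deriv i (\<psi> n) x \<partial>lebesgue_on \<Omega>)" for n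
    by (rule test_by_parts[OF Cc1_Ck[OF test_functions_Cc1[OF \<eta>]] \<psi>(1) i])
  ultimately show "(\<integral>x. partial_deriv i \<eta> x *\<^sub>R f x \<partial>lebesgue_on \<Omega>) = - (\<integral>x. \<eta> x *\<^sub>R G i x \<partial>lebesgue_on \<Omega>)"
    using LIMSEQ_unique[OF _ tendsto_minus] by simp
qed

text \<open>The fundamental lemma applied to the difference. This makes the choice inside
  \<open>weak_partial\<close> harmless.\<close>

lemma weak_partial_unique:
  fixes f :: "'a \<Rightarrow> 'b::euclidean_space"
  assumes g: "has_weak_partial \<Omega> i f g" and h: "has_weak_partial \<Omega> i f h"
  shows "AE x in lebesgue_on \<Omega>. g x = h x"
proof -
  have L: "g \<in> L2 \<Omega>" "h \<in> L2 \<Omega>" using g h by (auto simp: has_weak_partial_def)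
  have "AE x in lebesgue_on \<Omega>. g x - h x = 0"
  proof (rule fundamental_lemma[OF open_\<Omega> lmeasurable_\<Omega> L2_diff[OF L]])
    fix \<eta> :: "'a \<Rightarrow> real" assume \<eta>: "\<eta> \<in> test_functions \<Omega>"
    then have "(\<integral>x. \<eta> x *\<^sub>R g x \<partial>lebesgue_on \<Omega>) = (\<integral>x. \<eta> x *\<^sub>R h x \<partial>lebesgue_on \<Omega>)"
      using g h unfolding has_weak_partial_def by (metis neg_equal_iff_equal)
    then show "(\<integral>x. \<eta> x *\<^sub>R (g x - h x) \<partial>lebesgue_on \<Omega>) = 0"
      using L2_integrable_bilinear[OF bounded_bilinear_scaleR test_L2(1)[OF \<eta>] L(1)]
        L2_integrable_bilinear[OF bounded_bilinear_scaleR test_L2(1)[OF \<eta>] L(2)]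
      by (simp add: scaleR_diff_right)
  qed
  then show ?thesis by eventually_elim simp
qed

lemma has_weak_partial_weak_partial:
  "has_weak_partial \<Omega> i f g \<Longrightarrow> has_weak_partial \<Omega> i f (weak_partial \<Omega> i f)"
  unfolding weak_partial_def by (rule someI[of "has_weak_partial \<Omega> i f"])

lemma weak_partial_AE:
  fixes f :: "'a \<Rightarrow> 'b::euclidean_space"
  assumes "grad_approx \<Omega> f G" "i \<in> Basis"
  shows "AE x in lebesgue_on \<Omega>. weak_partial \<Omega> i f x = G i x"
  using grad_approx_weak_partial[OF assms] has_weak_partial_weak_partial weak_partial_unique by blast

lemma weak_partial_L2:
  fixes f :: "'a \<Rightarrow> 'b::euclidean_space"
  assumes "f \<in> H10 \<Omega>" "i \<in> Basis"
  shows "weak_partial \<Omega> i f \<in> L2 \<Omega>"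
proof -
  obtain g where "has_weak_partial \<Omega> i f g" using assms by (auto simp: H10_def H1_def)
  then show ?thesis using has_weak_partial_weak_partial unfolding has_weak_partial_def by blast
qed

lemma H10_L2: "f \<in> H10 \<Omega> \<Longrightarrow> f \<in> L2 \<Omega>"
  by (simp add: H10_def H1_def)

lemma H10_grad_approx:
  fixes f :: "'a \<Rightarrow> 'b::euclidean_space"
  shows "f \<in> H10 \<Omega> \<Longrightarrow> grad_approx \<Omega> f (\<lambda>i. weak_partial \<Omega> i f)"
  using weak_partial_L2 H10_L2 unfolding grad_approx_def by (auto simp: H10_def)

text \<open>The given gradient agrees almost everywhere with the chosen one, so the same test
  functions approximate both. With \<open>H10_grad_approx\<close> this makes the two descriptions of
  \<open>H10\<close> interchangeable.\<close>

lemma grad_approx_H10: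
  fixes f :: "'a \<Rightarrow> 'b::euclidean_space"
  assumes "grad_approx \<Omega> f G"
  shows "f \<in> H10 \<Omega>"
proof -
  have L: "f \<in> L2 \<Omega>" "\<And>i. i \<in> Basis \<Longrightarrow> G i \<in> L2 \<Omega>" using assms by (auto simp: grad_approx_def)
  have "f \<in> H1 \<Omega>" using L grad_approx_weak_partial[OF assms] by (auto simp: H1_def)
  obtain \<psi> where \<psi>: "\<And>n. \<psi> n \<in> test_functions \<Omega>"
      "(\<lambda>n. L2_norm \<Omega> (\<lambda>x. \<psi> n x - f x)) \<longlonglongrightarrow> 0"
      "\<And>i. i \<in> Basis \<Longrightarrow> (\<lambda>n. L2_norm \<Omega> (\<lambda>x. partial_deriv i (\<psi> n) x - G i x)) \<longlonglongrightarrow> 0"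
    using assms unfolding grad_approx_def by blast
  have "L2_norm \<Omega> (\<lambda>x. partial_deriv i (\<psi> n) x - weak_partial \<Omega> i f x)
      = L2_norm \<Omega> (\<lambda>x. partial_deriv i (\<psi> n) x - G i x)" if i: "i \<in> Basis" for i n
  proof (rule L2_norm_cong_AE)
    have w: "weak_partial \<Omega> i f \<in> L2 \<Omega>"
      using has_weak_partial_weak_partial[OF grad_approx_weak_partial[OF assms i]] by (simp add: has_weak_partial_def)
    show "(\<lambda>x. partial_deriv i (\<psi> n) x - weak_partial \<Omega> i f x) \<in> borel_measurable (lebesgue_on \<Omega>)"
      "(\<lambda>x. partial_deriv i (\<psi> n) x - G i x) \<in> borel_measurable (lebesgue_on \<Omega>)"
      using L2_diff[OF test_L2(2)[OF \<psi>(1) i] w] L2_diff[OF test_L2(2)[OF \<psi>(1) i] L(2)[OF i]]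
      by (auto dest: L2_measurable)
    show "AE x in lebesgue_on \<Omega>. partial_deriv i (\<psi> n) x - weak_partial \<Omega> i f x = partial_deriv i (\<psi> n) x - G i x"
      using weak_partial_AE[OF assms i] by eventually_elim simp
  qed
  with \<psi> \<open>f \<in> H1 \<Omega>\<close> show ?thesis
    unfolding H10_def by (auto intro!: exI[of _ \<psi>])
qed

lemma grad_approx_lin:
  fixes f g :: "'a \<Rightarrow> complex"
  assumes f: "grad_approx \<Omega> f F" and g: "grad_approx \<Omega> g G"
  shows "grad_approx \<Omega> (\<lambda>x. a * f x + b * g x) (\<lambda>i x. a * F i x + b * G i x)"
proof -
  have L: "f \<in> L2 \<Omega>" "\<And>i. i \<in> Basis \<Longrightarrow> F i \<in> L2 \<Omega>" "g \<in> L2 \<Omega>" "\<And>i. i \<in> Basis \<Longrightarrow> G i \<in> L2 \<Omega>"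
    using f g by (auto simp: grad_approx_def)
  obtain \<psi> where \<psi>: "\<And>n. \<psi> n \<in> test_functions \<Omega>"
      "(\<lambda>n. L2_norm \<Omega> (\<lambda>x. \<psi> n x - f x)) \<longlonglongrightarrow> 0"
      "\<And>i. i \<in> Basis \<Longrightarrow> (\<lambda>n. L2_norm \<Omega> (\<lambda>x. partial_deriv i (\<psi> n) x - F i x)) \<longlonglongrightarrow> 0"
    using f unfolding grad_approx_def by blast
  obtain \<theta> where \<theta>: "\<And>n. \<theta> n \<in> test_functions \<Omega>"
      "(\<lambda>n. L2_norm \<Omega> (\<lambda>x. \<theta> n x - g x)) \<longlonglongrightarrow> 0"
      "\<And>i. i \<in> Basis \<Longrightarrow> (\<lambda>n. L2_norm \<Omega> (\<lambda>x. partial_deriv i (\<theta> n) x - G i x)) \<longlonglongrightarrow> 0"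
    using g unfolding grad_approx_def by blast
  have lin: "(\<lambda>n. L2_norm \<Omega> (\<lambda>x. (a * s n x + b * t n x) - (a * S x + b * T x))) \<longlonglongrightarrow> 0"
    if s: "\<And>n. s n \<in> L2 \<Omega>" "S \<in> L2 \<Omega>" "(\<lambda>n. L2_norm \<Omega> (\<lambda>x. s n x - S x)) \<longlonglongrightarrow> 0"
      and t: "\<And>n. t n \<in> L2 \<Omega>" "T \<in> L2 \<Omega>" "(\<lambda>n. L2_norm \<Omega> (\<lambda>x. t n x - T x)) \<longlonglongrightarrow> 0"
    for s t :: "nat \<Rightarrow> 'a \<Rightarrow> complex" and S T
  proof (rule tendsto_sandwich[OF _ _ tendsto_const])
    have "L2_norm \<Omega> (\<lambda>x. (a * s n x + b * t n x) - (a * S x + b * T x))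
        \<le> cmod a * L2_norm \<Omega> (\<lambda>x. s n x - S x) + cmod b * L2_norm \<Omega> (\<lambda>x. t n x - T x)" for n
      using L2_norm_triangle[OF L2_cmult[OF L2_diff[OF s(1,2)], of a] L2_cmult[OF L2_diff[OF t(1,2)], of b], of n n]
      unfolding L2_norm_cmult by (simp add: algebra_simps)
    then show "\<forall>\<^sub>F n in sequentially. L2_norm \<Omega> (\<lambda>x. (a * s n x + b * t n x) - (a * S x + b * T x))
        \<le> cmod a * L2_norm \<Omega> (\<lambda>x. s n x - S x) + cmod b * L2_norm \<Omega> (\<lambda>x. t n x - T x)"
      by simp
    show "(\<lambda>n. cmod a * L2_norm \<Omega> (\<lambda>x. s n x - S x) + cmod b * L2_norm \<Omega> (\<lambda>x. t n x - T x)) \<longlonglongrightarrow> 0"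
      using tendsto_add[OF tendsto_mult_left[OF s(3), of "cmod a"] tendsto_mult_left[OF t(3), of "cmod b"]] by simp
  qed auto
  have test: "(\<lambda>x. a * \<psi> n x + b * \<theta> n x) \<in> test_functions \<Omega>" for n
  proof (rule test_functions_I)
    show "Ck k (\<lambda>x. a * \<psi> n x + b * \<theta> n x)" for k
      using \<psi>(1)[of n] \<theta>(1)[of n] by (intro Ck_add Ck_mult Ck_const) (auto simp: test_functions_def)
    show "bounded (closure {x. \<psi> n x \<noteq> 0} \<union> closure {x. \<theta> n x \<noteq> 0})"
      "closure {x. \<psi> n x \<noteq> 0} \<union> closure {x. \<theta> n x \<noteq> 0} \<subseteq> \<Omega>"
      using \<psi>(1)[of n] \<theta>(1)[of n] by (auto simp: test_functions_def compact_imp_bounded)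
    fix x assume "x \<notin> closure {x. \<psi> n x \<noteq> 0} \<union> closure {x. \<theta> n x \<noteq> 0}"
    then have "\<psi> n x = 0" "\<theta> n x = 0"
      using closure_subset[of "{x. \<psi> n x \<noteq> 0}"] closure_subset[of "{x. \<theta> n x \<noteq> 0}"] by blast+
    then show "a * \<psi> n x + b * \<theta> n x = 0" by simp
  qed auto
  have pd: "partial_deriv i (\<lambda>x. a * \<psi> n x + b * \<theta> n x) x = a * partial_deriv i (\<psi> n) x + b * partial_deriv i (\<theta> n) x" for i n x
  proof -
    have "((\<lambda>x. a * \<psi> n x + b * \<theta> n x) has_derivative
        (\<lambda>v. a * frechet_derivative (\<psi> n) (at x) v + b * frechet_derivative (\<theta> n) (at x) v)) (at x)"
      by (intro has_derivative_add has_derivative_mult_right differentiable_has_derivative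
           Cc1_differentiable test_functions_Cc1[OF \<psi>(1)] test_functions_Cc1[OF \<theta>(1)])
    from partial_deriv_eq[OF this] show ?thesis by (simp add: partial_deriv_def)
  qed
  show ?thesis
    unfolding grad_approx_def
    by (intro conjI ballI L2_add L2_cmult L exI[of _ "\<lambda>n x. a * \<psi> n x + b * \<theta> n x"] allI test)
       (simp_all add: pd lin \<psi> \<theta> L test_L2)
qed

text \<open>One test function serves the value and all directions at the same time, as diagonal
  arguments require.\<close>

lemma grad_approx_test_near:
  fixes f :: "'a \<Rightarrow> 'b::euclidean_space"
  assumes "grad_approx \<Omega> f G" "e > 0"
  shows "\<exists>\<psi>. \<psi> \<in> test_functions \<Omega> \<and> L2_norm \<Omega> (\<lambda>x. \<psi> x - f x) < e \<and>
     (\<forall>i\<in>Basis. L2_norm \<Omega> (\<lambda>x. partial_deriv i \<psi> x - G i x) < e)"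
proof -
  obtain \<psi> where \<psi>: "\<And>m. \<psi> m \<in> test_functions \<Omega>"
      "(\<lambda>m. L2_norm \<Omega> (\<lambda>x. \<psi> m x - f x)) \<longlonglongrightarrow> 0"
      "\<And>i. i \<in> Basis \<Longrightarrow> (\<lambda>m. L2_norm \<Omega> (\<lambda>x. partial_deriv i (\<psi> m) x - G i x)) \<longlonglongrightarrow> 0"
    using assms(1) unfolding grad_approx_def by blast
  have "\<forall>\<^sub>F m in sequentially. L2_norm \<Omega> (\<lambda>x. \<psi> m x - f x) < e"
    using \<psi>(2) \<open>e > 0\<close> by (rule order_tendstoD)
  moreover have "\<forall>\<^sub>F m in sequentially. \<forall>i\<in>Basis. L2_norm \<Omega> (\<lambda>x. partial_deriv i (\<psi> m) x - G i x) < e"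
    by (intro eventually_ball_finite ballI finite_Basis order_tendstoD(2)[OF \<psi>(3)] \<open>e > 0\<close>)
  ultimately have "\<forall>\<^sub>F m in sequentially. L2_norm \<Omega> (\<lambda>x. \<psi> m x - f x) < e \<and>
      (\<forall>i\<in>Basis. L2_norm \<Omega> (\<lambda>x. partial_deriv i (\<psi> m) x - G i x) < e)"
    by (rule eventually_conj)
  then obtain m where "L2_norm \<Omega> (\<lambda>x. \<psi> m x - f x) < e \<and>
      (\<forall>i\<in>Basis. L2_norm \<Omega> (\<lambda>x. partial_deriv i (\<psi> m) x - G i x) < e)"
    using eventually_happens'[OF sequentially_bot] by blast
  with \<psi>(1) show ?thesis by blast
qed

text \<open>Closedness of the Dirichlet form, by a diagonal choice: the \<open>n\<close>-th test
  function lies within \<open>1 / Suc n\<close> of \<open>s n\<close> in value and gradient.\<close>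

lemma grad_approx_limit:
  fixes f :: "'a \<Rightarrow> 'b::euclidean_space"
  assumes s: "\<And>n. grad_approx \<Omega> (s n) (S n)" and f: "f \<in> L2 \<Omega>" "\<And>i. i \<in> Basis \<Longrightarrow> G i \<in> L2 \<Omega>"
    and lim: "(\<lambda>n. L2_norm \<Omega> (\<lambda>x. s n x - f x)) \<longlonglongrightarrow> 0"
      "\<And>i. i \<in> Basis \<Longrightarrow> (\<lambda>n. L2_norm \<Omega> (\<lambda>x. S n i x - G i x)) \<longlonglongrightarrow> 0"
  shows "grad_approx \<Omega> f G"
proof -
  have L: "s n \<in> L2 \<Omega>" "i \<in> Basis \<Longrightarrow> S n i \<in> L2 \<Omega>" for n i using s[of n] by (auto simp: grad_approx_def)
  have "\<exists>\<psi>. \<psi> \<in> test_functions \<Omega> \<and> L2_norm \<Omega> (\<lambda>x. \<psi> x - s n x) < 1 / real (Suc n) \<and>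
     (\<forall>i\<in>Basis. L2_norm \<Omega> (\<lambda>x. partial_deriv i \<psi> x - S n i x) < 1 / real (Suc n))" for n
    using grad_approx_test_near[OF s[of n], of "1 / real (Suc n)"] by auto
  then obtain \<psi> where \<psi>: "\<And>n. \<psi> n \<in> test_functions \<Omega>" "\<And>n. L2_norm \<Omega> (\<lambda>x. \<psi> n x - s n x) < 1 / real (Suc n)"
     "\<And>n i. i \<in> Basis \<Longrightarrow> L2_norm \<Omega> (\<lambda>x. partial_deriv i (\<psi> n) x - S n i x) < 1 / real (Suc n)"
    by metis
  have lim': "(\<lambda>n. L2_norm \<Omega> (\<lambda>x. a n x - g x)) \<longlonglongrightarrow> 0"
    if "\<And>n. a n \<in> L2 \<Omega>" "\<And>n. b n \<in> L2 \<Omega>" "g \<in> L2 \<Omega>" "\<And>n. L2_norm \<Omega> (\<lambda>x. a n x - b n x) < 1 / real (Suc n)"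
      "(\<lambda>n. L2_norm \<Omega> (\<lambda>x. b n x - g x)) \<longlonglongrightarrow> 0" for a b and g :: "'a \<Rightarrow> 'b"
  proof (rule tendsto_sandwich[OF _ _ tendsto_const])
    have "L2_norm \<Omega> (\<lambda>x. a n x - g x) \<le> 1 / real (Suc n) + L2_norm \<Omega> (\<lambda>x. b n x - g x)" for n
      using L2_norm_triangle_diff[OF that(1,3,2), of n n] that(4)[of n] by linarith
    then show "\<forall>\<^sub>F n in sequentially. L2_norm \<Omega> (\<lambda>x. a n x - g x) \<le> 1 / real (Suc n) + L2_norm \<Omega> (\<lambda>x. b n x - g x)"
      by simp
    have "(\<lambda>n. 1 / real (Suc n)) \<longlonglongrightarrow> 0" by real_asymp
    from tendsto_add[OF this that(5)]
    show "(\<lambda>n. 1 / real (Suc n) + L2_norm \<Omega> (\<lambda>x. b n x - g x)) \<longlonglongrightarrow> 0" by simp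
  qed auto
  show ?thesis
    unfolding grad_approx_def
  proof (intro conjI ballI f exI[of _ \<psi>] allI \<psi>(1))
    show "(\<lambda>n. L2_norm \<Omega> (\<lambda>x. \<psi> n x - f x)) \<longlonglongrightarrow> 0"
      by (rule lim'[OF test_L2(1)[OF \<psi>(1)] L(1) f(1) \<psi>(2) lim(1)])
    show "(\<lambda>n. L2_norm \<Omega> (\<lambda>x. partial_deriv i (\<psi> n) x - G i x)) \<longlonglongrightarrow> 0" if i: "i \<in> Basis" for i
      by (rule lim'[OF test_L2(2)[OF \<psi>(1) i] L(2)[OF i] f(2)[OF i] \<psi>(3)[OF i] lim(2)[OF i]])
  qed
qed

text \<open>The product rule gives the gradient \<open>(G i + \<i> * (p \<bullet> i) * \<phi>) * cis
  (p \<bullet> x)\<close>. Since \<phi> is real, the bracket is already split into real and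
  imaginary part, and the later energy computation has no cross term.\<close>

lemma grad_approx_modulate:
  fixes \<phi> :: "'a \<Rightarrow> real"
  assumes "grad_approx \<Omega> \<phi> G"
  shows "grad_approx \<Omega> (\<lambda>x. complex_of_real (\<phi> x) * cis (p \<bullet> x))
     (\<lambda>i x. Complex (G i x) ((p \<bullet> i) * \<phi> x) * cis (p \<bullet> x))"
proof -
  have L: "\<phi> \<in> L2 \<Omega>" "\<And>i. i \<in> Basis \<Longrightarrow> G i \<in> L2 \<Omega>" using assms by (auto simp: grad_approx_def)
  obtain \<psi> where \<psi>: "\<And>n. \<psi> n \<in> test_functions \<Omega>"
      "(\<lambda>n. L2_norm \<Omega> (\<lambda>x. \<psi> n x - \<phi> x)) \<longlonglongrightarrow> 0"
      "\<And>i. i \<in> Basis \<Longrightarrow> (\<lambda>n. L2_norm \<Omega> (\<lambda>x. partial_deriv i (\<psi> n) x - G i x)) \<longlonglongrightarrow> 0"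
    using assms unfolding grad_approx_def by blast
  have m: "(\<lambda>x. cis (p \<bullet> x)) \<in> borel_measurable (lebesgue_on \<Omega>)"
    by (intro borel_measurable_lebesgue_on_borel borel_measurable_continuous_onI continuous_intros)
  \<comment> \<open>Stated for arbitrary real \<open>g\<close>, \<open>h\<close>, so that it applies
    to the limit and to the approximation errors alike.\<close>
  have Lc: "(\<lambda>x. Complex (g x) (c * h x) * cis (p \<bullet> x)) \<in> L2 \<Omega>"
    and Nc: "L2_norm \<Omega> (\<lambda>x. Complex (g x) (c * h x) * cis (p \<bullet> x)) \<le> L2_norm \<Omega> g + \<bar>c\<bar> * L2_norm \<Omega> h"
    if g: "g \<in> L2 \<Omega>" and h: "h \<in> L2 \<Omega>" for g h :: "'a \<Rightarrow> real" and c
  proof -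
    have [measurable]: "g \<in> borel_measurable (lebesgue_on \<Omega>)" "h \<in> borel_measurable (lebesgue_on \<Omega>)"
      using g h by (auto dest: L2_measurable)
    have gh: "(\<lambda>x. \<bar>g x\<bar> + \<bar>c\<bar> * \<bar>h x\<bar>) \<in> L2 \<Omega>"
      by (intro L2_add L2_dominated[OF _ g, of "\<lambda>x. \<bar>g x\<bar>" 1] L2_dominated[OF _ h, of "\<lambda>x. \<bar>c\<bar> * \<bar>h x\<bar>" "\<bar>c\<bar>"])
         (auto simp: abs_mult)
    have meas: "(\<lambda>x. Complex (g x) (c * h x) * cis (p \<bullet> x)) \<in> borel_measurable (lebesgue_on \<Omega>)"
      unfolding Complex_eq using m by measurable
    have bd: "AE x in lebesgue_on \<Omega>. norm (Complex (g x) (c * h x) * cis (p \<bullet> x)) \<le> 1 * norm (\<bar>g x\<bar> + \<bar>c\<bar> * \<bar>h x\<bar>)"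
      using cmod_le[of "Complex _ _"] by (auto simp: norm_mult abs_mult[symmetric])
    show "(\<lambda>x. Complex (g x) (c * h x) * cis (p \<bullet> x)) \<in> L2 \<Omega>"
      by (rule L2_dominated[OF meas gh bd])
    have "L2_norm \<Omega> (\<lambda>x. Complex (g x) (c * h x) * cis (p \<bullet> x)) \<le> L2_norm \<Omega> (\<lambda>x. \<bar>g x\<bar> + \<bar>c\<bar> * \<bar>h x\<bar>)"
      using L2_norm_mono[OF meas gh _ bd] by simp
    also have "\<dots> \<le> L2_norm \<Omega> (\<lambda>x. \<bar>g x\<bar>) + L2_norm \<Omega> (\<lambda>x. \<bar>c\<bar> *\<^sub>R \<bar>h x\<bar>)"
      using L2_norm_triangle[OF L2_dominated[OF _ g, of "\<lambda>x. \<bar>g x\<bar>" 1]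
          L2_scaleR[OF L2_dominated[OF _ h, of "\<lambda>x. \<bar>h x\<bar>" 1], of "\<bar>c\<bar>"]] by simp
    also have "\<dots> = L2_norm \<Omega> g + \<bar>c\<bar> * L2_norm \<Omega> h"
      unfolding L2_norm_scaleR by (simp add: L2_norm_def)
    finally show "L2_norm \<Omega> (\<lambda>x. Complex (g x) (c * h x) * cis (p \<bullet> x)) \<le> L2_norm \<Omega> g + \<bar>c\<bar> * L2_norm \<Omega> h" .
  qed
  have test: "(\<lambda>x. complex_of_real (\<psi> n x) * cis (p \<bullet> x)) \<in> test_functions \<Omega>" for n
  proof (rule test_functions_I)
    show "Ck k (\<lambda>x. complex_of_real (\<psi> n x) * cis (p \<bullet> x))" for k
      using \<psi>(1)[of n] Ck_inner[of k p]
      by (intro Ck_mult Ck_of_real Ck_cis) (auto simp: test_functions_def inner_commute)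
    show "bounded (closure {x. \<psi> n x \<noteq> 0})" "closure {x. \<psi> n x \<noteq> 0} \<subseteq> \<Omega>"
      using \<psi>(1)[of n] by (auto simp: test_functions_def compact_imp_bounded)
    fix x assume "x \<notin> closure {x. \<psi> n x \<noteq> 0}"
    then show "complex_of_real (\<psi> n x) * cis (p \<bullet> x) = 0"
      using closure_subset[of "{x. \<psi> n x \<noteq> 0}"] by auto
  qed auto
  have pd: "partial_deriv i (\<lambda>x. complex_of_real (\<psi> n x) * cis (p \<bullet> x)) x
      = Complex (partial_deriv i (\<psi> n) x) ((p \<bullet> i) * \<psi> n x) * cis (p \<bullet> x)" for i n x
  proof -
    have "((\<lambda>x. complex_of_real (\<psi> n x) * cis (p \<bullet> x)) has_derivative
        (\<lambda>v. complex_of_real (\<psi> n x) * ((p \<bullet> v) *\<^sub>R (\<i> * cis (p \<bullet> x)))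
            + complex_of_real (frechet_derivative (\<psi> n) (at x) v) * cis (p \<bullet> x))) (at x)"
      by (intro has_derivative_mult has_derivative_of_real differentiable_has_derivative
           Cc1_differentiable test_functions_Cc1[OF \<psi>(1)])
         (auto intro!: derivative_eq_intros)
    from partial_deriv_eq[OF this, of i] show ?thesis
      by (simp add: partial_deriv_def Complex_eq scaleR_conv_of_real algebra_simps)
  qed
  have sub: "Complex a b * z - Complex c d * z = Complex (a - c) (b - d) * z" for a b c d z
    by (simp add: complex_eq_iff algebra_simps)
  show ?thesis
    unfolding grad_approx_def
  proof (intro conjI ballI exI[of _ "\<lambda>n x. complex_of_real (\<psi> n x) * cis (p \<bullet> x)"] allI test)
    show "(\<lambda>x. complex_of_real (\<phi> x) * cis (p \<bullet> x)) \<in> L2 \<Omega>"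
      using Lc[OF L(1) L(1), of 0] by (simp add: Complex_eq)
    show "(\<lambda>x. Complex (G i x) ((p \<bullet> i) * \<phi> x) * cis (p \<bullet> x)) \<in> L2 \<Omega>" if "i \<in> Basis" for i
      by (rule Lc[OF L(2)[OF that] L(1)])
    show "(\<lambda>n. L2_norm \<Omega> (\<lambda>x. complex_of_real (\<psi> n x) * cis (p \<bullet> x) - complex_of_real (\<phi> x) * cis (p \<bullet> x))) \<longlonglongrightarrow> 0"
    proof -
      have "L2_norm \<Omega> (\<lambda>x. complex_of_real (\<psi> n x) * cis (p \<bullet> x) - complex_of_real (\<phi> x) * cis (p \<bullet> x))
          = L2_norm \<Omega> (\<lambda>x. \<psi> n x - \<phi> x)" for n
        unfolding L2_norm_def
        by (simp add: left_diff_distrib[symmetric] of_real_diff[symmetric] norm_mult del: of_real_diff)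
      then show ?thesis using \<psi>(2) by simp
    qed
    show "(\<lambda>n. L2_norm \<Omega> (\<lambda>x. partial_deriv i (\<lambda>x. complex_of_real (\<psi> n x) * cis (p \<bullet> x)) x
        - Complex (G i x) ((p \<bullet> i) * \<phi> x) * cis (p \<bullet> x))) \<longlonglongrightarrow> 0" if i: "i \<in> Basis" for i
    proof (rule tendsto_sandwich[OF _ _ tendsto_const])
      have "L2_norm \<Omega> (\<lambda>x. partial_deriv i (\<lambda>x. complex_of_real (\<psi> n x) * cis (p \<bullet> x)) x
        - Complex (G i x) ((p \<bullet> i) * \<phi> x) * cis (p \<bullet> x))
        \<le> L2_norm \<Omega> (\<lambda>x. partial_deriv i (\<psi> n) x - G i x) + \<bar>p \<bullet> i\<bar> * L2_norm \<Omega> (\<lambda>x. \<psi> n x - \<phi> x)" for n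
        using Nc[OF L2_diff[OF test_L2(2)[OF \<psi>(1) i] L(2)[OF i]] L2_diff[OF test_L2(1)[OF \<psi>(1)] L(1)], of n "p \<bullet> i" n]
        unfolding pd sub by (simp add: right_diff_distrib)
      then show "\<forall>\<^sub>F n in sequentially. L2_norm \<Omega> (\<lambda>x. partial_deriv i (\<lambda>x. complex_of_real (\<psi> n x) * cis (p \<bullet> x)) x
        - Complex (G i x) ((p \<bullet> i) * \<phi> x) * cis (p \<bullet> x))
        \<le> L2_norm \<Omega> (\<lambda>x. partial_deriv i (\<psi> n) x - G i x) + \<bar>p \<bullet> i\<bar> * L2_norm \<Omega> (\<lambda>x. \<psi> n x - \<phi> x)"
        by simp
      show "(\<lambda>n. L2_norm \<Omega> (\<lambda>x. partial_deriv i (\<psi> n) x - G i x) + \<bar>p \<bullet> i\<bar> * L2_norm \<Omega> (\<lambda>x. \<psi> n x - \<phi> x)) \<longlonglongrightarrow> 0"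
        using tendsto_add[OF \<psi>(3)[OF i] tendsto_mult_left[OF \<psi>(2)]] by simp
    qed auto
  qed
qed

end

section \<open>Rellich compactness\<close>

text \<open>Obtained by expanding the square. On a cube it trades the norm of \<open>w\<close> for
  its mean plus the oscillation over pairs of points, and the latter is controlled by
  translations.\<close>

lemma variance_identity:
  fixes w :: "'x \<Rightarrow> 'b::euclidean_space"
  assumes "finite_measure M" and w: "integrable M w" "integrable M (\<lambda>x. (norm (w x))\<^sup>2)"
  shows "(\<integral>\<^sup>+x. \<integral>\<^sup>+y. ennreal ((norm (w y - w x))\<^sup>2) \<partial>M \<partial>M) =
    ennreal (2 * measure M (space M) * (\<integral>x. (norm (w x))\<^sup>2 \<partial>M) - 2 * (norm (\<integral>x. w x \<partial>M))\<^sup>2)"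
proof -
  interpret finite_measure M by fact
  define I where "I = (\<integral>x. w x \<partial>M)"
  define J where "J = (\<integral>x. (norm (w x))\<^sup>2 \<partial>M)"
  have expand: "(norm (w y - w x))\<^sup>2 = (norm (w y))\<^sup>2 - 2 * (w y \<bullet> w x) + (norm (w x))\<^sup>2" for x y
    by (simp add: power2_norm_eq_inner inner_diff_left inner_diff_right inner_commute)
  have int1: "integrable M (\<lambda>y. (norm (w y - w x))\<^sup>2)" for x
    unfolding expand using w by simp
  have val1: "(\<integral>y. (norm (w y - w x))\<^sup>2 \<partial>M) = J - 2 * (I \<bullet> w x) + measure M (space M) * (norm (w x))\<^sup>2" for x
    unfolding expand I_def J_def using w by simp
  have int2: "integrable M (\<lambda>x. J - 2 * (I \<bullet> w x) + measure M (space M) * (norm (w x))\<^sup>2)"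
    using w by simp
  have "(\<integral>\<^sup>+x. \<integral>\<^sup>+y. ennreal ((norm (w y - w x))\<^sup>2) \<partial>M \<partial>M)
      = (\<integral>\<^sup>+x. ennreal (J - 2 * (I \<bullet> w x) + measure M (space M) * (norm (w x))\<^sup>2) \<partial>M)"
    by (subst nn_integral_eq_integral[OF int1]) (simp_all add: val1)
  also have "\<dots> = ennreal (\<integral>x. J - 2 * (I \<bullet> w x) + measure M (space M) * (norm (w x))\<^sup>2 \<partial>M)"
    by (rule nn_integral_eq_integral[OF int2], rule AE_I2) (simp add: val1[symmetric])
  also have "(\<integral>x. J - 2 * (I \<bullet> w x) + measure M (space M) * (norm (w x))\<^sup>2 \<partial>M)
      = 2 * measure M (space M) * J - 2 * (norm I)\<^sup>2"
    using w by (simp add: I_def[symmetric] J_def[symmetric] power2_norm_eq_inner[of I])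
  finally show ?thesis by (simp add: I_def J_def)
qed

text \<open>Half-open, so that for fixed \<open>h\<close> the cubes partition the space
  exactly.\<close>

definition cube :: "real \<Rightarrow> ('a::euclidean_space \<Rightarrow> int) \<Rightarrow> 'a set" where
  "cube h n = {x. \<forall>i\<in>Basis. real_of_int (n i) * h \<le> x \<bullet> i \<and> x \<bullet> i < (real_of_int (n i) + 1) * h}"

text \<open>Extensionality pins the indices off \<open>Basis\<close>; thus the set is finite and
  different indices give disjoint cubes.\<close>

definition grid :: "nat \<Rightarrow> ('a::euclidean_space \<Rightarrow> int) set" where
  "grid N = (Basis :: 'a set) \<rightarrow>\<^sub>E {- int N..<int N}"

lemma finite_grid: "finite (grid N)"
  unfolding grid_def by (rule finite_PiE) auto

lemma cube_borel [measurable]: "cube h n \<in> sets borel"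
proof -
  have "cube h n = (\<Inter>i\<in>Basis. {x. real_of_int (n i) * h \<le> x \<bullet> i} \<inter> {x. x \<bullet> i < (real_of_int (n i) + 1) * h})"
    by (auto simp: cube_def)
  also have "\<dots> \<in> sets borel"
    by (intro sets.finite_INT sets.Int borel_closed[OF closed_Collect_le] borel_open[OF open_Collect_less]
          continuous_intros) auto
  finally show ?thesis .
qed

lemma emeasure_cube:
  fixes n :: "'a::euclidean_space \<Rightarrow> int"
  assumes "h > 0"
  shows "emeasure lborel (cube h n) = ennreal (h ^ DIM('a))"
proof -
  define a b :: 'a where "a = (\<Sum>i\<in>Basis. (real_of_int (n i) * h) *\<^sub>R i)"
    and "b = (\<Sum>i\<in>Basis. ((real_of_int (n i) + 1) * h) *\<^sub>R i)"
  have ab: "b \<bullet> i - a \<bullet> i = h" "a \<bullet> i \<le> b \<bullet> i" if "i \<in> Basis" for i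
    using that assms by (simp_all add: a_def b_def) (simp_all add: algebra_simps)
  have "a \<bullet> i = real_of_int (n i) * h" "b \<bullet> i = (real_of_int (n i) + 1) * h" if "i \<in> Basis" for i
    using that by (simp_all add: a_def b_def)
  then have "box a b \<subseteq> cube h n" "cube h n \<subseteq> cbox a b"
    unfolding cube_def by (fastforce simp: mem_box)+
  then have "emeasure lborel (box a b) \<le> emeasure lborel (cube h n)"
      "emeasure lborel (cube h n) \<le> emeasure lborel (cbox a b)"
    by (auto intro!: emeasure_mono)
  moreover have "emeasure lborel (box a b) = ennreal (h ^ DIM('a))" "emeasure lborel (cbox a b) = ennreal (h ^ DIM('a))"
    using ab by (auto simp: emeasure_lborel_box emeasure_lborel_cbox inner_diff_left)
  ultimately show ?thesis by simp
qed

lemma cube_unique: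
  assumes "h > 0" "x \<in> cube h n" "i \<in> Basis"
  shows "n i = \<lfloor>x \<bullet> i / h\<rfloor>"
  using assms by (intro floor_unique[symmetric]) (auto simp: cube_def field_simps)

lemma grid_cover:
  fixes x :: "'a::euclidean_space"
  assumes "h > 0" "\<And>i. i \<in> Basis \<Longrightarrow> \<bar>x \<bullet> i\<bar> < real N * h"
  shows "\<exists>n\<in>grid N. x \<in> cube h n"
proof
  let ?n = "\<lambda>i\<in>Basis. \<lfloor>x \<bullet> i / h\<rfloor>"
  have "\<lfloor>x \<bullet> i / h\<rfloor> \<in> {- int N..<int N}" if "i \<in> Basis" for i
  proof -
    have "- real N < x \<bullet> i / h" "x \<bullet> i / h < real N"
      using assms(2)[OF that] assms(1) by (auto simp: field_simps abs_less_iff)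
    then show ?thesis by (auto simp: le_floor_iff floor_less_iff)
  qed
  then show "?n \<in> grid N" by (auto simp: grid_def)
  show "x \<in> cube h ?n"
  proof (simp add: cube_def, intro ballI conjI)
    fix i
    show "real_of_int \<lfloor>x \<bullet> i / h\<rfloor> * h \<le> x \<bullet> i"
      using of_int_floor_le[of "x \<bullet> i / h"] by (simp only: pos_le_divide_eq[OF assms(1)])
    have "x \<bullet> i / h < real_of_int \<lfloor>x \<bullet> i / h\<rfloor> + 1" by linarith
    then show "x \<bullet> i < (real_of_int \<lfloor>x \<bullet> i / h\<rfloor> + 1) * h"
      by (simp only: pos_divide_less_eq[OF assms(1)])
  qed
qed

lemma grid_cube_inj:
  assumes "h > 0" "n \<in> grid N" "m \<in> grid N" "x \<in> cube h n" "x \<in> cube h m"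
  shows "n = m"
  using assms by (intro PiE_ext[of n Basis "\<lambda>_. {- int N..<int N}"]) (auto simp: grid_def cube_unique)

text \<open>A point lies in at most one cube of the grid, and two points of one cube differ by at
  most \<open>h\<close> in each coordinate. This replaces the grid by a condition on the
  displacement alone.\<close>

lemma sum_grid_indicator_le:
  fixes x y :: "'a::euclidean_space"
  assumes "h > 0"
  shows "(\<Sum>n\<in>grid N. indicator (cube h n) x * indicator (cube h n) y) \<le>
     (indicator (cbox (- (h *\<^sub>R One)) (h *\<^sub>R One)) (y - x) :: ennreal)"
proof (cases "\<exists>m\<in>grid N. x \<in> cube h m \<and> y \<in> cube h m")
  case True
  then obtain m where m: "m \<in> grid N" "x \<in> cube h m" "y \<in> cube h m" by blast
  have "x \<notin> cube h n" if "n \<in> grid N - {m}" for n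
    using grid_cube_inj[OF assms, of n N m x] m that by blast
  then have "(\<Sum>n\<in>grid N. indicator (cube h n) x * indicator (cube h n) y)
      = (\<Sum>n\<in>{m}. indicator (cube h n) x * indicator (cube h n) y :: ennreal)"
    using m(1) by (intro sum.mono_neutral_right finite_grid) simp_all
  also have "\<dots> = 1" using m by simp
  also have "\<dots> = indicator (cbox (- (h *\<^sub>R One)) (h *\<^sub>R One)) (y - x)"
  proof -
    have "\<bar>y \<bullet> i - x \<bullet> i\<bar> \<le> h" if "i \<in> Basis" for i
    proof -
      have "real_of_int (m i) * h \<le> x \<bullet> i" "x \<bullet> i < real_of_int (m i) * h + h"
        "real_of_int (m i) * h \<le> y \<bullet> i" "y \<bullet> i < real_of_int (m i) * h + h"
        using m(2,3) that by (auto simp: cube_def distrib_right)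
      then show ?thesis by linarith
    qed
    then have "y - x \<in> cbox (- (h *\<^sub>R One)) (h *\<^sub>R One)"
      by (force simp: mem_box inner_diff_left abs_le_iff)
    then show ?thesis by simp
  qed
  finally show ?thesis by simp
next
  case False
  then have "(\<Sum>n\<in>grid N. indicator (cube h n) x * indicator (cube h n) y) = (0::ennreal)"
    by (intro sum.neutral) (auto simp: indicator_def)
  then show ?thesis by simp
qed

lemma L2_norm_dir_deriv_le:
  assumes w: "Cc1 w" and v: "\<And>i. i \<in> Basis \<Longrightarrow> \<bar>v \<bullet> i\<bar> \<le> h"
  shows "L2_norm UNIV (dir_deriv v w) \<le> h * (\<Sum>i\<in>Basis. L2_norm UNIV (partial_deriv i w))"
proof -
  have b: "bounded (closure {x. w x \<noteq> 0})" using w by (simp add: Cc1_def bounded_closure)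
  have L: "partial_deriv i w \<in> L2 UNIV" if "i \<in> Basis" for i
    by (rule L2_UNIV_continuous[OF Cc1_continuous_partial[OF w that] b]) (rule partial_deriv_zero)
  have "L2_norm UNIV (\<lambda>x. \<Sum>i\<in>I. (v \<bullet> i) *\<^sub>R partial_deriv i w x) \<le> (\<Sum>i\<in>I. h * L2_norm UNIV (partial_deriv i w))"
    if "finite I" "I \<subseteq> Basis" for I
    using that
  proof (induction I)
    case (insert i I)
    have "L2_norm UNIV (\<lambda>x. \<Sum>j\<in>insert i I. (v \<bullet> j) *\<^sub>R partial_deriv j w x)
        \<le> L2_norm UNIV (\<lambda>x. (v \<bullet> i) *\<^sub>R partial_deriv i w x) + L2_norm UNIV (\<lambda>x. \<Sum>j\<in>I. (v \<bullet> j) *\<^sub>R partial_deriv j w x)"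
      using insert by (simp, intro L2_norm_triangle L2_scaleR L2_sum L) auto
    also have "L2_norm UNIV (\<lambda>x. (v \<bullet> i) *\<^sub>R partial_deriv i w x) \<le> h * L2_norm UNIV (partial_deriv i w)"
      unfolding L2_norm_scaleR using v[of i] insert by (intro mult_right_mono) auto
    finally show ?case using insert by simp
  qed simp
  from this[OF finite_Basis order_refl] show ?thesis
    unfolding dir_deriv_def by (simp add: sum_distrib_left)
qed

lemma nn_integral_lborel_translation:
  assumes [measurable]: "f \<in> borel_measurable borel"
  shows "(\<integral>\<^sup>+x. f (x + a) \<partial>lborel) = (\<integral>\<^sup>+x. f x \<partial>(lborel :: 'a::euclidean_space measure))"
proof -
  have "(\<integral>\<^sup>+x. f x \<partial>lborel) = (\<integral>\<^sup>+x. f x \<partial>distr lborel borel ((+) a))"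
    by (simp add: lborel_distr_plus)
  also have "\<dots> = (\<integral>\<^sup>+x. f (a + x) \<partial>lborel)"
    by (rule nn_integral_distr) auto
  finally show ?thesis by (simp add: add.commute)
qed

lemma Cc1_L2: "Cc1 w \<Longrightarrow> w \<in> L2 UNIV"
  using Cc1_translation_L2[of w 0] by simp

lemma Cc1_borel: "Cc1 w \<Longrightarrow> w \<in> borel_measurable borel"
  by (rule borel_measurable_continuous_onI[OF Cc1_continuous])

text \<open>After substituting \<open>y = v + x\<close> and exchanging the integrals, the inner one
  is the squared norm of the increment of \<open>w\<close> along \<open>v\<close>, bounded by
  \<open>L2_translation_le\<close>. The factor \<open>(2 * h) ^ DIM('a)\<close> is the volume of the
  admissible displacements.\<close>

lemma grid_double_integral_le:
  fixes w :: "'a::euclidean_space \<Rightarrow> 'b::euclidean_space"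
  assumes w: "Cc1 w" and h: "h > 0"
  shows "(\<Sum>n\<in>grid N. \<integral>\<^sup>+x\<in>cube h n. (\<integral>\<^sup>+y\<in>cube h n. ennreal ((norm (w y - w x))\<^sup>2) \<partial>lborel) \<partial>lborel)
    \<le> ennreal ((2 * h) ^ DIM('a) * (h * (\<Sum>i\<in>Basis. L2_norm UNIV (partial_deriv i w)))\<^sup>2)"
proof -
  define K where "K = h * (\<Sum>i\<in>Basis. L2_norm UNIV (partial_deriv i w))"
  let ?C = "cbox (- (h *\<^sub>R One)) (h *\<^sub>R One) :: 'a set"
  let ?g = "\<lambda>x y. ennreal ((norm (w y - w x))\<^sup>2)"
  have [measurable]: "w \<in> borel_measurable borel" by (rule Cc1_borel[OF w])
  have "(\<Sum>n\<in>grid N. \<integral>\<^sup>+x\<in>cube h n. (\<integral>\<^sup>+y\<in>cube h n. ?g x y \<partial>lborel) \<partial>lborel)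
      = (\<Sum>n\<in>grid N. \<integral>\<^sup>+x. (\<integral>\<^sup>+y. ?g x y * (indicator (cube h n) x * indicator (cube h n) y) \<partial>lborel) \<partial>lborel)"
  proof (intro sum.cong refl nn_integral_cong)
    fix n and x :: 'a
    have "(\<integral>\<^sup>+y\<in>cube h n. ?g x y \<partial>lborel) * indicator (cube h n) x
        = (\<integral>\<^sup>+y. ?g x y * indicator (cube h n) y * indicator (cube h n) x \<partial>lborel)"
      by (rule nn_integral_multc[symmetric]) measurable
    then show "(\<integral>\<^sup>+y\<in>cube h n. ?g x y \<partial>lborel) * indicator (cube h n) x
        = (\<integral>\<^sup>+y. ?g x y * (indicator (cube h n) x * indicator (cube h n) y) \<partial>lborel)"
      by (simp only: mult.assoc mult.commute[of "indicator (cube h n) x"])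
  qed
  also have "\<dots> = (\<integral>\<^sup>+x. (\<integral>\<^sup>+y. ?g x y * (\<Sum>n\<in>grid N. indicator (cube h n) x * indicator (cube h n) y) \<partial>lborel) \<partial>lborel)"
    by (simp add: nn_integral_sum[symmetric] sum_distrib_left)
  also have "\<dots> \<le> (\<integral>\<^sup>+x. (\<integral>\<^sup>+y. ?g x y * indicator ?C (y - x) \<partial>lborel) \<partial>lborel)"
    by (intro nn_integral_mono mult_left_mono sum_grid_indicator_le h) auto
  also have "\<dots> = (\<integral>\<^sup>+x. (\<integral>\<^sup>+v. ?g x (v + x) * indicator ?C v \<partial>lborel) \<partial>lborel)"
  proof (rule nn_integral_cong)
    fix x :: 'a
    show "(\<integral>\<^sup>+y. ?g x y * indicator ?C (y - x) \<partial>lborel) = (\<integral>\<^sup>+v. ?g x (v + x) * indicator ?C v \<partial>lborel)"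
      using nn_integral_lborel_translation[of "\<lambda>y. ?g x y * indicator ?C (y - x)" x] by simp
  qed
  also have "\<dots> = (\<integral>\<^sup>+v. (\<integral>\<^sup>+x. ?g x (v + x) * indicator ?C v \<partial>lborel) \<partial>lborel)"
    by (rule lborel_pair.Fubini') measurable
  also have "\<dots> \<le> (\<integral>\<^sup>+v. ennreal (K\<^sup>2) * indicator ?C v \<partial>lborel)"
  proof (intro nn_integral_mono)
    fix v :: 'a
    show "(\<integral>\<^sup>+x. ?g x (v + x) * indicator ?C v \<partial>lborel) \<le> ennreal (K\<^sup>2) * indicator ?C v"
    proof (cases "v \<in> ?C")
      case True
      then have v: "\<bar>v \<bullet> i\<bar> \<le> h" if "i \<in> Basis" for i using that by (auto simp: mem_box abs_le_iff)
      have "L2_norm UNIV (\<lambda>x. w (x + v) - w x) \<le> K"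
        unfolding K_def using L2_translation_le[OF w, of v] L2_norm_dir_deriv_le[OF w v] by linarith
      then have "(L2_norm UNIV (\<lambda>x. w (x + v) - w x))\<^sup>2 \<le> K\<^sup>2" by (intro power_mono) auto
      moreover have "(\<integral>\<^sup>+x. ?g x (v + x) \<partial>lborel) = ennreal ((L2_norm UNIV (\<lambda>x. w (x + v) - w x))\<^sup>2)"
        unfolding nn_integral_L2[OF L2_diff[OF Cc1_translation_L2[OF w] Cc1_L2[OF w]], symmetric] lebesgue_on_UNIV_eq
        by (subst nn_integral_completion) (auto simp: add.commute)
      ultimately show ?thesis using True by (simp add: ennreal_leI)
    qed simp
  qed
  also have "\<dots> = ennreal (K\<^sup>2) * emeasure lborel ?C"
    by (rule nn_integral_cmult_indicator) simp
  also have "emeasure lborel ?C = ennreal ((2 * h) ^ DIM('a))"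
  proof -
    have "(h *\<^sub>R One - - (h *\<^sub>R One)) \<bullet> i = 2 * h" "- (h *\<^sub>R One) \<bullet> i \<le> h *\<^sub>R One \<bullet> i" if "i \<in> Basis" for i :: 'a
      using that h by (simp_all add: inner_diff_left inner_add_left)
    then show ?thesis by (subst emeasure_lborel_cbox) simp_all
  qed
  finally show ?thesis
    using h by (simp add: K_def ennreal_mult[symmetric] mult.commute)
qed

text \<open>A Poincare inequality on the cubes: finitely many cube integrals control the norm up to
  an error of order \<open>h\<close> times the gradient. Dividing by the cube volume leaves the
  factor \<open>2 ^ DIM('a)\<close> from the displacements.\<close>

lemma grid_inequality:
  fixes w :: "'a::euclidean_space \<Rightarrow> 'b::euclidean_space"
  assumes w: "Cc1 w" and h: "h > 0" and supp: "\<And>x i. w x \<noteq> 0 \<Longrightarrow> i \<in> Basis \<Longrightarrow> \<bar>x \<bullet> i\<bar> < real N * h"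
  shows "(L2_norm UNIV w)\<^sup>2 \<le> (\<Sum>n\<in>grid N. (norm (\<integral>x\<in>cube h n. w x \<partial>lborel))\<^sup>2) / h ^ DIM('a)
     + 2 ^ DIM('a) * (h * (\<Sum>i\<in>Basis. L2_norm UNIV (partial_deriv i w)))\<^sup>2"
proof -
  define D where "D = h ^ DIM('a)"
  have D: "D > 0" using h by (simp add: D_def)
  define K where "K = h * (\<Sum>i\<in>Basis. L2_norm UNIV (partial_deriv i w))"
  have [measurable]: "w \<in> borel_measurable borel" by (rule Cc1_borel[OF w])
  have int: "integrable lborel w" by (rule Cc1_integrable[OF w])
  have "bounded {x. w x \<noteq> 0}" using w by (simp add: Cc1_def)
  then have int2: "integrable lborel (\<lambda>x. (norm (w x))\<^sup>2)"
    by (rule integrable_continuous_bounded_support[rotated]) (auto intro!: continuous_intros Cc1_continuous[OF w])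
  define A where "A n = (\<integral>x\<in>cube h n. (norm (w x))\<^sup>2 \<partial>lborel)" for n
  define B where "B n = (norm (\<integral>x\<in>cube h n. w x \<partial>lborel))\<^sup>2" for n
  have var: "(\<integral>\<^sup>+x\<in>cube h n. (\<integral>\<^sup>+y\<in>cube h n. ennreal ((norm (w y - w x))\<^sup>2) \<partial>lborel) \<partial>lborel)
      = ennreal (2 * D * A n - 2 * B n)" and var_nonneg: "0 \<le> 2 * D * A n - 2 * B n" for n
  proof -
    let ?M = "restrict_space lborel (cube h n)"
    have sp: "space ?M = cube h n" by (simp add: space_restrict_space)
    have "emeasure ?M (cube h n) = emeasure lborel (cube h n)"
      by (rule emeasure_restrict_space) auto
    then have em: "emeasure ?M (space ?M) = ennreal D"
      by (simp only: sp emeasure_cube[OF h] D_def)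
    then have fm: "finite_measure ?M"
      by (intro finite_measureI) simp
    have m: "measure ?M (space ?M) = D"
      using D by (simp only: measure_def em) simp
    have i1: "integrable ?M w" "integrable ?M (\<lambda>x. (norm (w x))\<^sup>2)"
      using integrable_mult_indicator[OF _ int, of "cube h n"] integrable_mult_indicator[OF _ int2, of "cube h n"]
      by (simp_all add: integrable_restrict_space)
    have "(\<integral>\<^sup>+x\<in>cube h n. (\<integral>\<^sup>+y\<in>cube h n. ennreal ((norm (w y - w x))\<^sup>2) \<partial>lborel) \<partial>lborel)
        = (\<integral>\<^sup>+x. \<integral>\<^sup>+y. ennreal ((norm (w y - w x))\<^sup>2) \<partial>?M \<partial>?M)"
      by (simp add: nn_integral_restrict_space)
    also have "\<dots> = ennreal (2 * D * A n - 2 * B n)"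
      unfolding variance_identity[OF fm i1] m A_def B_def
      by (simp add: integral_restrict_space set_lebesgue_integral_def)
    finally show "(\<integral>\<^sup>+x\<in>cube h n. (\<integral>\<^sup>+y\<in>cube h n. ennreal ((norm (w y - w x))\<^sup>2) \<partial>lborel) \<partial>lborel)
      = ennreal (2 * D * A n - 2 * B n)" .
    \<comment> \<open>Cauchy-Schwarz on one cube. It ensures that \<open>ennreal\<close> truncates
      nothing, so that the sum over the grid may be moved inside it.\<close>
    have "B n \<le> D * A n"
    proof -
      have "norm (\<integral>x. w x \<partial>?M) ^ 2 \<le> (\<integral>x. norm (w x) \<partial>?M)\<^sup>2"
        by (intro power_mono integral_norm_bound) auto
      also have "\<dots> \<le> D * (\<integral>x. (norm (w x))\<^sup>2 \<partial>?M)"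
      proof -
        interpret finite_measure ?M by (rule fm)
        \<comment> \<open>With \<open>t\<close> the mean of \<open>norm (w x)\<close>, the integral
          of \<open>(norm (w x) - t)\<^sup>2\<close> is the Cauchy-Schwarz defect divided by
          \<open>D\<close>.\<close>
        define t where "t = (\<integral>x. norm (w x) \<partial>?M) / D"
        have "0 \<le> (\<integral>x. (norm (w x) - t)\<^sup>2 \<partial>?M)" by simp
        also have "\<dots> = (\<integral>x. (norm (w x))\<^sup>2 \<partial>?M) - 2 * t * (\<integral>x. norm (w x) \<partial>?M) + t\<^sup>2 * D"
          using i1 m by (simp add: power2_diff)
        finally have "0 \<le> D * ((\<integral>x. (norm (w x))\<^sup>2 \<partial>?M) - 2 * t * (\<integral>x. norm (w x) \<partial>?M) + t\<^sup>2 * D)"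
          using D by simp
        also have "\<dots> = D * (\<integral>x. (norm (w x))\<^sup>2 \<partial>?M) - (\<integral>x. norm (w x) \<partial>?M)\<^sup>2"
          using D by (simp add: t_def field_simps power2_eq_square)
        finally show ?thesis by simp
      qed
      finally show ?thesis
        by (simp add: A_def B_def integral_restrict_space set_lebesgue_integral_def)
    qed
    then show "0 \<le> 2 * D * A n - 2 * B n" by simp
  qed
  have "ennreal (\<Sum>n\<in>grid N. 2 * D * A n - 2 * B n) \<le> ennreal ((2 * h) ^ DIM('a) * K\<^sup>2)"
    using grid_double_integral_le[OF w h, of N] var_nonneg by (simp add: var sum_ennreal K_def)
  then have "(\<Sum>n\<in>grid N. 2 * D * A n - 2 * B n) \<le> (2 * h) ^ DIM('a) * K\<^sup>2"
    using h by (simp add: ennreal_le_iff)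
  \<comment> \<open>Halving would leave half of the last term; keeping all of it costs only a
    constant.\<close>
  then have le: "D * (\<Sum>n\<in>grid N. A n) \<le> (\<Sum>n\<in>grid N. B n) + 2 ^ DIM('a) * D * K\<^sup>2"
  proof -
    have "(\<Sum>n\<in>grid N. 2 * D * A n - 2 * B n) = 2 * (D * (\<Sum>n\<in>grid N. A n)) - 2 * (\<Sum>n\<in>grid N. B n)"
      by (simp add: sum_subtractf sum_distrib_left mult.assoc)
    moreover have "(2 * h) ^ DIM('a) * K\<^sup>2 = 2 ^ DIM('a) * D * K\<^sup>2"
      by (simp add: power_mult_distrib D_def)
    moreover have "0 \<le> 2 ^ DIM('a) * D * K\<^sup>2" using D by simp
    ultimately show ?thesis using \<open>(\<Sum>n\<in>grid N. 2 * D * A n - 2 * B n) \<le> _\<close> by linarith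
  qed
  have "(L2_norm UNIV w)\<^sup>2 = (\<integral>x. (norm (w x))\<^sup>2 \<partial>lborel)"
    by (rule L2_UNIV_norm) simp
  also have "\<dots> \<le> (\<integral>x. (\<Sum>n\<in>grid N. indicat_real (cube h n) x *\<^sub>R (norm (w x))\<^sup>2) \<partial>lborel)"
  proof (rule integral_mono[OF int2])
    show "integrable lborel (\<lambda>x. \<Sum>n\<in>grid N. indicat_real (cube h n) x *\<^sub>R (norm (w x))\<^sup>2)"
      by (intro Bochner_Integration.integrable_sum integrable_mult_indicator int2) simp
    fix x
    show "(norm (w x))\<^sup>2 \<le> (\<Sum>n\<in>grid N. indicat_real (cube h n) x *\<^sub>R (norm (w x))\<^sup>2)"
    proof (cases "w x = 0")
      case False
      then obtain n where n: "n \<in> grid N" "x \<in> cube h n"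
        using grid_cover[OF h, of x N] supp by blast
      have "(norm (w x))\<^sup>2 = indicat_real (cube h n) x *\<^sub>R (norm (w x))\<^sup>2" using n by simp
      also have "\<dots> \<le> (\<Sum>n\<in>grid N. indicat_real (cube h n) x *\<^sub>R (norm (w x))\<^sup>2)"
        by (rule member_le_sum[OF n(1) _ finite_grid]) auto
      finally show ?thesis .
    qed (simp add: sum_nonneg)
  qed
  also have "\<dots> = (\<Sum>n\<in>grid N. A n)"
    unfolding A_def set_lebesgue_integral_def
    by (rule Bochner_Integration.integral_sum) (intro integrable_mult_indicator int2, simp)
  also have "\<dots> = D * (\<Sum>n\<in>grid N. A n) / D" using D by simp
  also have "\<dots> \<le> ((\<Sum>n\<in>grid N. B n) + 2 ^ DIM('a) * D * K\<^sup>2) / D"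
    using le D by (intro divide_right_mono) auto
  also have "\<dots> = (\<Sum>n\<in>grid N. B n) / D + 2 ^ DIM('a) * K\<^sup>2"
    using D by (simp add: add_divide_distrib)
  finally show ?thesis by (simp add: B_def D_def K_def)
qed

section \<open>Compactness for sequences with bounded gradients\<close>

context bounded_open_set
begin

lemma test_function_diff:
  fixes \<psi> \<theta> :: "'a \<Rightarrow> 'b::euclidean_space"
  assumes "\<psi> \<in> test_functions \<Omega>" "\<theta> \<in> test_functions \<Omega>"
  shows "Cc1 (\<lambda>x. \<psi> x - \<theta> x)"
    "partial_deriv i (\<lambda>x. \<psi> x - \<theta> x) = (\<lambda>x. partial_deriv i \<psi> x - partial_deriv i \<theta> x)"
  using Cc1_diff[OF assms[THEN test_functions_Cc1]]
    partial_deriv_diff[OF assms[THEN test_functions_Cc1, THEN Cc1_differentiable]] by auto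

lemma L2_norm_UNIV_test:
  fixes \<psi> :: "'a \<Rightarrow> 'b::euclidean_space"
  assumes "continuous_on UNIV \<psi>" "\<And>x. x \<notin> \<Omega> \<Longrightarrow> \<psi> x = 0"
  shows "L2_norm UNIV \<psi> = L2_norm \<Omega> \<psi>"
  by (rule L2_norm_test_UNIV[OF sets_\<Omega> borel_measurable_continuous_onI[OF assms(1)] assms(2)])

text \<open>The integrals over all cubes of side \<open>1 / Suc k\<close> are bounded and countably
  indexed, so along one subsequence all of them converge. For given \<open>e\<close>, a fine
  \<open>k\<close> makes the gradient term of \<open>grid_inequality\<close> small, and what remains
  involves finitely many convergent sequences.\<close>

lemma rellich_test:
  fixes \<psi> :: "nat \<Rightarrow> 'a \<Rightarrow> 'b::euclidean_space"
  assumes \<psi>: "\<And>n. \<psi> n \<in> test_functions \<Omega>" and M: "\<And>n. L2_norm \<Omega> (\<psi> n) \<le> M"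
    and M': "\<And>n i. i \<in> Basis \<Longrightarrow> L2_norm \<Omega> (partial_deriv i (\<psi> n)) \<le> M"
  shows "\<exists>r :: nat \<Rightarrow> nat. strict_mono r \<and>
    (\<forall>e>0. \<exists>N. \<forall>m\<ge>N. \<forall>n\<ge>N. L2_norm \<Omega> (\<lambda>x. \<psi> (r m) x - \<psi> (r n) x) < e)"
proof -
  note C = test_functions_Cc1[OF \<psi>]
  define S where "S = (UNIV :: nat set) \<times> ((Basis :: 'a set) \<rightarrow>\<^sub>E (UNIV :: int set))"
  define f where "f n = (\<lambda>(k, \<nu>). \<integral>x\<in>cube (1 / real (Suc k)) \<nu>. \<psi> n x \<partial>lborel)" for n
  have "countable S" unfolding S_def
    by (intro countable_SIGMA countable_PiE) auto
  have bound: "norm (f n s) \<le> L2_norm \<Omega> (\<lambda>x. 1::real) * M" for n s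
  proof -
    obtain k \<nu> where s: "s = (k, \<nu>)" by force
    have "norm (f n s) \<le> (\<integral>x. norm (\<psi> n x) \<partial>lborel)"
      unfolding f_def s prod.case set_lebesgue_integral_def
    proof (rule Bochner_Integration.integral_norm_bound_integral)
      show "integrable lborel (\<lambda>x. indicat_real (cube (1 / real (Suc k)) \<nu>) x *\<^sub>R \<psi> n x)"
        by (intro integrable_mult_indicator Cc1_integrable C) simp
      show "integrable lborel (\<lambda>x. norm (\<psi> n x))" using Cc1_integrable[OF C] by simp
    qed (simp add: indicator_def)
    also have "\<dots> = (\<integral>x. norm (\<psi> n x) \<partial>lebesgue_on \<Omega>)"
      by (rule lebesgue_on_integral_eq_lborel[OF sets_\<Omega>, symmetric])
         (use Cc1_borel[OF C] test_functions_partial_zero[OF \<psi>] in auto)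
    also have "\<dots> \<le> L2_norm \<Omega> (\<lambda>x. 1::real) * L2_norm \<Omega> (\<psi> n)"
      using L2_Cauchy_Schwarz[OF L2_const[OF lmeasurable_\<Omega>, of "1::real"] test_L2(1)[OF \<psi>]] by simp
    also have "\<dots> \<le> L2_norm \<Omega> (\<lambda>x. 1::real) * M"
      by (intro mult_left_mono M) simp
    finally show ?thesis .
  qed
  obtain r :: "nat \<Rightarrow> nat" where r: "strict_mono r" and conv: "\<And>s. s \<in> S \<Longrightarrow> \<exists>l. (\<lambda>n. f (r n) s) \<longlonglongrightarrow> l"
    using function_convergent_subsequence[OF \<open>countable S\<close>, of f "L2_norm \<Omega> (\<lambda>x. 1::real) * M"] bound by blast
  obtain R where R: "\<And>x. x \<in> \<Omega> \<Longrightarrow> norm x \<le> R" using bounded_\<Omega> by (auto simp: bounded_iff)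
  have "\<exists>N. \<forall>m\<ge>N. \<forall>n\<ge>N. L2_norm \<Omega> (\<lambda>x. \<psi> (r m) x - \<psi> (r n) x) < e" if e: "e > 0" for e
  proof -
    \<comment> \<open>\<open>2 * M\<close> bounds each partial derivative of a difference of two
      members of the sequence.\<close>
    have "(\<lambda>k. 2 ^ DIM('a) * (1 / real (Suc k) * (DIM('a) * (2 * M)))\<^sup>2) \<longlonglongrightarrow> 2 ^ DIM('a) * (0 * (DIM('a) * (2 * M)))\<^sup>2"
      by (intro tendsto_intros LIMSEQ_Suc lim_1_over_n)
    then have "\<forall>\<^sub>F k in sequentially. 2 ^ DIM('a) * (1 / real (Suc k) * (DIM('a) * (2 * M)))\<^sup>2 < e\<^sup>2 / 2"
      by (rule order_tendstoD) (use e in simp)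
    then obtain k where k: "2 ^ DIM('a) * (1 / real (Suc k) * (DIM('a) * (2 * M)))\<^sup>2 < e\<^sup>2 / 2"
      using eventually_happens'[OF sequentially_bot] by blast
    define h where "h = 1 / real (Suc k)"
    have h: "h > 0" by (simp add: h_def)
    \<comment> \<open>\<open>G\<close> is taken so large that the cubes of \<open>grid G\<close>
      cover \<Omega>.\<close>
    obtain G :: nat where G: "R / h < real G" using reals_Archimedean2 by blast
    define a where "a n \<nu> = (\<integral>x\<in>cube h \<nu>. \<psi> (r n) x \<partial>lborel)" for n \<nu>
    have "\<exists>l. (\<lambda>n. a n \<nu>) \<longlonglongrightarrow> l" if "\<nu> \<in> grid G" for \<nu>
    proof -
      have "(k, \<nu>) \<in> S" using that by (auto simp: S_def grid_def)
      then show ?thesis using conv[of "(k, \<nu>)"] by (simp add: f_def a_def h_def)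
    qed
    then obtain l where l: "\<And>\<nu>. \<nu> \<in> grid G \<Longrightarrow> (\<lambda>n. a n \<nu>) \<longlonglongrightarrow> l \<nu>" by metis
    \<comment> \<open>The product filter lets both indices go to infinity together, which is the
      Cauchy condition.\<close>
    have "((\<lambda>(m, n). (\<Sum>\<nu>\<in>grid G. (norm (a m \<nu> - a n \<nu>))\<^sup>2) / h ^ DIM('a)) \<longlongrightarrow>
        (\<Sum>\<nu>\<in>grid G. (norm (l \<nu> - l \<nu>))\<^sup>2) / h ^ DIM('a)) (sequentially \<times>\<^sub>F sequentially)"
      unfolding case_prod_beta using h
      by (intro tendsto_intros filterlim_compose[OF l filterlim_fst] filterlim_compose[OF l filterlim_snd]) auto
    then have "\<forall>\<^sub>F p in sequentially \<times>\<^sub>F sequentially.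
        (case p of (m, n) \<Rightarrow> (\<Sum>\<nu>\<in>grid G. (norm (a m \<nu> - a n \<nu>))\<^sup>2) / h ^ DIM('a)) < e\<^sup>2 / 2"
      using e by (intro order_tendstoD) auto
    then obtain N where N: "\<And>m n. m \<ge> N \<Longrightarrow> n \<ge> N \<Longrightarrow> (\<Sum>\<nu>\<in>grid G. (norm (a m \<nu> - a n \<nu>))\<^sup>2) / h ^ DIM('a) < e\<^sup>2 / 2"
      by (auto simp: eventually_prod_sequentially)
    have "L2_norm \<Omega> (\<lambda>x. \<psi> (r m) x - \<psi> (r n) x) < e" if mn: "m \<ge> N" "n \<ge> N" for m n
    proof -
      define w where "w = (\<lambda>x. \<psi> (r m) x - \<psi> (r n) x)"
      have w: "Cc1 w" unfolding w_def by (rule test_function_diff[OF \<psi> \<psi>])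
      have w0: "w x = 0" "partial_deriv i w x = 0" if "x \<notin> \<Omega>" for x i
        using test_functions_partial_zero[OF \<psi> that] by (simp_all add: w_def test_function_diff[OF \<psi> \<psi>])
      have supp: "\<bar>x \<bullet> i\<bar> < real G * h" if "w x \<noteq> 0" "i \<in> Basis" for x i
      proof -
        have "x \<in> \<Omega>" using w0(1)[of x] that by blast
        then have "\<bar>x \<bullet> i\<bar> \<le> R" using Basis_le_norm[OF that(2), of x] R[of x] by linarith
        also have "R < real G * h" using G h by (simp add: pos_divide_less_eq)
        finally show ?thesis .
      qed
      have int: "(\<integral>x\<in>cube h \<nu>. w x \<partial>lborel) = a m \<nu> - a n \<nu>" for \<nu>
        unfolding w_def a_def
        by (rule set_integral_diff) (simp_all add: set_integrable_def integrable_mult_indicator Cc1_integrable[OF C])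
      have pd: "L2_norm UNIV (partial_deriv i w) \<le> 2 * M" if i: "i \<in> Basis" for i
      proof -
        have "L2_norm UNIV (partial_deriv i w) = L2_norm \<Omega> (partial_deriv i w)"
          by (rule L2_norm_UNIV_test[OF Cc1_continuous_partial[OF w i] w0(2)])
        also have "\<dots> = L2_norm \<Omega> (\<lambda>x. partial_deriv i (\<psi> (r m)) x - partial_deriv i (\<psi> (r n)) x)"
          by (simp add: w_def test_function_diff[OF \<psi> \<psi>])
        also have "\<dots> \<le> L2_norm \<Omega> (\<lambda>x. partial_deriv i (\<psi> (r m)) x - 0) + L2_norm \<Omega> (\<lambda>x. 0 - partial_deriv i (\<psi> (r n)) x)"
          by (intro L2_norm_triangle_diff test_L2(2)[OF \<psi> i] L2_zero)
        also have "\<dots> \<le> 2 * M"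
          using M'[OF i, of "r m"] M'[OF i, of "r n"] L2_norm_minus_commute[of \<Omega> "\<lambda>_. 0" "partial_deriv i (\<psi> (r n))"] by simp
        finally show ?thesis .
      qed
      have "(L2_norm \<Omega> w)\<^sup>2 = (L2_norm UNIV w)\<^sup>2"
        by (simp add: L2_norm_UNIV_test[OF Cc1_continuous[OF w] w0(1)])
      also have "\<dots> \<le> (\<Sum>\<nu>\<in>grid G. (norm (a m \<nu> - a n \<nu>))\<^sup>2) / h ^ DIM('a)
         + 2 ^ DIM('a) * (h * (\<Sum>i\<in>Basis. L2_norm UNIV (partial_deriv i w)))\<^sup>2"
        using grid_inequality[OF w h supp] by (simp add: int)
      also have "2 ^ DIM('a) * (h * (\<Sum>i\<in>Basis. L2_norm UNIV (partial_deriv i w)))\<^sup>2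
          \<le> 2 ^ DIM('a) * (h * (DIM('a) * (2 * M)))\<^sup>2"
        using sum_bounded_above[OF pd] h
        by (intro mult_left_mono power_mono) (auto intro!: sum_nonneg mult_nonneg_nonneg)
      also have "\<dots> < e\<^sup>2 / 2" using k by (simp add: h_def)
      finally have "(L2_norm \<Omega> w)\<^sup>2 < e\<^sup>2" using N[OF mn] by linarith
      then show ?thesis unfolding w_def using e by (auto intro: power2_less_imp_less)
    qed
    then show ?thesis by blast
  qed
  with r show ?thesis by blast
qed

text \<open>Each function is replaced by a test function within \<open>1 / Suc n\<close> in value
  and gradient, which raises the bounds to \<open>M + 1\<close>. The Cauchy property passes back
  because \<open>r n \<ge> n\<close> keeps the errors small along the subsequence.\<close>

lemma rellich:
  fixes s :: "nat \<Rightarrow> 'a \<Rightarrow> 'b::euclidean_space"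
  assumes s: "\<And>n. grad_approx \<Omega> (s n) (S n)" and M: "\<And>n. L2_norm \<Omega> (s n) \<le> M"
    and M': "\<And>n i. i \<in> Basis \<Longrightarrow> L2_norm \<Omega> (S n i) \<le> M"
  shows "\<exists>r :: nat \<Rightarrow> nat. strict_mono r \<and>
    (\<forall>e>0. \<exists>N. \<forall>m\<ge>N. \<forall>n\<ge>N. L2_norm \<Omega> (\<lambda>x. s (r m) x - s (r n) x) < e)"
proof -
  have L: "s n \<in> L2 \<Omega>" "i \<in> Basis \<Longrightarrow> S n i \<in> L2 \<Omega>" for n i using s[of n] by (auto simp: grad_approx_def)
  have "\<exists>\<psi>. \<psi> \<in> test_functions \<Omega> \<and> L2_norm \<Omega> (\<lambda>x. \<psi> x - s n x) < 1 / real (Suc n) \<and>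
     (\<forall>i\<in>Basis. L2_norm \<Omega> (\<lambda>x. partial_deriv i \<psi> x - S n i x) < 1 / real (Suc n))" for n
    using grad_approx_test_near[OF s[of n], of "1 / real (Suc n)"] by auto
  then obtain \<psi> where \<psi>: "\<And>n. \<psi> n \<in> test_functions \<Omega>" "\<And>n. L2_norm \<Omega> (\<lambda>x. \<psi> n x - s n x) < 1 / real (Suc n)"
     "\<And>n i. i \<in> Basis \<Longrightarrow> L2_norm \<Omega> (\<lambda>x. partial_deriv i (\<psi> n) x - S n i x) < 1 / real (Suc n)"
    by metis
  have le1: "1 / real (Suc n) \<le> 1" for n by simp
  have b1: "L2_norm \<Omega> (\<psi> n) \<le> M + 1" for n
    using L2_norm_diff_le[OF test_L2(1)[OF \<psi>(1)] L(1), of n n] M[of n] \<psi>(2)[of n] le1[of n] by linarith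
  have b2: "L2_norm \<Omega> (partial_deriv i (\<psi> n)) \<le> M + 1" if i: "i \<in> Basis" for n i
    using L2_norm_diff_le[OF test_L2(2)[OF \<psi>(1) i] L(2)[OF i], of n n] M'[OF i, of n] \<psi>(3)[OF i, of n] le1[of n] by linarith
  obtain r :: "nat \<Rightarrow> nat" where r: "strict_mono r"
    and cau: "\<And>e. e > 0 \<Longrightarrow> \<exists>N. \<forall>m\<ge>N. \<forall>n\<ge>N. L2_norm \<Omega> (\<lambda>x. \<psi> (r m) x - \<psi> (r n) x) < e"
    using rellich_test[where \<psi> = \<psi>, OF \<psi>(1) b1 b2] by auto
  have "\<exists>N. \<forall>m\<ge>N. \<forall>n\<ge>N. L2_norm \<Omega> (\<lambda>x. s (r m) x - s (r n) x) < e" if e: "e > 0" for e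
  proof -
    obtain N1 where N1: "\<And>m n. m \<ge> N1 \<Longrightarrow> n \<ge> N1 \<Longrightarrow> L2_norm \<Omega> (\<lambda>x. \<psi> (r m) x - \<psi> (r n) x) < e / 3"
      using cau[of "e / 3"] e by auto
    obtain N2 :: nat where N2: "3 / e < real N2" using reals_Archimedean2 by blast
    have small: "L2_norm \<Omega> (\<lambda>x. \<psi> (r m) x - s (r m) x) < e / 3" if "m \<ge> N2" for m
    proof -
      have "3 / e < real (Suc (r m))" using N2 that seq_suble[OF r, of m] by linarith
      then have "1 / real (Suc (r m)) < e / 3" using e by (simp add: field_simps)
      then show ?thesis using \<psi>(2)[of "r m"] by linarith
    qed
    have "L2_norm \<Omega> (\<lambda>x. s (r m) x - s (r n) x) < e" if "m \<ge> max N1 N2" "n \<ge> max N1 N2" for m n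
      using L2_norm_triangle_diff[OF L(1) L(1) test_L2(1)[OF \<psi>(1)], of "r m" "r n" "r m"]
        L2_norm_triangle_diff[OF test_L2(1)[OF \<psi>(1)] L(1) test_L2(1)[OF \<psi>(1)], of "r m" "r n" "r n"]
        small[of m] small[of n] N1[of m n] that L2_norm_minus_commute[of \<Omega> "\<psi> (r m)" "s (r m)"] by simp
    then show ?thesis by blast
  qed
  with r show ?thesis by blast
qed

end

section \<open>The spectral lower bound\<close>

text \<open>Gaussian elimination: a pivot \<open>p\<close> for the last equation is removed from the
  unknowns, and induction solves the reduced system. It serves to count eigenfunctions against
  \<open>has_multiplicity\<close>.\<close>

lemma linear_dependence:
  fixes c :: "'k \<Rightarrow> nat \<Rightarrow> complex"
  assumes "finite K" "card K > n"
  shows "\<exists>d. (\<exists>k\<in>K. d k \<noteq> 0) \<and> (\<forall>i<n. (\<Sum>k\<in>K. d k * c k i) = 0)"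
  using assms
proof (induction n arbitrary: K c)
  case 0
  then have "K \<noteq> {}" by auto
  then show ?case by (intro exI[of _ "\<lambda>_. 1"]) auto
next
  case (Suc n)
  show ?case
  proof (cases "\<forall>k\<in>K. c k n = 0")
    case True
    then show ?thesis using Suc.IH[OF Suc.prems(1), of c] Suc.prems(2) by (auto simp: less_Suc_eq)
  next
    case False
    then obtain p where p: "p \<in> K" "c p n \<noteq> 0" by blast
    have "card (K - {p}) > n" using Suc.prems p by simp
    then obtain d where d: "\<exists>k\<in>K - {p}. d k \<noteq> 0"
      "\<And>i. i < n \<Longrightarrow> (\<Sum>k\<in>K - {p}. d k * (c k i - c k n / c p n * c p i)) = 0"
      using Suc.IH[of "K - {p}" "\<lambda>k i. c k i - c k n / c p n * c p i"] Suc.prems by auto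
    \<comment> \<open>The value at the pivot is forced by equation \<open>n\<close>.\<close>
    define d' where "d' = d(p := - (\<Sum>k\<in>K - {p}. d k * c k n) / c p n)"
    have "(\<Sum>k\<in>K. d' k * c k i) = (\<Sum>k\<in>K - {p}. d k * (c k i - c k n / c p n * c p i))" for i
    proof -
      have "(\<Sum>k\<in>K. d' k * c k i) = d' p * c p i + (\<Sum>k\<in>K - {p}. d k * c k i)"
        using Suc.prems p by (subst sum.remove[of _ p]) (auto simp: d'_def intro!: sum.cong)
      also have "d' p * c p i = - (\<Sum>k\<in>K - {p}. d k * (c k n / c p n * c p i))"
        by (simp add: d'_def sum_distrib_right sum_divide_distrib mult.assoc)
      finally show ?thesis by (simp add: right_diff_distrib sum_subtractf)
    qed
    then have "(\<Sum>k\<in>K. d' k * c k i) = 0" if "i < Suc n" for i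
      using that d(2) p by (auto simp: less_Suc_eq)
    moreover have "\<exists>k\<in>K. d' k \<noteq> 0" using d(1) by (auto simp: d'_def)
    ultimately show ?thesis by blast
  qed
qed

text \<open>The elements are functions rather than classes, so a form may be degenerate. The energy,
  the inner product and their shifts share this algebra, on \<open>H10\<close>, on \<open>L2\<close>
  or on a subspace. Combinations are kept in the shape \<open>a * f x + b * g x\<close>, if
  necessary with coefficients \<open>1\<close> and \<open>-1\<close>, to match
  \<open>lin_mem\<close>.\<close>

locale hermitian_form =
  fixes H :: "('a \<Rightarrow> complex) set" and q :: "('a \<Rightarrow> complex) \<Rightarrow> ('a \<Rightarrow> complex) \<Rightarrow> complex"
  assumes zero_mem: "(\<lambda>x. 0) \<in> H"
    and lin_mem: "\<And>a b f g. f \<in> H \<Longrightarrow> g \<in> H \<Longrightarrow> (\<lambda>x. a * f x + b * g x) \<in> H"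
    and lin: "\<And>a b f g h. f \<in> H \<Longrightarrow> g \<in> H \<Longrightarrow> h \<in> H \<Longrightarrow> q (\<lambda>x. a * f x + b * g x) h = a * q f h + b * q g h"
    and herm: "\<And>f g. f \<in> H \<Longrightarrow> g \<in> H \<Longrightarrow> q g f = cnj (q f g)"
begin

lemma lin_right:
  assumes "f \<in> H" "g \<in> H" "h \<in> H"
  shows "q h (\<lambda>x. a * f x + b * g x) = cnj a * q h f + cnj b * q h g"
  using assms herm[OF lin_mem[OF assms(1,2), of a b] assms(3)] lin[OF assms, of a b]
    herm[OF assms(1,3)] herm[OF assms(2,3)] by simp

lemma zero_left: "f \<in> H \<Longrightarrow> q (\<lambda>x. 0) f = 0"
  using lin[OF zero_mem zero_mem, of f 0 0] by simp

lemma sum_mem: "finite J \<Longrightarrow> (\<And>j. j \<in> J \<Longrightarrow> f j \<in> H) \<Longrightarrow> (\<lambda>x. \<Sum>j\<in>J. c j * f j x) \<in> H"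
proof (induction J rule: finite_induct)
  case (insert j J)
  then show ?case using lin_mem[of "f j" "\<lambda>x. \<Sum>j\<in>J. c j * f j x" "c j" 1] by simp
qed (simp add: zero_mem)

lemma sum_left:
  "finite J \<Longrightarrow> (\<And>j. j \<in> J \<Longrightarrow> f j \<in> H) \<Longrightarrow> g \<in> H \<Longrightarrow> q (\<lambda>x. \<Sum>j\<in>J. c j * f j x) g = (\<Sum>j\<in>J. c j * q (f j) g)"
proof (induction J rule: finite_induct)
  case (insert j J)
  then show ?case using lin[of "f j" "\<lambda>x. \<Sum>j\<in>J. c j * f j x" g "c j" 1] by (simp add: sum_mem)
qed (simp add: zero_left)

lemma sum_right:
  assumes "finite J" "\<And>j. j \<in> J \<Longrightarrow> f j \<in> H" "g \<in> H"
  shows "q g (\<lambda>x. \<Sum>j\<in>J. c j * f j x) = (\<Sum>j\<in>J. cnj (c j) * q g (f j))"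
  using assms by (subst herm[OF sum_mem[OF assms(1,2)] assms(3)]) (simp_all add: sum_left herm[of g])

lemma diag_lin:
  assumes "f \<in> H" "g \<in> H"
  shows "Re (q (\<lambda>x. a * f x + b * g x) (\<lambda>x. a * f x + b * g x))
    = (cmod a)\<^sup>2 * Re (q f f) + (cmod b)\<^sup>2 * Re (q g g) + 2 * Re (a * cnj b * q f g)"
proof -
  have "q (\<lambda>x. a * f x + b * g x) (\<lambda>x. a * f x + b * g x)
      = (a * cnj a) * q f f + (b * cnj b) * q g g + (a * cnj b * q f g + cnj (a * cnj b * q f g))"
    using assms by (simp add: lin lin_mem lin_right herm[OF assms] algebra_simps)
  also have "\<dots> = of_real ((cmod a)\<^sup>2) * q f f + of_real ((cmod b)\<^sup>2) * q g g + (a * cnj b * q f g + cnj (a * cnj b * q f g))"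
    by (simp only: complex_norm_square)
  finally show ?thesis by (simp add: algebra_simps del: of_real_power)
qed

lemma parallelogram:
  assumes "f \<in> H" "g \<in> H"
  shows "Re (q (\<lambda>x. 1 * f x + (-1) * g x) (\<lambda>x. 1 * f x + (-1) * g x))
      = 2 * Re (q f f) + 2 * Re (q g g) - Re (q (\<lambda>x. 1 * f x + 1 * g x) (\<lambda>x. 1 * f x + 1 * g x))"
  using diag_lin[OF assms, of 1 1] diag_lin[OF assms, of 1 "-1"] by simp

end

locale psd_form = hermitian_form +
  assumes nonneg: "\<And>f. f \<in> H \<Longrightarrow> 0 \<le> Re (q f f)"
begin

text \<open>If \<open>q f f\<close> vanishes, the form along \<open>g - t * cnj (q f g) * f\<close>
  is affine in \<open>t\<close> and would become negative. Applied to a shifted form, this is the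
  Euler-Lagrange equation of a minimizer.\<close>

lemma null_orthogonal:
  assumes f: "f \<in> H" and g: "g \<in> H" and 0: "Re (q f f) = 0"
  shows "q f g = 0"
proof (rule ccontr)
  assume "q f g \<noteq> 0"
  then have c: "(cmod (q f g))\<^sup>2 > 0" by simp
  \<comment> \<open>This value makes the form equal to \<open>- Re (q g g) - 2\<close>.\<close>
  define t where "t = (Re (q g g) + 1) / (cmod (q f g))\<^sup>2"
  have "0 \<le> Re (q (\<lambda>x. (- of_real t * cnj (q f g)) * f x + 1 * g x) (\<lambda>x. (- of_real t * cnj (q f g)) * f x + 1 * g x))"
    by (rule nonneg[OF lin_mem[OF f g]])
  also have "\<dots> = Re (q g g) - 2 * t * (cmod (q f g))\<^sup>2"
  proof -
    have "(- of_real t * cnj (q f g)) * cnj 1 * q f g = of_real (- t * (cmod (q f g))\<^sup>2)"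
      by (simp only: of_real_mult of_real_minus complex_norm_square) (simp add: mult_ac)
    then have "Re ((- of_real t * cnj (q f g)) * cnj 1 * q f g) = - t * (cmod (q f g))\<^sup>2"
      by (simp only: Re_complex_of_real)
    then show ?thesis by (subst diag_lin[OF f g]) (simp add: 0)
  qed
  also have "\<dots> = - Re (q g g) - 2" using c by (simp add: t_def)
  finally show False using nonneg[OF g] by linarith
qed

end

section \<open>The Dirichlet form and its eigenspaces\<close>

context bounded_open_set
begin

definition energy :: "('a \<Rightarrow> complex) \<Rightarrow> ('a \<Rightarrow> complex) \<Rightarrow> complex" where
  "energy f g = (\<Sum>i\<in>Basis. L2_inner \<Omega> (weak_partial \<Omega> i f) (weak_partial \<Omega> i g))"

text \<open>Gradients found by approximation may replace the chosen ones, since they agree almost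
  everywhere.\<close>

lemma energy_eq:
  assumes f: "grad_approx \<Omega> f F" and g: "grad_approx \<Omega> g G"
  shows "energy f g = (\<Sum>i\<in>Basis. L2_inner \<Omega> (F i) (G i))"
  unfolding energy_def
proof (rule sum.cong[OF refl])
  fix i :: 'a assume i: "i \<in> Basis"
  show "L2_inner \<Omega> (weak_partial \<Omega> i f) (weak_partial \<Omega> i g) = L2_inner \<Omega> (F i) (G i)"
    by (intro L2_inner_cong_AE weak_partial_AE[OF f i] weak_partial_AE[OF g i]
          weak_partial_L2[OF grad_approx_H10[OF f] i] weak_partial_L2[OF grad_approx_H10[OF g] i])
       (use f g i in \<open>simp_all add: grad_approx_def\<close>)
qed

lemma energy_self:
  assumes "grad_approx \<Omega> f F"
  shows "energy f f = complex_of_real (\<Sum>i\<in>Basis. (L2_norm \<Omega> (F i))\<^sup>2)"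
  using assms unfolding energy_eq[OF assms assms]
  by (auto simp: grad_approx_def L2_inner_self simp del: of_real_power)

lemma grad_approx_zero: "grad_approx \<Omega> (\<lambda>x. 0 :: 'b::euclidean_space) (\<lambda>i x. 0)"
proof -
  have "partial_deriv i (\<lambda>x. 0 :: 'b) = (\<lambda>x. 0)" for i :: 'a
    by (rule ext, rule partial_deriv_eq) simp
  moreover have "(\<lambda>x. 0 :: 'b) \<in> test_functions \<Omega>"
    by (rule test_functions_I[of _ "{}"]) auto
  ultimately show ?thesis
    unfolding grad_approx_def by (auto intro!: exI[of _ "\<lambda>n x. 0"])
qed

lemma H10_lin:
  fixes f g :: "'a \<Rightarrow> complex"
  shows "f \<in> H10 \<Omega> \<Longrightarrow> g \<in> H10 \<Omega> \<Longrightarrow> (\<lambda>x. a * f x + b * g x) \<in> H10 \<Omega>"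
  using grad_approx_H10[OF grad_approx_lin[OF H10_grad_approx H10_grad_approx]] by blast

lemma energy_psd: "psd_form (H10 \<Omega>) energy"
proof
  show "(\<lambda>x. 0 :: complex) \<in> H10 \<Omega>" using grad_approx_H10[OF grad_approx_zero] .
  fix f g h :: "'a \<Rightarrow> complex" and a b
  assume f: "f \<in> H10 \<Omega>" and g: "g \<in> H10 \<Omega>"
  note F = H10_grad_approx[OF f] and G = H10_grad_approx[OF g]
  show "(\<lambda>x. a * f x + b * g x) \<in> H10 \<Omega>" by (rule H10_lin[OF f g])
  show "energy g f = cnj (energy f g)"
    unfolding energy_def cnj_sum by (rule sum.cong[OF refl]) (rule L2_inner_commute)
  assume h: "h \<in> H10 \<Omega>"
  show "energy (\<lambda>x. a * f x + b * g x) h = a * energy f h + b * energy g h"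
    unfolding energy_eq[OF grad_approx_lin[OF F G, of a b] H10_grad_approx[OF h]]
      energy_eq[OF F H10_grad_approx[OF h]] energy_eq[OF G H10_grad_approx[OF h]]
      sum_distrib_left sum.distrib[symmetric]
    by (intro sum.cong refl L2_inner_lin weak_partial_L2 f g h)
next
  fix f :: "'a \<Rightarrow> complex" assume "f \<in> H10 \<Omega>"
  from energy_self[OF H10_grad_approx[OF this]] show "0 \<le> Re (energy f f)"
    by (simp add: sum_nonneg del: of_real_sum of_real_power)
qed

lemma inner_psd: "psd_form (H10 \<Omega>) (L2_inner \<Omega>)"
proof
  show "(\<lambda>x. 0 :: complex) \<in> H10 \<Omega>" using grad_approx_H10[OF grad_approx_zero] .
  fix f g h :: "'a \<Rightarrow> complex" and a b
  assume f: "f \<in> H10 \<Omega>" and g: "g \<in> H10 \<Omega>"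
  show "(\<lambda>x. a * f x + b * g x) \<in> H10 \<Omega>" by (rule H10_lin[OF f g])
  show "L2_inner \<Omega> g f = cnj (L2_inner \<Omega> f g)" by (rule L2_inner_commute)
  assume "h \<in> H10 \<Omega>"
  then show "L2_inner \<Omega> (\<lambda>x. a * f x + b * g x) h = a * L2_inner \<Omega> f h + b * L2_inner \<Omega> g h"
    using f g by (intro L2_inner_lin H10_L2)
next
  fix f :: "'a \<Rightarrow> complex" assume "f \<in> H10 \<Omega>"
  then show "0 \<le> Re (L2_inner \<Omega> f f)" by (simp add: L2_inner_self H10_L2 del: of_real_power)
qed

sublocale energy: psd_form "H10 \<Omega>" energy by (rule energy_psd)
sublocale inner: psd_form "H10 \<Omega>" "L2_inner \<Omega>" by (rule inner_psd)

text \<open>The form of the operator \<open>-\<Delta> - z\<close>. By \<open>eigenspace_iff\<close>,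
  a member of \<open>H10\<close> is an eigenfunction for \<open>z\<close> exactly when this form
  pairs it to \<open>0\<close> with all of \<open>H10\<close>.\<close>

definition shifted :: "real \<Rightarrow> ('a \<Rightarrow> complex) \<Rightarrow> ('a \<Rightarrow> complex) \<Rightarrow> complex" where
  "shifted z f g = energy f g - complex_of_real z * L2_inner \<Omega> f g"

sublocale shifted: hermitian_form "H10 \<Omega>" "shifted z" for z
proof
  show "(\<lambda>x. 0 :: complex) \<in> H10 \<Omega>" by (rule inner.zero_mem)
  fix f g h :: "'a \<Rightarrow> complex" and a b
  assume f: "f \<in> H10 \<Omega>" and g: "g \<in> H10 \<Omega>"
  show "(\<lambda>x. a * f x + b * g x) \<in> H10 \<Omega>" by (rule H10_lin[OF f g])
  show "shifted z g f = cnj (shifted z f g)"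
    using energy.herm[OF f g] inner.herm[OF f g] by (simp add: shifted_def)
  assume "h \<in> H10 \<Omega>"
  then show "shifted z (\<lambda>x. a * f x + b * g x) h = a * shifted z f h + b * shifted z g h"
    using f g by (simp add: shifted_def energy.lin inner.lin algebra_simps)
qed

lemma Re_inner_self: "f \<in> H10 \<Omega> \<Longrightarrow> Re (L2_inner \<Omega> f f) = (L2_norm \<Omega> f)\<^sup>2"
  by (simp add: L2_inner_self H10_L2 del: of_real_power)

lemma eigenspace_iff:
  "w \<in> eigenspace \<Omega> \<mu> \<longleftrightarrow> w \<in> H10 \<Omega> \<and> (\<forall>v\<in>H10 \<Omega>. energy w v = complex_of_real \<mu> * L2_inner \<Omega> w v)"
proof -
  have "L2_inner \<Omega> (\<lambda>x. complex_of_real \<mu> * w x) v = complex_of_real \<mu> * L2_inner \<Omega> w v"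
    if "w \<in> H10 \<Omega>" "v \<in> H10 \<Omega>" for v
    using L2_inner_lin[OF H10_L2[OF that(1)] H10_L2[OF that(1)] H10_L2[OF that(2)], of "of_real \<mu>" 0] by simp
  then show ?thesis
    unfolding eigenspace_def dirichlet_laplacian_def energy_def
    by (auto intro: L2_cmult H10_L2)
qed

text \<open>Together with \<open>w\<close> there are \<open>card T + 1\<close> functions in a space
  of dimension \<open>card T\<close>, hence a nontrivial relation. Orthonormality removes the
  coefficients of the \<open>u j\<close>, so the coefficient of \<open>w\<close> is nonzero and
  \<open>w\<close> has norm \<open>0\<close>.\<close>

lemma eigenspace_orthonormal_span:
  fixes u :: "nat \<Rightarrow> 'a \<Rightarrow> complex"
  assumes mult: "has_multiplicity \<Omega> \<mu> (card T)" and T: "finite T" "0 \<notin> T"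
    and u: "\<And>j. j \<in> T \<Longrightarrow> u j \<in> eigenspace \<Omega> \<mu>"
    and on: "\<And>i j. i \<in> T \<Longrightarrow> j \<in> T \<Longrightarrow> L2_inner \<Omega> (u i) (u j) = (if i = j then 1 else 0)"
    and w: "w \<in> eigenspace \<Omega> \<mu>" and perp: "\<And>j. j \<in> T \<Longrightarrow> L2_inner \<Omega> w (u j) = 0"
  shows "L2_norm \<Omega> w = 0"
proof -
  \<comment> \<open>The index \<open>0\<close> is free for \<open>w\<close>, because eigenvalues are
    numbered from \<open>1\<close>.\<close>
  define f where "f k = (if k = (0::nat) then w else u k)" for k
  let ?K = "insert 0 T"
  have fE: "f k \<in> eigenspace \<Omega> \<mu>" if "k \<in> ?K" for k
    using that u w by (auto simp: f_def)
  then have fH: "f k \<in> H10 \<Omega>" if "k \<in> ?K" for k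
    using that by (auto simp: eigenspace_iff)
  obtain v where v: "\<And>w. w \<in> eigenspace \<Omega> \<mu> \<Longrightarrow> \<exists>c. AE x in lebesgue_on \<Omega>. w x = (\<Sum>i<card T. c i * v i x)"
    using mult unfolding has_multiplicity_def by blast
  have "\<exists>c. AE x in lebesgue_on \<Omega>. f k x = (\<Sum>i<card T. c i * v i x)" if "k \<in> ?K" for k
    using v[OF fE[OF that]] .
  then obtain c where c: "\<And>k. k \<in> ?K \<Longrightarrow> AE x in lebesgue_on \<Omega>. f k x = (\<Sum>i<card T. c k i * v i x)"
    by metis
  obtain d where d: "\<exists>k\<in>?K. d k \<noteq> 0" "\<And>i. i < card T \<Longrightarrow> (\<Sum>k\<in>?K. d k * c k i) = 0"
    using linear_dependence[of ?K "card T" c] T by auto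
  define g where "g x = (\<Sum>k\<in>?K. d k * f k x)" for x
  have "AE x in lebesgue_on \<Omega>. \<forall>k\<in>?K. f k x = (\<Sum>i<card T. c k i * v i x)"
    using c T by (subst AE_finite_all) auto
  then have g0: "AE x in lebesgue_on \<Omega>. g x = 0"
  proof eventually_elim
    case (elim x)
    have "g x = (\<Sum>k\<in>?K. d k * (\<Sum>i<card T. c k i * v i x))"
      unfolding g_def using elim by (intro sum.cong) auto
    also have "\<dots> = (\<Sum>i<card T. (\<Sum>k\<in>?K. d k * c k i) * v i x)"
      unfolding sum_distrib_left sum_distrib_right by (subst sum.swap) (simp add: mult.assoc)
    also have "\<dots> = 0" using d(2) by simp
    finally show ?case .
  qed
  have inner_g: "L2_inner \<Omega> g h = 0" for h
    unfolding L2_inner_def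
    by (rule integral_eq_zero_AE) (use g0 in eventually_elim, simp)
  have sum: "L2_inner \<Omega> g h = (\<Sum>k\<in>?K. d k * L2_inner \<Omega> (f k) h)" if "h \<in> H10 \<Omega>" for h
    unfolding g_def using T fH that by (intro inner.sum_left) auto
  have fT: "f k = u k" if "k \<in> T" for k using that T by (auto simp: f_def)
  \<comment> \<open>Pairing the relation with \<open>u j\<close> isolates the coefficient
    \<open>d j\<close>.\<close>
  have dT: "d j = 0" if j: "j \<in> T" for j
  proof -
    have "0 = (\<Sum>k\<in>?K. d k * L2_inner \<Omega> (f k) (u j))"
      using sum[of "u j"] inner_g fH[of j] j fT by simp
    also have "\<dots> = (\<Sum>k\<in>T. d k * L2_inner \<Omega> (f k) (u j))"
      using T perp[OF j] by (simp add: f_def)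
    also have "\<dots> = (\<Sum>k\<in>T. if k = j then d k else 0)"
      using j by (intro sum.cong refl) (simp add: fT on)
    also have "\<dots> = d j" using T j by simp
    finally show ?thesis by simp
  qed
  then have d0: "d 0 \<noteq> 0" using d(1) by auto
  have "w \<in> H10 \<Omega>" using fH[of 0] by (simp add: f_def)
  then have "0 = (\<Sum>k\<in>?K. d k * L2_inner \<Omega> (f k) w)" using sum[of w] inner_g by simp
  also have "\<dots> = d 0 * L2_inner \<Omega> w w" using T dT by (simp add: f_def)
  finally have "L2_inner \<Omega> w w = 0" using d0 by simp
  then show ?thesis using Re_inner_self[OF \<open>w \<in> H10 \<Omega>\<close>] by simp
qed

lemma weak_partial_norm_le_energy:
  assumes "grad_approx \<Omega> f F" "i \<in> Basis"
  shows "(L2_norm \<Omega> (F i))\<^sup>2 \<le> Re (energy f f)"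
  unfolding energy_self[OF assms(1)] using assms(2)
  by (simp add: member_le_sum[of i Basis "\<lambda>i. (L2_norm \<Omega> (F i))\<^sup>2"] del: of_real_sum of_real_power)

text \<open>Rellich makes a minimizing sequence Cauchy in \<open>L2\<close>, and the parallelogram
  identity lifts this to the gradients: the sum of two almost minimizing functions still has energy
  at least \<mu> times its squared norm, which leaves little energy for the difference. The limit
  thus exists in \<open>H10\<close> and its energy is the infimum.\<close>

lemma rayleigh_minimizer:
  assumes V: "V \<subseteq> H10 \<Omega>" and ex: "w0 \<in> V" "L2_norm \<Omega> w0 = 1"
    and V_lin: "\<And>a b f g. f \<in> V \<Longrightarrow> g \<in> V \<Longrightarrow> (\<lambda>x. a * f x + b * g x) \<in> V"
    and V_closed: "\<And>s f. (\<And>n. s n \<in> V) \<Longrightarrow> f \<in> H10 \<Omega> \<Longrightarrow> (\<lambda>n. L2_norm \<Omega> (\<lambda>x. s n x - f x)) \<longlonglongrightarrow> 0 \<Longrightarrow> f \<in> V"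
  obtains w where "w \<in> V" "L2_norm \<Omega> w = 1"
    "\<And>v. v \<in> V \<Longrightarrow> Re (energy w w) * (L2_norm \<Omega> v)\<^sup>2 \<le> Re (energy v v)"
proof -
  define E where "E w = Re (energy w w)" for w
  define X where "X = {E w |w. w \<in> V \<and> L2_norm \<Omega> w = 1}"
  have E0: "0 \<le> E w" if "w \<in> V" for w unfolding E_def using energy.nonneg V that by blast
  have Xb: "bdd_below X" unfolding X_def by (rule bdd_belowI[of _ 0]) (auto intro: E0)
  have Xne: "X \<noteq> {}" using ex by (auto simp: X_def)
  define \<mu> where "\<mu> = Inf X"
  have \<mu>0: "0 \<le> \<mu>" unfolding \<mu>_def using Xne E0 by (intro cInf_greatest) (auto simp: X_def)
  have scale: "E (\<lambda>x. a * v x + 0 * v x) = (cmod a)\<^sup>2 * E v" if "v \<in> V" for v a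
    unfolding E_def using energy.diag_lin[of v v a 0] V that by auto
  have \<mu>_le: "\<mu> * (L2_norm \<Omega> v)\<^sup>2 \<le> E v" if v: "v \<in> V" for v
  proof (cases "L2_norm \<Omega> v = 0")
    case False
    define a where "a = complex_of_real (1 / L2_norm \<Omega> v)"
    have "L2_norm \<Omega> (\<lambda>x. a * v x + 0 * v x) = 1"
      using False L2_norm_cmult[of \<Omega> a v] by (simp add: a_def norm_divide)
    then have "E (\<lambda>x. a * v x + 0 * v x) \<in> X"
      using V_lin[OF v v, of a 0] unfolding X_def by blast
    then have "\<mu> \<le> E (\<lambda>x. a * v x + 0 * v x)"
      unfolding \<mu>_def by (rule cInf_lower[OF _ Xb])
    also have "\<dots> = E v / (L2_norm \<Omega> v)\<^sup>2"
      unfolding scale[OF v] by (simp add: a_def norm_divide power_divide)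
    finally show ?thesis using False by (simp add: pos_le_divide_eq)
  qed (simp add: E0[OF v])
  have "\<exists>w\<in>V. L2_norm \<Omega> w = 1 \<and> E w < \<mu> + 1 / real (Suc n)" for n
  proof -
    have "Inf X < \<mu> + 1 / real (Suc n)" by (simp add: \<mu>_def)
    from cInf_lessD[OF Xne this] show ?thesis by (auto simp: X_def)
  qed
  then obtain s where s: "\<And>n. s n \<in> V" "\<And>n. L2_norm \<Omega> (s n) = 1" "\<And>n. E (s n) < \<mu> + 1 / real (Suc n)"
    by metis
  have sH: "s n \<in> H10 \<Omega>" for n using s(1) V by blast
  note S = H10_grad_approx[OF sH]
  have inv1: "1 / real (Suc n) \<le> 1" for n by simp
  \<comment> \<open>The constant is generous: its square exceeds \<open>\<mu> + 1\<close>, and it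
    also bounds the norm \<open>1\<close> of \<open>s n\<close>, so it serves both bounds demanded
    by \<open>rellich\<close>.\<close>
  have "L2_norm \<Omega> (weak_partial \<Omega> i (s n)) \<le> \<mu> + 2" if i: "i \<in> Basis" for n i
  proof (rule power2_le_imp_le)
    have "(L2_norm \<Omega> (weak_partial \<Omega> i (s n)))\<^sup>2 \<le> E (s n)"
      unfolding E_def by (rule weak_partial_norm_le_energy[OF S i])
    also have "\<dots> \<le> \<mu> + 1" using s(3)[of n] inv1[of n] by linarith
    also have "\<dots> \<le> (\<mu> + 2)\<^sup>2" using \<mu>0 by (simp add: power2_eq_square algebra_simps add_increasing)
    finally show "(L2_norm \<Omega> (weak_partial \<Omega> i (s n)))\<^sup>2 \<le> (\<mu> + 2)\<^sup>2" .
  qed (use \<mu>0 in simp)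
  then obtain r :: "nat \<Rightarrow> nat" where r: "strict_mono r"
    and cau: "\<And>e. e > 0 \<Longrightarrow> \<exists>N. \<forall>m\<ge>N. \<forall>n\<ge>N. L2_norm \<Omega> (\<lambda>x. s (r m) x - s (r n) x) < e"
    using rellich[where s = s, OF S, of "\<mu> + 2"] s(2) \<mu>0 by auto
  define t where "t n = s (r n)" for n
  have tV: "t n \<in> V" and tH: "t n \<in> H10 \<Omega>" and t1: "L2_norm \<Omega> (t n) = 1" for n
    using s sH by (auto simp: t_def)
  have tE: "E (t n) < \<mu> + 1 / real (Suc n)" for n
  proof -
    have "1 / real (Suc (r n)) \<le> 1 / real (Suc n)"
      using seq_suble[OF r, of n] by (intro divide_left_mono) auto
    then show ?thesis using s(3)[of "r n"] by (simp add: t_def)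
  qed
  define D where "D n i = weak_partial \<Omega> i (t n)" for n i
  have tD: "grad_approx \<Omega> (t n) (D n)" for n unfolding D_def by (rule H10_grad_approx[OF tH])
  have DL: "D n i \<in> L2 \<Omega>" if "i \<in> Basis" for n i using tD[of n] that by (simp add: grad_approx_def)
  have cau_t: "\<exists>N. \<forall>m\<ge>N. \<forall>n\<ge>N. L2_norm \<Omega> (\<lambda>x. t m x - t n x) < e" if "e > 0" for e
    using cau[OF that] by (simp add: t_def)
  have Ediff: "(L2_norm \<Omega> (\<lambda>x. D m i x - D n i x))\<^sup>2
      \<le> 2 / real (Suc m) + 2 / real (Suc n) + \<mu> * (L2_norm \<Omega> (\<lambda>x. t m x - t n x))\<^sup>2" if i: "i \<in> Basis" for i m n
  proof -
    let ?d = "\<lambda>x. 1 * t m x + (-1) * t n x" and ?p = "\<lambda>x. 1 * t m x + 1 * t n x"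
    have "(L2_norm \<Omega> (\<lambda>x. D m i x - D n i x))\<^sup>2 \<le> E ?d"
      using weak_partial_norm_le_energy[OF grad_approx_lin[OF tD tD] i, of 1 m "-1" n] by (simp add: E_def)
    also have "E ?d = 2 * E (t m) + 2 * E (t n) - E ?p"
      unfolding E_def by (rule energy.parallelogram[OF tH tH])
    also have "\<dots> \<le> 2 * E (t m) + 2 * E (t n) - \<mu> * (L2_norm \<Omega> ?p)\<^sup>2"
      using \<mu>_le[OF V_lin[OF tV tV], of 1 m 1 n] by simp
    also have "(L2_norm \<Omega> ?p)\<^sup>2 = 4 - (L2_norm \<Omega> ?d)\<^sup>2"
      using inner.parallelogram[OF tH tH, of m n] t1
      by (simp add: Re_inner_self H10_lin[OF tH tH, of 1 _ 1, simplified] H10_lin[OF tH tH, of 1 _ "-1", simplified] tH)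
    finally have "(L2_norm \<Omega> (\<lambda>x. D m i x - D n i x))\<^sup>2 \<le> 2 * E (t m) + 2 * E (t n) - \<mu> * (4 - (L2_norm \<Omega> ?d)\<^sup>2)"
      by simp
    also have "\<dots> = 2 * (E (t m) - \<mu>) + 2 * (E (t n) - \<mu>) + \<mu> * (L2_norm \<Omega> (\<lambda>x. t m x - t n x))\<^sup>2"
      by (simp add: algebra_simps)
    also have "\<dots> \<le> 2 * (1 / real (Suc m)) + 2 * (1 / real (Suc n)) + \<mu> * (L2_norm \<Omega> (\<lambda>x. t m x - t n x))\<^sup>2"
      by (intro order_refl add_mono mult_left_mono) (use tE[of m] tE[of n] in simp_all)
    finally show ?thesis by simp
  qed
  have cau_D: "\<exists>N. \<forall>m\<ge>N. \<forall>n\<ge>N. L2_norm \<Omega> (\<lambda>x. D m i x - D n i x) < e" if i: "i \<in> Basis" and e: "e > 0" for i e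
  proof -
    \<comment> \<open>The minimum with \<open>1\<close> gives
      \<open>\<delta>\<^sup>2 \<le> \<delta>\<close>; the denominator with \<open>\<mu> + 1\<close>
      covers \<open>\<mu> = 0\<close>.\<close>
    define \<delta> where "\<delta> = min 1 (e\<^sup>2 / (4 * (\<mu> + 1)))"
    have \<delta>: "\<delta> > 0" using e \<mu>0 by (simp add: \<delta>_def)
    obtain N1 where N1: "\<And>m n. m \<ge> N1 \<Longrightarrow> n \<ge> N1 \<Longrightarrow> L2_norm \<Omega> (\<lambda>x. t m x - t n x) < \<delta>"
      using cau_t[OF \<delta>] by blast
    obtain N2 :: nat where N2: "8 / e\<^sup>2 < real N2" using reals_Archimedean2 by blast
    have small: "2 / real (Suc m) < e\<^sup>2 / 4" if "m \<ge> N2" for m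
    proof -
      have "8 / e\<^sup>2 < real (Suc m)" using N2 that by linarith
      then show ?thesis using e by (simp add: field_simps)
    qed
    have "L2_norm \<Omega> (\<lambda>x. D m i x - D n i x) < e" if mn: "m \<ge> max N1 N2" "n \<ge> max N1 N2" for m n
    proof -
      have "(L2_norm \<Omega> (\<lambda>x. t m x - t n x))\<^sup>2 \<le> \<delta>\<^sup>2"
        using N1[of m n] mn by (intro power_mono) auto
      also have "\<dots> \<le> \<delta> * 1" unfolding power2_eq_square using \<delta> by (intro mult_left_mono) (auto simp: \<delta>_def)
      finally have "\<mu> * (L2_norm \<Omega> (\<lambda>x. t m x - t n x))\<^sup>2 \<le> \<mu> * \<delta>" using \<mu>0 by (intro mult_left_mono) auto
      also have "\<dots> \<le> (\<mu> + 1) * (e\<^sup>2 / (4 * (\<mu> + 1)))"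
        using \<mu>0 \<delta> by (intro mult_mono) (auto simp: \<delta>_def)
      also have "\<dots> = e\<^sup>2 / 4" using \<mu>0 by (simp add: field_simps)
      finally have "\<mu> * (L2_norm \<Omega> (\<lambda>x. t m x - t n x))\<^sup>2 \<le> e\<^sup>2 / 4" .
      moreover have "2 / real (Suc m) < e\<^sup>2 / 4" "2 / real (Suc n) < e\<^sup>2 / 4"
        using small mn by auto
      moreover have "0 < e\<^sup>2" using e by simp
      ultimately have "(L2_norm \<Omega> (\<lambda>x. D m i x - D n i x))\<^sup>2 < e\<^sup>2"
        using Ediff[OF i, of m n] by linarith
      then show ?thesis using e by (auto intro: power2_less_imp_less)
    qed
    then show ?thesis by blast
  qed
  obtain f where f: "f \<in> L2 \<Omega>" "(\<lambda>n. L2_norm \<Omega> (\<lambda>x. t n x - f x)) \<longlonglongrightarrow> 0"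
    using L2_complete[OF lmeasurable_\<Omega> H10_L2[OF tH] cau_t] by blast
  have "\<exists>g. g \<in> L2 \<Omega> \<and> (\<lambda>n. L2_norm \<Omega> (\<lambda>x. D n i x - g x)) \<longlonglongrightarrow> 0" if i: "i \<in> Basis" for i
    using L2_complete[of \<Omega> "\<lambda>n. D n i", OF lmeasurable_\<Omega> DL[OF i] cau_D[OF i]] by blast
  then obtain G where G: "\<And>i. i \<in> Basis \<Longrightarrow> G i \<in> L2 \<Omega>"
      "\<And>i. i \<in> Basis \<Longrightarrow> (\<lambda>n. L2_norm \<Omega> (\<lambda>x. D n i x - G i x)) \<longlonglongrightarrow> 0"
    by metis
  have fG: "grad_approx \<Omega> f G" by (rule grad_approx_limit[OF tD f(1) G(1) f(2) G(2)])
  then have fV: "f \<in> V" using V_closed[OF tV grad_approx_H10[OF fG] f(2)] by blast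
  have "(\<lambda>n. L2_norm \<Omega> (t n)) \<longlonglongrightarrow> L2_norm \<Omega> f"
    by (rule L2_norm_tendsto[OF H10_L2[OF tH] f])
  then have f1: "L2_norm \<Omega> f = 1" using t1 by (simp add: LIMSEQ_const_iff)
  have "(\<lambda>n. \<Sum>i\<in>Basis. (L2_norm \<Omega> (D n i))\<^sup>2) \<longlonglongrightarrow> (\<Sum>i\<in>Basis. (L2_norm \<Omega> (G i))\<^sup>2)"
    by (intro tendsto_intros L2_norm_tendsto DL G)
  then have lim: "(\<lambda>n. E (t n)) \<longlonglongrightarrow> E f"
    unfolding E_def energy_self[OF tD] energy_self[OF fG] by (simp del: of_real_sum of_real_power)
  have "E f \<le> \<mu>"
  proof (rule LIMSEQ_le[OF lim])
    show "(\<lambda>n. \<mu> + 1 / real (Suc n)) \<longlonglongrightarrow> \<mu>" by real_asymp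
    show "\<exists>N. \<forall>n\<ge>N. E (t n) \<le> \<mu> + 1 / real (Suc n)" using tE less_imp_le by blast
  qed
  then have "E f * (L2_norm \<Omega> v)\<^sup>2 \<le> E v" if "v \<in> V" for v
    using \<mu>_le[OF that] mult_right_mono[of "E f" \<mu> "(L2_norm \<Omega> v)\<^sup>2"] by simp
  with fV f1 that show thesis unfolding E_def by blast
qed

section \<open>Consequences for the list of eigenvalues\<close>

context
  fixes ev :: "nat \<Rightarrow> real" and u :: "nat \<Rightarrow> 'a \<Rightarrow> complex"
  assumes ev: "dirichlet_eigenvalues \<Omega> ev" and u: "orthonormal_eigenfunctions \<Omega> ev u"
begin

lemma u_eigen: "1 \<le> j \<Longrightarrow> u j \<in> eigenspace \<Omega> (ev j)"
  using u by (simp add: orthonormal_eigenfunctions_def)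

lemma u_H10: "1 \<le> j \<Longrightarrow> u j \<in> H10 \<Omega>"
  using u_eigen by (simp add: eigenspace_iff)

lemma u_orthonormal: "1 \<le> i \<Longrightarrow> 1 \<le> j \<Longrightarrow> L2_inner \<Omega> (u i) (u j) = (if i = j then 1 else 0)"
  using u by (simp add: orthonormal_eigenfunctions_def)

lemma u_energy: "1 \<le> j \<Longrightarrow> v \<in> H10 \<Omega> \<Longrightarrow> energy (u j) v = complex_of_real (ev j) * L2_inner \<Omega> (u j) v"
  using u_eigen by (simp add: eigenspace_iff)

lemma u_norm: "1 \<le> j \<Longrightarrow> L2_norm \<Omega> (u j) = 1"
  using Re_inner_self[OF u_H10, of j] u_orthonormal[of j j] L2_norm_nonneg[of \<Omega> "u j"]
  by (simp add: power2_eq_1_iff)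

text \<open>Infinitely many such \<open>u j\<close> would be bounded in energy and hence have a
  Cauchy subsequence, but orthonormal functions have squared distance \<open>2\<close>.\<close>

lemma finite_eigenvalues_below: "finite {j. 1 \<le> j \<and> ev j < z}"
proof (rule ccontr)
  assume "infinite {j. 1 \<le> j \<and> ev j < z}"
  then obtain f :: "nat \<Rightarrow> nat" where f: "inj f" "range f \<subseteq> {j. 1 \<le> j \<and> ev j < z}"
    using infinite_countable_subset by blast
  then have f1: "1 \<le> f n" "ev (f n) < z" for n by auto
  note S = H10_grad_approx[OF u_H10[OF f1(1)]]
  have "L2_norm \<Omega> (weak_partial \<Omega> i (u (f n))) \<le> \<bar>z\<bar> + 1" if i: "i \<in> Basis" for n i
  proof (rule power2_le_imp_le)
    have "(L2_norm \<Omega> (weak_partial \<Omega> i (u (f n))))\<^sup>2 \<le> Re (energy (u (f n)) (u (f n)))"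
      by (rule weak_partial_norm_le_energy[OF S i])
    also have "\<dots> = ev (f n)"
      using f1 by (simp add: u_energy u_H10 u_orthonormal)
    also have "\<dots> \<le> \<bar>z\<bar>" using f1(2)[of n] by linarith
    also have "\<dots> \<le> (\<bar>z\<bar> + 1)\<^sup>2" by (simp add: power2_eq_square algebra_simps)
    finally show "(L2_norm \<Omega> (weak_partial \<Omega> i (u (f n))))\<^sup>2 \<le> (\<bar>z\<bar> + 1)\<^sup>2" .
  qed simp
  then obtain r :: "nat \<Rightarrow> nat" where r: "strict_mono r"
    and cau: "\<And>e. e > 0 \<Longrightarrow> \<exists>N. \<forall>m\<ge>N. \<forall>n\<ge>N. L2_norm \<Omega> (\<lambda>x. u (f (r m)) x - u (f (r n)) x) < e"
    using rellich[where s = "\<lambda>n. u (f n)", OF S, of "\<bar>z\<bar> + 1"] u_norm[OF f1(1)] by auto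
  obtain N where N: "\<And>m n. m \<ge> N \<Longrightarrow> n \<ge> N \<Longrightarrow> L2_norm \<Omega> (\<lambda>x. u (f (r m)) x - u (f (r n)) x) < 1"
    using cau[of 1] by auto
  define i j where "i = f (r N)" and "j = f (r (Suc N))"
  have "r N < r (Suc N)" using r by (simp add: strict_mono_def)
  then have ij: "i \<noteq> j" "1 \<le> i" "1 \<le> j"
    using f1(1) injD[OF f(1), of "r N" "r (Suc N)"] by (auto simp: i_def j_def)
  have "(L2_norm \<Omega> (\<lambda>x. u i x - u j x))\<^sup>2 = 2"
    using inner.diag_lin[OF u_H10[OF ij(2)] u_H10[OF ij(3)], of 1 "-1"] ij
      Re_inner_self[OF H10_lin[OF u_H10[OF ij(2)] u_H10[OF ij(3)], of 1 "-1"]]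
    by (simp add: u_orthonormal)
  moreover have "(L2_norm \<Omega> (\<lambda>x. u i x - u j x))\<^sup>2 \<le> 1\<^sup>2"
    using N[of N "Suc N"] by (intro power_mono) (auto simp: i_def j_def)
  ultimately show False by simp
qed

lemma projection:
  assumes J: "finite J" and J1: "J \<subseteq> {1..}" and v: "v \<in> H10 \<Omega>"
    and P_def: "P = (\<lambda>x. \<Sum>j\<in>J. L2_inner \<Omega> v (u j) * u j x)"
  shows "P \<in> H10 \<Omega>" "j \<in> J \<Longrightarrow> L2_inner \<Omega> P (u j) = L2_inner \<Omega> v (u j)"
    "j \<in> J \<Longrightarrow> L2_inner \<Omega> (\<lambda>x. 1 * v x + (-1) * P x) (u j) = 0"
proof -
  have uH: "u j \<in> H10 \<Omega>" if "j \<in> J" for j using u_H10 J1 that by auto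
  show PH: "P \<in> H10 \<Omega>" unfolding P_def by (rule inner.sum_mem[OF J uH])
  show P_inner: "L2_inner \<Omega> P (u j) = L2_inner \<Omega> v (u j)" if j: "j \<in> J" for j
  proof -
    have "L2_inner \<Omega> P (u j) = (\<Sum>k\<in>J. L2_inner \<Omega> v (u k) * L2_inner \<Omega> (u k) (u j))"
      unfolding P_def by (rule inner.sum_left[OF J uH uH[OF j]])
    also have "\<dots> = (\<Sum>k\<in>J. if k = j then L2_inner \<Omega> v (u k) else 0)"
      by (rule sum.cong[OF refl], subst u_orthonormal) (use J1 j in auto)
    also have "\<dots> = L2_inner \<Omega> v (u j)" using J j by simp
    finally show ?thesis .
  qed
  show "L2_inner \<Omega> (\<lambda>x. 1 * v x + (-1) * P x) (u j) = 0" if j: "j \<in> J"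
    unfolding inner.lin[OF v PH uH[OF j]] P_inner[OF j] by simp
qed

lemma shifted_u: "1 \<le> j \<Longrightarrow> v \<in> H10 \<Omega> \<Longrightarrow> shifted z (u j) v = complex_of_real (ev j - z) * L2_inner \<Omega> (u j) v"
  using u_energy[of j v] by (simp add: shifted_def algebra_simps)

lemma shifted_u_perp:
  assumes "1 \<le> j" "v \<in> H10 \<Omega>" "L2_inner \<Omega> v (u j) = 0"
  shows "shifted z v (u j) = 0"
  using shifted.herm[OF u_H10[OF assms(1)] assms(2)] shifted_u[OF assms(1,2)]
    inner.herm[OF assms(2) u_H10[OF assms(1)]] assms(3) by simp

text \<open>Let \<open>m\<close> minimize the Rayleigh quotient on the complement \<open>V\<close>,
  with value \<open>\<mu> < z\<close>. Minimality gives the eigenvalue equation only against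
  \<open>V\<close>; against the removed \<open>u j\<close> it holds because these are eigenfunctions
  orthogonal to \<open>m\<close>. Since \<open>\<mu> < z\<close>, every \<open>u j\<close> with
  eigenvalue \<mu> was removed, so \<open>m\<close> is orthogonal to a full basis of its own
  eigenspace.\<close>

lemma orthogonal_complement_bound:
  assumes w: "w \<in> H10 \<Omega>" and perp: "\<And>j. 1 \<le> j \<Longrightarrow> ev j < z \<Longrightarrow> L2_inner \<Omega> w (u j) = 0"
  shows "z * (L2_norm \<Omega> w)\<^sup>2 \<le> Re (energy w w)"
proof (rule ccontr)
  assume neg: "\<not> z * (L2_norm \<Omega> w)\<^sup>2 \<le> Re (energy w w)"
  define J where "J = {j. 1 \<le> j \<and> ev j < z}"
  have J: "finite J" "\<And>j. j \<in> J \<Longrightarrow> 1 \<le> j" using finite_eigenvalues_below by (auto simp: J_def)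
  have J1: "J \<subseteq> {1..}" by (auto simp: J_def)
  have uH: "u j \<in> H10 \<Omega>" if "j \<in> J" for j using u_H10 J(2)[OF that] by blast
  define V where "V = {f \<in> H10 \<Omega>. \<forall>j\<in>J. L2_inner \<Omega> f (u j) = 0}"
  have VH: "f \<in> H10 \<Omega>" if "f \<in> V" for f using that by (simp add: V_def)
  have V0: "L2_inner \<Omega> f (u j) = 0" if "f \<in> V" "j \<in> J" for f j using that by (simp add: V_def)
  have wV: "w \<in> V" using w perp by (simp add: V_def J_def)
  have V_lin: "(\<lambda>x. a * f x + b * g x) \<in> V" if "f \<in> V" "g \<in> V" for f g a b
  proof -
    have "L2_inner \<Omega> (\<lambda>x. a * f x + b * g x) (u j) = 0" if "j \<in> J" for j
      using inner.lin[OF VH[OF \<open>f \<in> V\<close>] VH[OF \<open>g \<in> V\<close>] uH[OF that]]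
        V0[OF \<open>f \<in> V\<close> that] V0[OF \<open>g \<in> V\<close> that] by simp
    then show ?thesis using H10_lin[OF VH[OF that(1)] VH[OF that(2)]] by (simp add: V_def)
  qed
  have V_closed: "f \<in> V" if s: "\<And>n. s n \<in> V" and f: "f \<in> H10 \<Omega>" and lim: "(\<lambda>n. L2_norm \<Omega> (\<lambda>x. s n x - f x)) \<longlonglongrightarrow> 0" for s f
  proof -
    have "L2_inner \<Omega> f (u j) = 0" if j: "j \<in> J" for j
    proof -
      have "cmod (L2_inner \<Omega> f (u j)) \<le> L2_norm \<Omega> (\<lambda>x. s n x - f x)" for n
      proof -
        have "L2_inner \<Omega> (\<lambda>x. 1 * s n x + (-1) * f x) (u j) = - L2_inner \<Omega> f (u j)"
          using inner.lin[OF VH[OF s] f uH[OF j], of 1 n "-1"] V0[OF s j] by simp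
        then show ?thesis
          using L2_inner_bound[OF L2_diff[OF H10_L2[OF VH[OF s]] H10_L2[OF f]] H10_L2[OF uH[OF j]], of n]
            u_norm[OF J(2)[OF j]] by simp
      qed
      then have "cmod (L2_inner \<Omega> f (u j)) \<le> 0" by (intro LIMSEQ_le_const[OF lim]) auto
      then show ?thesis by simp
    qed
    with f show ?thesis by (simp add: V_def)
  qed
  have nz: "L2_norm \<Omega> w \<noteq> 0"
    using neg energy.nonneg[OF w] by auto
  define a where "a = complex_of_real (1 / L2_norm \<Omega> w)"
  have w0: "(\<lambda>x. a * w x + 0 * w x) \<in> V" "L2_norm \<Omega> (\<lambda>x. a * w x + 0 * w x) = 1"
    using V_lin[OF wV wV, of a 0] nz L2_norm_cmult[of \<Omega> a w] by (auto simp: a_def norm_divide)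
  have VsubH: "V \<subseteq> H10 \<Omega>" using VH by blast
  obtain m where m: "m \<in> V" "L2_norm \<Omega> m = 1"
      "\<And>v. v \<in> V \<Longrightarrow> Re (energy m m) * (L2_norm \<Omega> v)\<^sup>2 \<le> Re (energy v v)"
    by (rule rayleigh_minimizer[where V = V, OF VsubH w0]) (use V_lin V_closed in blast)+
  define \<mu> where "\<mu> = Re (energy m m)"
  have "\<mu> * (L2_norm \<Omega> w)\<^sup>2 < z * (L2_norm \<Omega> w)\<^sup>2" using m(3)[OF wV] neg by (simp add: \<mu>_def)
  then have \<mu>z: "\<mu> < z" by (simp add: mult_less_cancel_right)
  have mH: "m \<in> H10 \<Omega>" by (rule VH[OF m(1)])
  \<comment> \<open>Minimality of \<open>m\<close> says precisely that this form is nonnegative on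
    \<open>V\<close>; \<open>m\<close> is a null vector of it.\<close>
  interpret q: psd_form V "shifted \<mu>"
  proof
    show "(\<lambda>x. 0) \<in> V" using V_lin[OF wV wV, of 0 0] by simp
    fix f g h :: "'a \<Rightarrow> complex" and a b assume fg: "f \<in> V" "g \<in> V"
    show "(\<lambda>x. a * f x + b * g x) \<in> V" by (rule V_lin[OF fg])
    show "shifted \<mu> g f = cnj (shifted \<mu> f g)" by (rule shifted.herm[OF fg[THEN VH]])
    assume "h \<in> V"
    then show "shifted \<mu> (\<lambda>x. a * f x + b * g x) h = a * shifted \<mu> f h + b * shifted \<mu> g h"
      by (intro shifted.lin VH fg)
  next
    fix f assume f: "f \<in> V"
    then show "0 \<le> Re (shifted \<mu> f f)"
      using m(3)[OF f] Re_inner_self[OF VH[OF f]] by (simp add: shifted_def \<mu>_def)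
  qed
  have "Re (shifted \<mu> m m) = 0" using Re_inner_self[OF mH] m(2) by (simp add: shifted_def \<mu>_def)
  then have qV: "shifted \<mu> m v = 0" if "v \<in> V" for v by (rule q.null_orthogonal[OF m(1) that])
  have qu: "shifted \<mu> m (u j) = 0" if j: "j \<in> J" for j
    by (rule shifted_u_perp[OF J(2)[OF j] mH V0[OF m(1) j]])
  \<comment> \<open>An arbitrary \<open>v\<close> splits into its projection onto the removed
    \<open>u j\<close> and a part in \<open>V\<close>.\<close>
  have "shifted \<mu> m v = 0" if v: "v \<in> H10 \<Omega>" for v
  proof -
    define P where "P = (\<lambda>x. \<Sum>j\<in>J. L2_inner \<Omega> v (u j) * u j x)"
    note P = projection[OF J(1) J1 v P_def]
    have "shifted \<mu> m P = 0"
      unfolding P_def using qu by (simp add: shifted.sum_right[OF J(1) uH mH])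
    moreover have "(\<lambda>x. 1 * v x + (-1) * P x) \<in> V"
      using P(3) H10_lin[OF v P(1), of 1 "-1"] unfolding V_def by blast
    note qV[OF this]
    ultimately show ?thesis using shifted.lin_right[OF v P(1) mH, of \<mu> 1 "-1"] by simp
  qed
  then have mE: "m \<in> eigenspace \<Omega> \<mu>" using mH by (simp add: eigenspace_iff shifted_def)
  define T where "T = {j. 1 \<le> j \<and> ev j = \<mu>}"
  have T: "finite T" "0 \<notin> T" "has_multiplicity \<Omega> \<mu> (card T)"
    using ev by (auto simp: T_def dirichlet_eigenvalues_def)
  have TJ: "T \<subseteq> J" using \<mu>z by (auto simp: T_def J_def)
  have "L2_norm \<Omega> m = 0"
  proof (rule eigenspace_orthonormal_span[OF T(3,1,2) _ _ mE])
    show "u j \<in> eigenspace \<Omega> \<mu>" if "j \<in> T" for j using u_eigen[of j] that by (auto simp: T_def)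
    show "L2_inner \<Omega> (u i) (u j) = (if i = j then 1 else 0)" if "i \<in> T" "j \<in> T" for i j
      using that by (intro u_orthonormal) (auto simp: T_def)
    show "L2_inner \<Omega> m (u j) = 0" if "j \<in> T" for j using that TJ V0[OF m(1)] by blast
  qed
  with m(2) show False by simp
qed

text \<open>For the form shifted by \<open>z\<close>, the projection of \<open>v\<close> onto the
  \<open>u j\<close> with \<open>ev j < z\<close> and the remainder are orthogonal. The remainder
  contributes a nonnegative amount, the projection exactly minus the sum on the right.\<close>

lemma riesz_mean_lower_bound:
  assumes v: "v \<in> H10 \<Omega>"
  shows "z * (L2_norm \<Omega> v)\<^sup>2 - Re (energy v v)
    \<le> (\<Sum>j\<in>{j. 1 \<le> j \<and> ev j < z}. (z - ev j) * (cmod (L2_inner \<Omega> v (u j)))\<^sup>2)"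
proof -
  define J where "J = {j. 1 \<le> j \<and> ev j < z}"
  have J: "finite J" "\<And>j. j \<in> J \<Longrightarrow> 1 \<le> j" using finite_eigenvalues_below by (auto simp: J_def)
  have J1: "J \<subseteq> {1..}" by (auto simp: J_def)
  have uH: "u j \<in> H10 \<Omega>" if "j \<in> J" for j using u_H10 J(2)[OF that] by blast
  define c where "c j = L2_inner \<Omega> v (u j)" for j
  define P where "P = (\<lambda>x. \<Sum>j\<in>J. L2_inner \<Omega> v (u j) * u j x)"
  note P = projection[OF J(1) J1 v P_def]
  define w where "w = (\<lambda>x. 1 * v x + (-1) * P x)"
  have wH: "w \<in> H10 \<Omega>" unfolding w_def by (rule H10_lin[OF v P(1)])
  have w_perp: "L2_inner \<Omega> w (u j) = 0" if "j \<in> J" for j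
    unfolding w_def by (rule P(3)[OF that])
  have "z * (L2_norm \<Omega> w)\<^sup>2 \<le> Re (energy w w)"
    using orthogonal_complement_bound[OF wH, of z] w_perp by (simp add: J_def)
  then have Qww: "0 \<le> Re (shifted z w w)" using Re_inner_self[OF wH] by (simp add: shifted_def)
  have "shifted z w P = (\<Sum>j\<in>J. cnj (L2_inner \<Omega> v (u j)) * shifted z w (u j))"
    unfolding P_def by (rule shifted.sum_right[OF J(1) uH wH])
  also have "\<dots> = 0"
    by (intro sum.neutral ballI) (simp add: shifted_u_perp[OF J(2) wH w_perp])
  finally have "shifted z w P = 0" .
  then have QPw: "shifted z P w = 0" using shifted.herm[OF wH P(1), of z] by simp
  have QPP: "Re (shifted z P P) = - (\<Sum>j\<in>J. (z - ev j) * (cmod (c j))\<^sup>2)"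
  proof -
    have "shifted z P P = (\<Sum>j\<in>J. c j * shifted z (u j) P)"
      using shifted.sum_left[OF J(1) uH P(1), where z = z and c = c] by (simp add: P_def c_def)
    also have "\<dots> = (\<Sum>j\<in>J. complex_of_real (- ((z - ev j) * (cmod (c j))\<^sup>2)))"
    proof (rule sum.cong[OF refl])
      fix j assume j: "j \<in> J"
      have "L2_inner \<Omega> (u j) P = cnj (c j)" using inner.herm[OF P(1) uH[OF j]] P(2)[OF j] by (simp add: c_def)
      then have "c j * shifted z (u j) P = complex_of_real (ev j - z) * (c j * cnj (c j))"
        by (simp add: shifted_u[OF J(2)[OF j] P(1)] del: of_real_diff)
      also have "\<dots> = complex_of_real ((ev j - z) * (cmod (c j))\<^sup>2)"
        by (simp only: of_real_mult complex_norm_square)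
      finally show "c j * shifted z (u j) P = complex_of_real (- ((z - ev j) * (cmod (c j))\<^sup>2))"
        by (simp add: algebra_simps)
    qed
    finally show ?thesis by (simp only: of_real_sum[symmetric] Re_complex_of_real sum_negf)
  qed
  have vw: "v = (\<lambda>x. 1 * P x + 1 * w x)" by (simp add: w_def)
  have "Re (shifted z v v) = Re (shifted z P P) + Re (shifted z w w)"
    using shifted.diag_lin[OF P(1) wH, of z 1 1, folded vw] QPw by simp
  moreover have "Re (shifted z v v) = Re (energy v v) - z * (L2_norm \<Omega> v)\<^sup>2"
    using Re_inner_self[OF v] by (simp add: shifted_def)
  ultimately show ?thesis
    using QPP Qww by (simp add: J_def c_def)
qed

end

end

section \<open>Bessel inequality for the Fourier transform\<close>

lemma integral_lborel_prod:
  fixes f :: "'a::euclidean_space \<Rightarrow> real \<Rightarrow> complex"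
  assumes int: "\<And>b. b \<in> Basis \<Longrightarrow> integrable lborel (f b)"
  shows "(\<integral>x. (\<Prod>b\<in>Basis. f b (x \<bullet> b)) \<partial>lborel) = (\<Prod>b\<in>Basis. \<integral>t. f b t \<partial>lborel)"
proof -
  interpret P: product_sigma_finite "\<lambda>_::'a. lborel :: real measure" ..
  have m: "f b \<in> borel_measurable borel" if "b \<in> Basis" for b using int[OF that] by auto
  have "(\<integral>x. (\<Prod>b\<in>Basis. f b (x \<bullet> b)) \<partial>lborel)
      = (\<integral>x. (\<Prod>b\<in>Basis. f b (x \<bullet> b)) \<partial>distr (\<Pi>\<^sub>M b\<in>Basis. lborel) borel (\<lambda>g. \<Sum>b\<in>Basis. g b *\<^sub>R b))"
    by (subst lborel_eq) (rule refl)
  also have "\<dots> = (\<integral>g. (\<Prod>b\<in>Basis. f b ((\<Sum>c\<in>Basis. g c *\<^sub>R c) \<bullet> b)) \<partial>(\<Pi>\<^sub>M b\<in>Basis. lborel))"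
  proof (rule integral_distr)
    show "(\<lambda>x. \<Prod>b\<in>Basis. f b (x \<bullet> b)) \<in> borel_measurable (borel :: 'a measure)"
      by (rule borel_measurable_prod) (rule measurable_compose[OF _ m], auto)
  qed measurable
  also have "\<dots> = (\<integral>g. (\<Prod>b\<in>Basis. f b (g b)) \<partial>(\<Pi>\<^sub>M b\<in>Basis. lborel))"
    by simp
  also have "\<dots> = (\<Prod>b\<in>Basis. \<integral>t. f b t \<partial>lborel)"
    by (rule P.product_integral_prod) (auto intro: int)
  finally show ?thesis .
qed

lemma integral_cis_period:
  fixes L :: real and n :: int
  assumes L: "L > 0" and n: "n \<noteq> 0"
  shows "(\<integral>t. indicat_real {-(L/2)..L/2} t *\<^sub>R cis (2 * pi * n / L * t) \<partial>lborel) = 0"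
proof -
  define k where "k = 2 * pi * n / L"
  have k: "k \<noteq> 0" using assms by (simp add: k_def)
  have "(\<integral>t. indicat_real {-(L/2)..L/2} t *\<^sub>R cis (k * t) \<partial>lborel)
      = cis (k * (L/2)) / (\<i> * k) - cis (k * -(L/2)) / (\<i> * k)"
  proof (rule integral_FTC_Icc)
    show "((\<lambda>t. cis (k * t) / (\<i> * k)) has_vector_derivative cis (k * t)) (at t within {-(L/2)..L/2})" for t
      unfolding has_vector_derivative_def using k
      by (auto intro!: derivative_eq_intros simp: scaleR_conv_of_real field_simps)
  qed (use L in \<open>auto intro!: continuous_intros\<close>)
  also have "k * (L/2) = pi * n" using L by (simp add: k_def)
  also have "k * -(L/2) = - (pi * n)" using L by (simp add: k_def)
  also have "cis (pi * n) = cis (- (pi * n))"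
    by (simp add: complex_eq_iff)
  finally show ?thesis by (simp add: k_def)
qed

text \<open>The lower corner of \<open>cube h n\<close>. With \<open>h = 2 * pi / L\<close> these
  points form the lattice dual to a cube of side \<open>L\<close>.\<close>

definition lattice_point :: "real \<Rightarrow> ('a::euclidean_space \<Rightarrow> int) \<Rightarrow> 'a" where
  "lattice_point h n = (\<Sum>i\<in>Basis. (real_of_int (n i) * h) *\<^sub>R i)"

lemma lattice_point_inner [simp]: "i \<in> Basis \<Longrightarrow> lattice_point h n \<bullet> i = real_of_int (n i) * h"
  by (simp add: lattice_point_def)

lemma cis_sum: "finite A \<Longrightarrow> cis (\<Sum>i\<in>A. f i) = (\<Prod>i\<in>A. cis (f i))"
  by (induction A rule: finite_induct) (auto simp: cis_mult[symmetric])

lemma cis_inner_prod: "cis (k \<bullet> x) = (\<Prod>i\<in>Basis. cis ((k \<bullet> i) * (x \<bullet> i)))"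
  by (subst euclidean_inner) (simp add: cis_sum)

text \<open>The integral factors over the coordinates. Distinct members of the grid must differ in a
  coordinate direction, where the exponential runs through full periods.\<close>

lemma exponentials_orthogonal:
  fixes n m :: "'a::euclidean_space \<Rightarrow> int" and L :: real
  assumes L: "L > 0" and nm: "n \<in> grid N" "m \<in> grid N"
  defines "C \<equiv> cbox (- ((L/2) *\<^sub>R One)) ((L/2) *\<^sub>R One) :: 'a set"
  shows "(\<integral>x. indicat_real C x *\<^sub>R cis ((lattice_point (2*pi/L) n - lattice_point (2*pi/L) m) \<bullet> x) \<partial>lborel)
    = (if n = m then complex_of_real (L ^ DIM('a)) else 0)"
proof -
  define f where "f i t = indicat_real {-(L/2)..L/2} t *\<^sub>R cis (2 * pi * (n i - m i) / L * t)" for i t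
  have "indicat_real C x = (\<Prod>i\<in>Basis. indicat_real {-(L/2)..L/2} (x \<bullet> i))" for x
    by (auto simp: C_def indicator_def mem_box intro!: prod.neutral[symmetric])
  moreover have "(lattice_point (2*pi/L) n - lattice_point (2*pi/L) m) \<bullet> i * t = 2 * pi * (n i - m i) / L * t"
    if "i \<in> Basis" for i and t :: real
    using that by (simp add: inner_diff_left algebra_simps diff_divide_distrib)
  ultimately have "indicat_real C x *\<^sub>R cis ((lattice_point (2*pi/L) n - lattice_point (2*pi/L) m) \<bullet> x)
      = (\<Prod>i\<in>Basis. f i (x \<bullet> i))" for x
    by (simp add: cis_inner_prod f_def scaleR_conv_of_real prod.distrib del: inner_diff_left cong: prod.cong)
  then have "(\<integral>x. indicat_real C x *\<^sub>R cis ((lattice_point (2*pi/L) n - lattice_point (2*pi/L) m) \<bullet> x) \<partial>lborel)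
      = (\<integral>x. (\<Prod>i\<in>Basis. f i (x \<bullet> i)) \<partial>lborel)" by simp
  also have "\<dots> = (\<Prod>i\<in>Basis. \<integral>t. f i t \<partial>lborel)"
  proof (rule integral_lborel_prod)
    fix i :: 'a
    show "integrable lborel (f i)"
      unfolding f_def set_integrable_def[symmetric]
      by (rule borel_integrable_atLeastAtMost') (intro continuous_intros)
  qed
  also have "\<dots> = (if n = m then complex_of_real (L ^ DIM('a)) else 0)"
  proof (cases "n = m")
    case True
    then have "(\<integral>t. f i t \<partial>lborel) = complex_of_real L" for i
      using L by (simp add: f_def scaleR_conv_of_real)
    with True show ?thesis by simp
  next
    case False
    then obtain i where i: "n i \<noteq> m i" by blast
    with nm have "i \<in> Basis" unfolding grid_def by (metis PiE_arb)
    moreover have "(\<integral>t. f i t \<partial>lborel) = 0"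
      unfolding f_def using integral_cis_period[OF L, of "n i - m i"] i by simp
    ultimately have "(\<Prod>i\<in>Basis. \<integral>t. f i t \<partial>lborel) = 0" by (intro prod_zero) auto
    with False show ?thesis by simp
  qed
  finally show ?thesis .
qed

lemma inner_hermitian_L2: "hermitian_form (L2 \<Omega>) (L2_inner \<Omega>)"
  by unfold_locales (auto intro: L2_add L2_cmult L2_inner_lin L2_inner_commute)

text \<open>Unnormalized and with positive sign, so that the inner product of a modulated \<phi>
  with \<open>u j\<close> is the transform of \<phi> times the conjugate of
  \<open>u j\<close>.\<close>

definition fourier :: "'a::euclidean_space set \<Rightarrow> ('a \<Rightarrow> complex) \<Rightarrow> 'a \<Rightarrow> complex" where
  "fourier \<Omega> f p = (\<integral>x. f x * cis (p \<bullet> x) \<partial>lebesgue_on \<Omega>)"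

lemma L2_cnj:
  assumes "f \<in> L2 \<Omega>" shows "(\<lambda>x. cnj (f x)) \<in> L2 \<Omega>"
proof (rule L2_dominated[OF _ assms, of _ 1])
  show "(\<lambda>x. cnj (f x)) \<in> borel_measurable (lebesgue_on \<Omega>)"
    by (rule borel_measurable_continuous_on[OF _ L2_measurable[OF assms]]) (intro continuous_intros)
qed simp

context bounded_open_set
begin

lemma cis_L2: "(\<lambda>x. cis (p \<bullet> x)) \<in> L2 \<Omega>"
  by (rule L2_bounded[OF lmeasurable_\<Omega>, of _ 1])
     (auto intro!: borel_measurable_lebesgue_on_borel borel_measurable_continuous_onI continuous_intros)

lemma fourier_inner: "fourier \<Omega> f p = L2_inner \<Omega> f (\<lambda>x. cnj (cis (p \<bullet> x)))"
  by (simp add: fourier_def L2_inner_def)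

text \<open>The exponentials are orthogonal on the cube of side \<open>L\<close>, not on \<Omega>;
  but the norm of a combination \<open>s\<close> over \<Omega> is at most its norm over the cube.
  This inequality suffices to read Bessel's inequality off the squared norm of
  \<open>f - s / D\<close>.\<close>

lemma fourier_bessel_lattice:
  assumes f: "f \<in> L2 \<Omega>" and L: "L > 0" and sub: "\<Omega> \<subseteq> cbox (- ((L/2) *\<^sub>R One)) ((L/2) *\<^sub>R One)"
  shows "(\<Sum>n\<in>grid N. (cmod (fourier \<Omega> f (p + lattice_point (2*pi/L) n)))\<^sup>2) \<le> L ^ DIM('a) * (L2_norm \<Omega> f)\<^sup>2"
proof -
  interpret I: hermitian_form "L2 \<Omega>" "L2_inner \<Omega>" by (rule inner_hermitian_L2)
  let ?C = "cbox (- ((L/2) *\<^sub>R One)) ((L/2) *\<^sub>R One) :: 'a set"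
  define D where "D = L ^ DIM('a)"
  have D: "D > 0" using L by (simp add: D_def)
  define e where "e n x = cnj (cis ((p + lattice_point (2*pi/L) n) \<bullet> x))" for n x
  define c where "c n = L2_inner \<Omega> f (e n)" for n
  have eL: "e n \<in> L2 \<Omega>" for n unfolding e_def by (rule L2_cnj[OF cis_L2])
  define s where "s x = (\<Sum>n\<in>grid N. c n * e n x)" for x
  have sL: "s \<in> L2 \<Omega>" unfolding s_def by (rule I.sum_mem[OF finite_grid eL])
  define X where "X = (\<Sum>n\<in>grid N. (cmod (c n))\<^sup>2)"
  have fs: "L2_inner \<Omega> f s = complex_of_real X"
  proof -
    have "L2_inner \<Omega> f s = (\<Sum>n\<in>grid N. cnj (c n) * c n)"
      unfolding s_def c_def by (rule I.sum_right[OF finite_grid eL f])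
    also have "\<dots> = (\<Sum>n\<in>grid N. complex_of_real ((cmod (c n))\<^sup>2))"
      by (simp only: complex_norm_square mult.commute)
    finally show ?thesis by (simp only: X_def of_real_sum)
  qed
  have s_cont: "continuous_on UNIV s" unfolding s_def e_def by (intro continuous_intros)
  have s_int: "integrable lborel (\<lambda>x. indicat_real ?C x *\<^sub>R (norm (s x))\<^sup>2)"
    using s_cont by (intro borel_integrable_compact compact_cbox continuous_intros) (rule continuous_on_subset, auto)
  have ss: "(L2_norm \<Omega> s)\<^sup>2 \<le> D * X"
  proof -
    have "(L2_norm \<Omega> s)\<^sup>2 = (\<integral>x. indicat_real \<Omega> x *\<^sub>R (norm (s x))\<^sup>2 \<partial>lebesgue)"
      unfolding L2_norm_power2 by (rule lebesgue_on_integral[OF sets_\<Omega>])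
    also have "\<dots> \<le> (\<integral>x. indicat_real ?C x *\<^sub>R (norm (s x))\<^sup>2 \<partial>lebesgue)"
    proof (rule integral_mono)
      show "integrable lebesgue (\<lambda>x. indicat_real \<Omega> x *\<^sub>R (norm (s x))\<^sup>2)"
        using L2_integrable[OF sL] by (simp only: lebesgue_on_integrable[OF sets_\<Omega>])
      show "integrable lebesgue (\<lambda>x. indicat_real ?C x *\<^sub>R (norm (s x))\<^sup>2)"
        using s_int by (subst integrable_completion) auto
      show "indicat_real \<Omega> x *\<^sub>R (norm (s x))\<^sup>2 \<le> indicat_real ?C x *\<^sub>R (norm (s x))\<^sup>2" for x
        using sub by (auto simp: indicator_def)
    qed
    also have "\<dots> = (\<integral>x. indicat_real ?C x *\<^sub>R (norm (s x))\<^sup>2 \<partial>lborel)"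
      using s_int by (intro integral_completion) auto
    finally have le: "(L2_norm \<Omega> s)\<^sup>2 \<le> (\<integral>x. indicat_real ?C x *\<^sub>R (norm (s x))\<^sup>2 \<partial>lborel)" .
    let ?k = "\<lambda>n. lattice_point (2*pi/L) n :: 'a"
    have int_cis: "integrable lborel (\<lambda>x. indicat_real ?C x *\<^sub>R cis (k \<bullet> x))" for k
      by (intro borel_integrable_compact compact_cbox continuous_intros)
    have "complex_of_real (\<integral>x. indicat_real ?C x *\<^sub>R (norm (s x))\<^sup>2 \<partial>lborel)
        = (\<integral>x. complex_of_real (indicat_real ?C x *\<^sub>R (norm (s x))\<^sup>2) \<partial>lborel)"
      by (rule integral_complex_of_real[symmetric])
    also have "\<dots> = (\<integral>x. (\<Sum>n\<in>grid N. \<Sum>m\<in>grid N. c n * cnj (c m) *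
        (indicat_real ?C x *\<^sub>R cis ((?k m - ?k n) \<bullet> x))) \<partial>lborel)"
    proof (rule Bochner_Integration.integral_cong[OF refl])
      fix x
      \<comment> \<open>The offset \<open>p\<close> cancels here, so the lattice may be shifted
        freely.\<close>
      have e: "e n x * cnj (e m x) = cis ((?k m - ?k n) \<bullet> x)" for n m
        by (simp add: e_def cis_cnj cis_mult inner_add_left inner_diff_left)
      have "complex_of_real ((norm (s x))\<^sup>2) = s x * cnj (s x)" by (rule complex_norm_square)
      also have "\<dots> = (\<Sum>n\<in>grid N. \<Sum>m\<in>grid N. (c n * e n x) * (cnj (c m) * cnj (e m x)))"
        by (simp add: s_def sum_product)
      also have "\<dots> = (\<Sum>n\<in>grid N. \<Sum>m\<in>grid N. c n * cnj (c m) * cis ((?k m - ?k n) \<bullet> x))"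
        by (intro sum.cong refl, subst e[symmetric]) (simp add: mult_ac)
      finally show "complex_of_real (indicat_real ?C x *\<^sub>R (norm (s x))\<^sup>2)
         = (\<Sum>n\<in>grid N. \<Sum>m\<in>grid N. c n * cnj (c m) * (indicat_real ?C x *\<^sub>R cis ((?k m - ?k n) \<bullet> x)))"
        by (simp add: scaleR_conv_of_real sum_distrib_left mult_ac del: of_real_power)
    qed
    also have "\<dots> = (\<Sum>n\<in>grid N. \<Sum>m\<in>grid N. c n * cnj (c m) *
        (\<integral>x. indicat_real ?C x *\<^sub>R cis ((?k m - ?k n) \<bullet> x) \<partial>lborel))"
      by (subst Bochner_Integration.integral_sum, intro Bochner_Integration.integrable_sum integrable_mult_right int_cis,
          rule sum.cong[OF refl], subst Bochner_Integration.integral_sum, intro integrable_mult_right int_cis,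
          rule sum.cong[OF refl], rule integral_mult_right_zero)
    also have "\<dots> = (\<Sum>n\<in>grid N. \<Sum>m\<in>grid N. if m = n then c n * cnj (c n) * complex_of_real D else 0)"
      by (intro sum.cong refl, subst exponentials_orthogonal[OF L]) (auto simp: D_def)
    also have "\<dots> = (\<Sum>n\<in>grid N. complex_of_real ((cmod (c n))\<^sup>2) * complex_of_real D)"
      by (simp add: finite_grid complex_norm_square del: of_real_power)
    also have "\<dots> = complex_of_real (D * X)"
      by (simp add: X_def sum_distrib_left mult.commute)
    finally show ?thesis using le by (simp only: of_real_eq_iff)
  qed
  \<comment> \<open>The multiple minimizing
    \<open>(L2_norm \<Omega> f)\<^sup>2 + t\<^sup>2 * D * X - 2 * t * X\<close>.\<close>
  define t where "t = complex_of_real (1 / D)"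
  have fsL: "(\<lambda>x. 1 * f x + (- t) * s x) \<in> L2 \<Omega>" by (rule I.lin_mem[OF f sL])
  have "0 \<le> (L2_norm \<Omega> (\<lambda>x. 1 * f x + (- t) * s x))\<^sup>2" by simp
  also have "\<dots> = Re (L2_inner \<Omega> (\<lambda>x. 1 * f x + (- t) * s x) (\<lambda>x. 1 * f x + (- t) * s x))"
    unfolding L2_inner_self[OF fsL] by simp
  also have "\<dots> = (L2_norm \<Omega> f)\<^sup>2 + (1 / D)\<^sup>2 * (L2_norm \<Omega> s)\<^sup>2 - 2 * (1 / D) * X"
    unfolding I.diag_lin[OF f sL] fs L2_inner_self[OF f] L2_inner_self[OF sL]
    by (simp add: t_def norm_divide power_divide)
  also have "\<dots> \<le> (L2_norm \<Omega> f)\<^sup>2 + (1 / D)\<^sup>2 * (D * X) - 2 * (1 / D) * X"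
    using ss by (intro diff_mono add_mono mult_left_mono order_refl) auto
  also have "\<dots> = (L2_norm \<Omega> f)\<^sup>2 - X / D" using D by (simp add: power2_eq_square)
  finally have "X \<le> D * (L2_norm \<Omega> f)\<^sup>2" using D by (simp add: field_simps)
  then show ?thesis by (simp add: X_def c_def D_def fourier_inner e_def[abs_def])
qed

lemma fourier_measurable:
  assumes f: "f \<in> L2 \<Omega>"
  shows "fourier \<Omega> f \<in> borel_measurable borel"
proof -
  interpret M: finite_measure "lebesgue_on \<Omega>" by (rule finite_measure_lebesgue_on[OF lmeasurable_\<Omega>])
  have [measurable]: "f \<in> borel_measurable (lebesgue_on \<Omega>)" by (rule L2_measurable[OF f])
  have [measurable]: "(\<lambda>x. x) \<in> borel_measurable (lebesgue_on \<Omega>)"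
    by (rule borel_measurable_lebesgue_on_borel) simp
  have [measurable]: "cis \<in> borel_measurable borel"
    by (intro borel_measurable_continuous_onI continuous_intros)
  have "(\<lambda>p. \<integral>x. f x * cis (p \<bullet> x) \<partial>lebesgue_on \<Omega>) \<in> borel_measurable borel"
    by (rule M.borel_measurable_lebesgue_integral) measurable
  then show ?thesis by (simp add: fourier_def[abs_def])
qed

text \<open>The lattice form of Bessel's inequality is averaged over a fundamental cell of the dual
  lattice.\<close>

lemma fourier_bessel:
  assumes f: "f \<in> L2 \<Omega>"
  shows "(\<integral>\<^sup>+p\<in>cball 0 R. ennreal ((cmod (fourier \<Omega> f p))\<^sup>2) \<partial>lborel) \<le> ennreal ((2 * pi) ^ DIM('a) * (L2_norm \<Omega> f)\<^sup>2)"
proof -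
  obtain B where B: "B > 0" "\<And>x. x \<in> \<Omega> \<Longrightarrow> norm x \<le> B" using bounded_\<Omega> by (auto simp: bounded_pos)
  define L where "L = 2 * B"
  have L: "L > 0" using B by (simp add: L_def)
  have sub: "\<Omega> \<subseteq> cbox (- ((L/2) *\<^sub>R One)) ((L/2) *\<^sub>R One)"
  proof
    fix x assume "x \<in> \<Omega>"
    then have "\<bar>x \<bullet> i\<bar> \<le> L / 2" if "i \<in> Basis" for i
      using B(2)[of x] Basis_le_norm[OF that, of x] by (simp add: L_def)
    then show "x \<in> cbox (- ((L/2) *\<^sub>R One)) ((L/2) *\<^sub>R One)"
      by (force simp: mem_box abs_le_iff)
  qed
  define h where "h = 2 * pi / L"
  have h: "h > 0" using L by (simp add: h_def)
  obtain N :: nat where N: "R / h < real N" using reals_Archimedean2 by blast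
  let ?g = "\<lambda>p. ennreal ((cmod (fourier \<Omega> f p))\<^sup>2)"
  have gm[measurable]: "?g \<in> borel_measurable borel"
    using fourier_measurable[OF f] by measurable
  have "(\<integral>\<^sup>+p\<in>cball 0 R. ?g p \<partial>lborel) \<le> (\<integral>\<^sup>+p. (\<Sum>n\<in>grid N. ?g p * indicator (cube h n) p) \<partial>lborel)"
  proof (rule nn_integral_mono)
    fix p :: 'a
    show "?g p * indicator (cball 0 R) p \<le> (\<Sum>n\<in>grid N. ?g p * indicator (cube h n) p)"
    proof (cases "p \<in> cball 0 R")
      case True
      have "\<bar>p \<bullet> i\<bar> < real N * h" if "i \<in> Basis" for i
      proof -
        have "\<bar>p \<bullet> i\<bar> \<le> R" using Basis_le_norm[OF that, of p] True by simp
        also have "R < real N * h" using N h by (simp add: pos_divide_less_eq)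
        finally show ?thesis .
      qed
      then obtain n where n: "n \<in> grid N" "p \<in> cube h n" using grid_cover[OF h, of p N] by blast
      have "?g p * indicator (cball 0 R) p = ?g p * indicator (cube h n) p" using True n by simp
      also have "\<dots> \<le> (\<Sum>n\<in>grid N. ?g p * indicator (cube h n) p)"
        using n(1) finite_grid[of N] by (intro member_le_sum) auto
      finally show ?thesis .
    qed simp
  qed
  also have "\<dots> = (\<Sum>n\<in>grid N. \<integral>\<^sup>+p. ?g p * indicator (cube h n) p \<partial>lborel)"
    by (rule nn_integral_sum) measurable
  \<comment> \<open>Every cube is moved back to the base cell, so that the lattice inequality can be
    used for each offset \<open>p\<close> before integrating.\<close>
  also have "\<dots> = (\<Sum>n\<in>grid N. \<integral>\<^sup>+p. ?g (p + lattice_point h n) * indicator (cube h (\<lambda>_. 0)) p \<partial>lborel)"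
  proof (rule sum.cong[OF refl])
    fix n :: "'a \<Rightarrow> int"
    have "indicator (cube h n) (p + lattice_point h n) = (indicator (cube h (\<lambda>_. 0)) p :: ennreal)" for p
    proof -
      have "p + lattice_point h n \<in> cube h n \<longleftrightarrow> p \<in> cube h (\<lambda>_. 0)"
        by (auto simp: cube_def inner_add_left distrib_right)
      then show ?thesis by (simp add: indicator_def)
    qed
    then show "(\<integral>\<^sup>+p. ?g p * indicator (cube h n) p \<partial>lborel) = (\<integral>\<^sup>+p. ?g (p + lattice_point h n) * indicator (cube h (\<lambda>_. 0)) p \<partial>lborel)"
      using nn_integral_lborel_translation[of "\<lambda>p. ?g p * indicator (cube h n) p" "lattice_point h n"] by simp
  qed
  also have "\<dots> = (\<integral>\<^sup>+p. (\<Sum>n\<in>grid N. ?g (p + lattice_point h n)) * indicator (cube h (\<lambda>_. 0)) p \<partial>lborel)"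
    unfolding sum_distrib_right by (rule nn_integral_sum[symmetric]) measurable
  also have "\<dots> \<le> (\<integral>\<^sup>+(p::'a). ennreal (L ^ DIM('a) * (L2_norm \<Omega> f)\<^sup>2) * indicator (cube h (\<lambda>_. 0)) p \<partial>lborel)"
  proof (intro nn_integral_mono mult_right_mono)
    show "(\<Sum>n\<in>grid N. ?g (p + lattice_point h n)) \<le> ennreal (L ^ DIM('a) * (L2_norm \<Omega> f)\<^sup>2)" for p
      using fourier_bessel_lattice[OF f L sub, of p N]
      by (simp add: sum_ennreal h_def ennreal_leI)
  qed simp
  also have "\<dots> = ennreal (L ^ DIM('a) * (L2_norm \<Omega> f)\<^sup>2) * ennreal (h ^ DIM('a))"
    by (subst nn_integral_cmult_indicator) (simp_all add: emeasure_cube[OF h])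
  also have "\<dots> = ennreal ((L * h) ^ DIM('a) * (L2_norm \<Omega> f)\<^sup>2)"
    using L h by (simp add: ennreal_mult[symmetric] power_mult_distrib mult_ac)
  \<comment> \<open>The auxiliary side \<open>L\<close> drops out here, and
    \<open>(2 * pi) ^ DIM('a)\<close> remains.\<close>
  also have "L * h = 2 * pi" using L by (simp add: h_def)
  finally show ?thesis .
qed

end

text \<open>Layer cake: the weight is the integral of \<open>2 * r\<close> from
  \<open>norm p\<close> to \<open>R\<close>. Exchanging the integrals leaves \<open>2 * r\<close>
  times the volume of the ball of radius \<open>r\<close>, integrated over
  \<open>{0..R}\<close>.\<close>

lemma ball_weight_integral:
  assumes R: "R \<ge> 0"
  shows "(\<integral>\<^sup>+p\<in>cball (0::'a::euclidean_space) R. ennreal (R\<^sup>2 - (norm p)\<^sup>2) \<partial>lborel)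
    = ennreal (2 / (real DIM('a) + 2) * unit_ball_vol (real DIM('a)) * R ^ (DIM('a) + 2))"
proof -
  define w where "w = unit_ball_vol (real DIM('a))"
  have w: "w \<ge> 0" by (simp add: w_def)
  have "(\<integral>\<^sup>+p\<in>cball (0::'a) R. ennreal (R\<^sup>2 - (norm p)\<^sup>2) \<partial>lborel)
      = (\<integral>\<^sup>+p. (\<integral>\<^sup>+r. ennreal (2 * r) * (indicator {0..R} r * indicator {q. norm (fst q) \<le> snd q} (p :: 'a, r)) \<partial>lborel) \<partial>lborel)"
  proof (rule nn_integral_cong)
    fix p :: 'a
    show "ennreal (R\<^sup>2 - (norm p)\<^sup>2) * indicator (cball 0 R) p
        = (\<integral>\<^sup>+r. ennreal (2 * r) * (indicator {0..R} r * indicator {q. norm (fst q) \<le> snd q} (p, r)) \<partial>lborel)"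
    proof (cases "norm p \<le> R")
      case True
      have "(\<integral>\<^sup>+r. ennreal (2 * r) * (indicator {0..R} r * indicator {q. norm (fst q) \<le> snd q} (p, r)) \<partial>lborel)
          = (\<integral>\<^sup>+r. ennreal (2 * r) * indicator {norm p..R} r \<partial>lborel)"
        by (rule nn_integral_cong) (auto simp: indicator_def intro: order_trans[OF norm_ge_zero])
      also have "\<dots> = ennreal (R\<^sup>2 - (norm p)\<^sup>2)"
        by (rule nn_integral_FTC_Icc)
           (use True in \<open>auto intro!: derivative_eq_intros simp: has_vector_derivative_def intro: order_trans[OF norm_ge_zero]\<close>)
      finally show ?thesis using True by simp
    next
      case False
      then have "indicator {0..R} r * indicator {q. norm (fst q) \<le> snd q} (p, r) = (0::ennreal)" for r
        by (auto simp: indicator_def)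
      then have "(\<integral>\<^sup>+r. ennreal (2 * r) * (indicator {0..R} r * indicator {q. norm (fst q) \<le> snd q} (p :: 'a, r)) \<partial>lborel)
          = (\<integral>\<^sup>+(r::real). 0 \<partial>lborel)" by (intro nn_integral_cong) (simp only: mult_zero_right)
      then show ?thesis using False by simp
    qed
  qed
  also have "\<dots> = (\<integral>\<^sup>+r. (\<integral>\<^sup>+p. ennreal (2 * r) * (indicator {0..R} r * indicator {q. norm (fst q) \<le> snd q} (p :: 'a, r)) \<partial>lborel) \<partial>lborel)"
  proof (rule lborel_pair.Fubini')
    have [measurable]: "{q :: 'a \<times> real. norm (fst q) \<le> snd q} \<in> sets (lborel \<Otimes>\<^sub>M lborel)"
      by (subst lborel_prod) (auto intro!: borel_closed closed_Collect_le continuous_intros)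
    show "(\<lambda>(r, p). ennreal (2 * r) * (indicator {0..R} r * indicator {q. norm (fst q) \<le> snd q} (p, r)))
        \<in> borel_measurable (lborel \<Otimes>\<^sub>M (lborel :: 'a measure))"
      by measurable
  qed
  also have "\<dots> = (\<integral>\<^sup>+r. ennreal (2 * w * r ^ (DIM('a) + 1)) * indicator {0..R} r \<partial>lborel)"
  proof (rule nn_integral_cong)
    fix r :: real
    show "(\<integral>\<^sup>+p. ennreal (2 * r) * (indicator {0..R} r * indicator {q. norm (fst q) \<le> snd q} (p :: 'a, r)) \<partial>lborel)
        = ennreal (2 * w * r ^ (DIM('a) + 1)) * indicator {0..R} r"
    proof (cases "r \<in> {0..R}")
      case True
      then have "(\<integral>\<^sup>+p. ennreal (2 * r) * (indicator {0..R} r * indicator {q. norm (fst q) \<le> snd q} (p :: 'a, r)) \<partial>lborel)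
          = (\<integral>\<^sup>+p. ennreal (2 * r) * indicator (cball (0::'a) r) p \<partial>lborel)"
        by (intro nn_integral_cong) (auto simp: indicator_def)
      also have "\<dots> = ennreal (2 * r) * emeasure lborel (cball (0::'a) r)"
        by (rule nn_integral_cmult_indicator) simp
      also have "\<dots> = ennreal (2 * w * r ^ (DIM('a) + 1))"
        using True w by (simp add: emeasure_cball w_def ennreal_mult[symmetric] mult_ac)
      finally show ?thesis using True by simp
    qed simp
  qed
  also have "\<dots> = ennreal (2 * w * R ^ (DIM('a) + 2) / (real DIM('a) + 2) - 2 * w * 0 ^ (DIM('a) + 2) / (real DIM('a) + 2))"
  proof (rule nn_integral_FTC_Icc)
    show "((\<lambda>r. 2 * w * r ^ (DIM('a) + 2) / (real DIM('a) + 2)) has_real_derivative 2 * w * r ^ (DIM('a) + 1)) (at r)" for r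
    proof -
      have "((\<lambda>r. 2 * w * r ^ (DIM('a) + 2) / (real DIM('a) + 2)) has_real_derivative
          2 * w * (real (DIM('a) + 2) * r ^ (DIM('a) + 1)) / (real DIM('a) + 2)) (at r)"
      proof (intro DERIV_cdivide DERIV_cmult)
        show "((\<lambda>r. r ^ (DIM('a) + 2)) has_real_derivative real (DIM('a) + 2) * r ^ (DIM('a) + 1)) (at r)"
          using DERIV_pow[of "DIM('a) + 2" r UNIV] by simp
      qed
      moreover have "2 * w * (real (DIM('a) + 2) * r ^ (DIM('a) + 1)) / (real DIM('a) + 2) = 2 * w * r ^ (DIM('a) + 1)"
        by (simp add: field_simps)
      ultimately show ?thesis by (simp only:)
    qed
  qed (use R w in auto)
  also have "2 * w * R ^ (DIM('a) + 2) / (real DIM('a) + 2) - 2 * w * 0 ^ (DIM('a) + 2) / (real DIM('a) + 2)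
      = 2 / (real DIM('a) + 2) * unit_ball_vol (real DIM('a)) * R ^ (DIM('a) + 2)"
    by (simp add: w_def)
  finally show ?thesis .
qed

section \<open>The theorem\<close>

lemma abs_sin_diff_le: "\<bar>sin a - sin b\<bar> \<le> \<bar>a - b\<bar>" for a b :: real
proof -
  have "\<bar>sin a - sin b\<bar> = 2 * (\<bar>sin ((a - b) / 2)\<bar> * \<bar>cos ((a + b) / 2)\<bar>)"
    by (simp add: sin_diff_sin abs_mult)
  also have "\<dots> \<le> 2 * (\<bar>(a - b) / 2\<bar> * 1)"
    by (intro mult_left_mono mult_mono abs_sin_x_le_abs_x) auto
  finally show ?thesis by simp
qed

lemma abs_cos_diff_le: "\<bar>cos a - cos b\<bar> \<le> \<bar>a - b\<bar>" for a b :: real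
  using abs_sin_diff_le[of "pi / 2 - a" "pi / 2 - b"] by (simp add: sin_diff)

text \<open>The left side is the tangent line at \<open>t\<close> of the convex function on the
  right. The proof is Young's inequality with exponents \<open>s\<close> and
  \<open>s / (s - 1)\<close>.\<close>

lemma powr_tangent_bound:
  fixes s t T :: real
  assumes s: "s > 1" and t: "t > 0" and T: "T \<ge> 0"
  shows "s * t powr (s - 1) * T - (s - 1) * t powr s \<le> T powr s"
proof -
  have "T * t powr (s - 1) \<le> T powr s / s + (t powr (s - 1)) powr (s / (s - 1)) / (s / (s - 1))"
    by (rule Youngs_inequality) (use s T in \<open>auto simp: field_simps\<close>)
  also have "(t powr (s - 1)) powr (s / (s - 1)) = t powr s" using s by (simp add: powr_powr)
  finally have "s * (T * t powr (s - 1)) \<le> s * (T powr s / s + t powr s / (s / (s - 1)))"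
    using s by (intro mult_left_mono) auto
  also have "\<dots> = T powr s + (s - 1) * t powr s" using s by (simp add: field_simps)
  finally show ?thesis by (simp add: mult_ac)
qed

text \<open>A finite essential supremum makes \<open>real_of_ereal\<close> faithful, and one that is
  at most \<open>0\<close> would force \<phi> to vanish almost everywhere.\<close>

lemma Linfty_bound:
  assumes \<phi>: "\<phi> \<in> Linfty \<Omega>" and nz: "\<not> (AE x in lebesgue_on \<Omega>. \<phi> x = 0)"
  shows "0 < Linfty_norm \<Omega> \<phi>" "AE x in lebesgue_on \<Omega>. \<bar>\<phi> x\<bar> \<le> Linfty_norm \<Omega> \<phi>"
proof -
  define M where "M = esssup (lebesgue_on \<Omega>) (\<lambda>x. ereal \<bar>\<phi> x\<bar>)"
  have AE: "AE x in lebesgue_on \<Omega>. ereal \<bar>\<phi> x\<bar> \<le> M" unfolding M_def by (rule esssup_AE)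
  have "\<not> M \<le> 0"
  proof
    assume "M \<le> 0"
    have "AE x in lebesgue_on \<Omega>. \<phi> x = 0"
      using AE
    proof eventually_elim
      case (elim x)
      then have "ereal \<bar>\<phi> x\<bar> \<le> 0" using \<open>M \<le> 0\<close> by (rule order_trans)
      then show ?case by simp
    qed
    with nz show False by simp
  qed
  moreover have "M < \<infinity>" using \<phi> by (simp add: Linfty_def M_def)
  ultimately obtain m where m: "M = ereal m" "m > 0" by (cases M) auto
  then have "Linfty_norm \<Omega> \<phi> = m" by (simp add: Linfty_norm_def M_def[symmetric])
  with m AE show "0 < Linfty_norm \<Omega> \<phi>" "AE x in lebesgue_on \<Omega>. \<bar>\<phi> x\<bar> \<le> Linfty_norm \<Omega> \<phi>" by auto
qed

section \<open>The bound on rho and the trial functions\<close>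

context bounded_open_set
begin

lemma measure_lebesgue_on_\<Omega>: "measure (lebesgue_on \<Omega>) \<Omega> = measure lebesgue \<Omega>"
  by (rule measure_restrict_space) (use sets_\<Omega> in auto)

text \<open>If \<open>\<bar>\<phi>\<bar> = c\<close>, then \<open>1 - cos (pi \<phi> / c)\<close> is the constant \<open>2\<close>, and it is a limit of test functions
  whose gradients tend to \<open>0\<close> in \<open>L\<^sup>1\<close>; integrating \<open>x \<bullet> i\<close> against the gradients contradicts this.\<close>

lemma not_constant_modulus:
  fixes \<phi> :: "'a \<Rightarrow> real"
  assumes \<phi>: "\<phi> \<in> H10 \<Omega>" and c: "c > 0" and AE: "AE x in lebesgue_on \<Omega>. \<bar>\<phi> x\<bar> = c"
  shows "measure lebesgue \<Omega> = 0"
proof -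
  note G = H10_grad_approx[OF \<phi>]
  obtain \<psi> where \<psi>: "\<And>n. \<psi> n \<in> test_functions \<Omega>"
      "(\<lambda>n. L2_norm \<Omega> (\<lambda>x. \<psi> n x - \<phi> x)) \<longlonglongrightarrow> 0"
      "\<And>i. i \<in> Basis \<Longrightarrow> (\<lambda>n. L2_norm \<Omega> (\<lambda>x. partial_deriv i (\<psi> n) x - weak_partial \<Omega> i \<phi> x)) \<longlonglongrightarrow> 0"
    using G unfolding grad_approx_def by blast
  obtain i :: 'a where i: "i \<in> Basis" using nonempty_Basis by blast
  \<comment> \<open>For both values \<open>c\<close> and \<open>- c\<close> of \<phi> this scaling
    gives sine \<open>0\<close> and cosine \<open>-1\<close>.\<close>
  define a where "a = pi / c"
  have a: "a > 0" using c by (simp add: a_def)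
  define \<theta> where "\<theta> n x = 1 - cos (a * \<psi> n x)" for n x
  have test: "\<theta> n \<in> test_functions \<Omega>" for n
  proof (rule test_functions_I)
    show "Ck k (\<theta> n)" for k
      unfolding \<theta>_def[abs_def] using \<psi>(1)[of n]
      by (intro Ck_diff Ck_const Ck_cos Ck_mult) (auto simp: test_functions_def)
    show "bounded (closure {x. \<psi> n x \<noteq> 0})" "closure {x. \<psi> n x \<noteq> 0} \<subseteq> \<Omega>"
      using \<psi>(1)[of n] by (auto simp: test_functions_def compact_imp_bounded)
    fix x assume "x \<notin> closure {x. \<psi> n x \<noteq> 0}"
    then have "\<psi> n x = 0" using closure_subset[of "{x. \<psi> n x \<noteq> 0}"] by auto
    then show "\<theta> n x = 0" by (simp add: \<theta>_def)
  qed auto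
  have pd: "partial_deriv i (\<theta> n) x = a * sin (a * \<psi> n x) * partial_deriv i (\<psi> n) x" for n x
  proof -
    have "(\<theta> n has_derivative (\<lambda>v. a * sin (a * \<psi> n x) * frechet_derivative (\<psi> n) (at x) v)) (at x)"
      unfolding \<theta>_def[abs_def]
      by (auto intro!: derivative_eq_intros differentiable_has_derivative Cc1_differentiable test_functions_Cc1 \<psi>(1))
    from partial_deriv_eq[OF this] show ?thesis by (simp add: partial_deriv_def)
  qed
  have d\<phi>: "(\<lambda>x. \<psi> n x - \<phi> x) \<in> L2 \<Omega>" for n
    by (rule L2_diff[OF test_L2(1)[OF \<psi>(1)] H10_L2[OF \<phi>]])
  have sin_cos: "sin (a * \<phi> x) = 0 \<and> cos (a * \<phi> x) = -1" if "\<bar>\<phi> x\<bar> = c" for x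
  proof -
    have "\<phi> x = c \<or> \<phi> x = - c" using that by linarith
    then have "a * \<phi> x = pi \<or> a * \<phi> x = - pi" using c by (auto simp: a_def)
    then show ?thesis by auto
  qed
  have \<psi>m: "(\<lambda>x. a * \<psi> n x) \<in> borel_measurable (lebesgue_on \<Omega>)" for n
    using L2_measurable[OF test_L2(1)[OF \<psi>(1)], of n] by measurable
  have L1: "(\<lambda>x. \<theta> n x - 2) \<in> L2 \<Omega>" for n
    by (rule L2_diff[OF test_L2(1)[OF test] L2_const[OF lmeasurable_\<Omega>]])
  have N1: "L2_norm \<Omega> (\<lambda>x. \<theta> n x - 2) \<le> a * L2_norm \<Omega> (\<lambda>x. \<psi> n x - \<phi> x)" for n
  proof (rule L2_norm_mono[OF L2_measurable[OF L1] d\<phi>])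
    show "AE x in lebesgue_on \<Omega>. norm (\<theta> n x - 2) \<le> a * norm (\<psi> n x - \<phi> x)"
      using AE
    proof eventually_elim
      case (elim x)
      have "\<theta> n x - 2 = - (cos (a * \<psi> n x) - cos (a * \<phi> x))"
        using sin_cos[OF elim] by (simp add: \<theta>_def)
      then have "norm (\<theta> n x - 2) = \<bar>cos (a * \<psi> n x) - cos (a * \<phi> x)\<bar>"
        by (simp only: real_norm_def abs_minus)
      also have "\<dots> \<le> \<bar>a * \<psi> n x - a * \<phi> x\<bar>" by (rule abs_cos_diff_le)
      finally show ?case using a by (simp add: right_diff_distrib[symmetric] abs_mult)
    qed
  qed (use a in simp)
  have sinL: "(\<lambda>x. sin (a * \<psi> n x)) \<in> L2 \<Omega>" for n
    by (rule L2_bounded[OF lmeasurable_\<Omega>, of _ 1]) (use \<psi>m in \<open>auto intro: borel_measurable_sin\<close>)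
  have N2: "L2_norm \<Omega> (\<lambda>x. sin (a * \<psi> n x)) \<le> a * L2_norm \<Omega> (\<lambda>x. \<psi> n x - \<phi> x)" for n
  proof (rule L2_norm_mono[OF L2_measurable[OF sinL] d\<phi>])
    show "AE x in lebesgue_on \<Omega>. norm (sin (a * \<psi> n x)) \<le> a * norm (\<psi> n x - \<phi> x)"
      using AE
    proof eventually_elim
      case (elim x)
      have "norm (sin (a * \<psi> n x)) = \<bar>sin (a * \<psi> n x) - sin (a * \<phi> x)\<bar>"
        using sin_cos[OF elim] by simp
      also have "\<dots> \<le> \<bar>a * \<psi> n x - a * \<phi> x\<bar>" by (rule abs_sin_diff_le)
      finally show ?case using a by (simp add: right_diff_distrib[symmetric] abs_mult)
    qed
  qed (use a in simp)
  obtain B where B: "B > 0" "\<And>x. x \<in> \<Omega> \<Longrightarrow> norm x \<le> B" using bounded_\<Omega> by (auto simp: bounded_pos)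
  have xL: "(\<lambda>x. x \<bullet> i * \<psi>' x) \<in> L2 \<Omega> \<and> L2_norm \<Omega> (\<lambda>x. x \<bullet> i * \<psi>' x) \<le> B * L2_norm \<Omega> \<psi>'"
    if \<psi>': "\<psi>' \<in> L2 \<Omega>" for \<psi>' :: "'a \<Rightarrow> real"
  proof -
    have "(\<lambda>x. x \<bullet> i) \<in> borel_measurable (lebesgue_on \<Omega>)"
      by (intro borel_measurable_lebesgue_on_borel borel_measurable_continuous_onI continuous_intros)
    then have m: "(\<lambda>x. x \<bullet> i * \<psi>' x) \<in> borel_measurable (lebesgue_on \<Omega>)"
      using L2_measurable[OF \<psi>'] by measurable
    have b: "AE x in lebesgue_on \<Omega>. norm (x \<bullet> i * \<psi>' x) \<le> B * norm (\<psi>' x)"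
    proof (rule AE_I2)
      fix x assume "x \<in> space (lebesgue_on \<Omega>)"
      then have "\<bar>x \<bullet> i\<bar> \<le> B" using B(2)[of x] Basis_le_norm[OF i, of x] by simp
      then show "norm (x \<bullet> i * \<psi>' x) \<le> B * norm (\<psi>' x)" by (simp add: abs_mult mult_right_mono)
    qed
    show ?thesis using L2_dominated[OF m \<psi>' b] L2_norm_mono[OF m \<psi>' _ b] B(1) by simp
  qed
  define m where "m = measure lebesgue \<Omega>"
  define V where "V = L2_norm \<Omega> (\<lambda>x. 1::real)"
  \<comment> \<open>The integral of \<open>\<theta> n\<close> is \<open>2 * m\<close> up to the
    distance of \<open>\<theta> n\<close> from \<open>2\<close>, and by parts it is minus the
    integral of \<open>x \<bullet> i\<close> times its derivative. That derivative contains the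
    factor \<open>sin (a * \<psi> n x)\<close>, which tends to \<open>0\<close> in
    \<open>L2\<close>, so the whole bound tends to \<open>0\<close>.\<close>
  have bound: "2 * m \<le> V * (a * L2_norm \<Omega> (\<lambda>x. \<psi> n x - \<phi> x))
      + a * (B * (a * L2_norm \<Omega> (\<lambda>x. \<psi> n x - \<phi> x))) * L2_norm \<Omega> (partial_deriv i (\<psi> n))" for n
  proof -
    have int: "(\<integral>x. \<theta> n x \<partial>lebesgue_on \<Omega>) = (\<integral>x. (\<theta> n x - 2) \<partial>lebesgue_on \<Omega>) + 2 * m"
      using L2_imp_integrable[OF lmeasurable_\<Omega> test_L2(1)[OF test]] integrable_const_lebesgue_on[OF lmeasurable_\<Omega>, of "2::real"]
      by (simp add: m_def measure_lebesgue_on_\<Omega>)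
    have "Ck (Suc 0) (\<lambda>x. x \<bullet> i)" by (rule Ck_inner)
    from test_by_parts[OF this test[of n] i]
    have "(\<integral>x. partial_deriv i (\<lambda>x. x \<bullet> i) x *\<^sub>R \<theta> n x \<partial>lebesgue_on \<Omega>) = - (\<integral>x. (x \<bullet> i) *\<^sub>R partial_deriv i (\<theta> n) x \<partial>lebesgue_on \<Omega>)" .
    moreover have "partial_deriv i (\<lambda>x. x \<bullet> i) x = 1" for x
    proof -
      have "((\<lambda>x. x \<bullet> i) has_derivative (\<lambda>v. v \<bullet> i)) (at x)" by (auto intro!: derivative_eq_intros)
      from partial_deriv_eq[OF this, of i] show ?thesis using i by simp
    qed
    ultimately have parts: "(\<integral>x. \<theta> n x \<partial>lebesgue_on \<Omega>) = - (\<integral>x. (x \<bullet> i) * partial_deriv i (\<theta> n) x \<partial>lebesgue_on \<Omega>)"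
      by simp
    have "\<bar>\<integral>x. (\<theta> n x - 2) \<partial>lebesgue_on \<Omega>\<bar> \<le> V * L2_norm \<Omega> (\<lambda>x. \<theta> n x - 2)"
      using L2_bilinear_bound[OF bounded_bilinear_mult _ L2_const[OF lmeasurable_\<Omega>, of "1::real"] L1[of n]]
      by (simp add: V_def abs_mult)
    also have "\<dots> \<le> V * (a * L2_norm \<Omega> (\<lambda>x. \<psi> n x - \<phi> x))"
      by (intro mult_left_mono N1) (simp add: V_def)
    finally have 1: "\<bar>\<integral>x. (\<theta> n x - 2) \<partial>lebesgue_on \<Omega>\<bar> \<le> V * (a * L2_norm \<Omega> (\<lambda>x. \<psi> n x - \<phi> x))" .
    have "(\<integral>x. (x \<bullet> i) * partial_deriv i (\<theta> n) x \<partial>lebesgue_on \<Omega>)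
        = a * (\<integral>x. (x \<bullet> i * sin (a * \<psi> n x)) * partial_deriv i (\<psi> n) x \<partial>lebesgue_on \<Omega>)"
      unfolding pd by (subst integral_mult_right_zero[symmetric]) (simp add: mult_ac)
    then have "\<bar>\<integral>x. (x \<bullet> i) * partial_deriv i (\<theta> n) x \<partial>lebesgue_on \<Omega>\<bar>
        = a * \<bar>\<integral>x. (x \<bullet> i * sin (a * \<psi> n x)) * partial_deriv i (\<psi> n) x \<partial>lebesgue_on \<Omega>\<bar>"
      using a by (simp add: abs_mult)
    also have "\<dots> \<le> a * (L2_norm \<Omega> (\<lambda>x. x \<bullet> i * sin (a * \<psi> n x)) * L2_norm \<Omega> (partial_deriv i (\<psi> n)))"
      using L2_bilinear_bound[OF bounded_bilinear_mult _ conjunct1[OF xL[OF sinL[of n]]] test_L2(2)[OF \<psi>(1) i, of n]] a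
      by (intro mult_left_mono) (simp_all add: abs_mult)
    also have "\<dots> \<le> a * ((B * (a * L2_norm \<Omega> (\<lambda>x. \<psi> n x - \<phi> x))) * L2_norm \<Omega> (partial_deriv i (\<psi> n)))"
      using a B(1) order_trans[OF conjunct2[OF xL[OF sinL[of n]]] mult_left_mono[OF N2[of n], of B]]
      by (intro mult_left_mono mult_right_mono) auto
    finally have 2: "\<bar>\<integral>x. (x \<bullet> i) * partial_deriv i (\<theta> n) x \<partial>lebesgue_on \<Omega>\<bar>
        \<le> a * (B * (a * L2_norm \<Omega> (\<lambda>x. \<psi> n x - \<phi> x))) * L2_norm \<Omega> (partial_deriv i (\<psi> n))"
      by (simp add: mult.assoc)
    show ?thesis using int parts 1 2 by linarith
  qed
  have "(\<lambda>n. L2_norm \<Omega> (partial_deriv i (\<psi> n))) \<longlonglongrightarrow> L2_norm \<Omega> (weak_partial \<Omega> i \<phi>)"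
    by (rule L2_norm_tendsto[OF test_L2(2)[OF \<psi>(1) i] weak_partial_L2[OF \<phi> i] \<psi>(3)[OF i]])
  then have "(\<lambda>n. V * (a * L2_norm \<Omega> (\<lambda>x. \<psi> n x - \<phi> x))
      + a * (B * (a * L2_norm \<Omega> (\<lambda>x. \<psi> n x - \<phi> x))) * L2_norm \<Omega> (partial_deriv i (\<psi> n)))
      \<longlonglongrightarrow> V * (a * 0) + a * (B * (a * 0)) * L2_norm \<Omega> (weak_partial \<Omega> i \<phi>)"
    by (intro tendsto_intros \<psi>(2))
  then have "2 * m \<le> V * (a * 0) + a * (B * (a * 0)) * L2_norm \<Omega> (weak_partial \<Omega> i \<phi>)"
    by (rule LIMSEQ_le_const) (use bound in blast)
  then show ?thesis by (simp add: m_def measure_nonneg antisym)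
qed

text \<open>Equality in the bound of the squared norm by \<open>m * M\<^sup>2\<close> would force
  the modulus of \<phi> to equal \<open>M\<close> almost everywhere, and
  \<open>not_constant_modulus\<close> then makes the nonempty open set \<Omega> null.\<close>

lemma rho_less_1:
  fixes \<phi> :: "'a \<Rightarrow> real"
  assumes ne: "\<Omega> \<noteq> {}" and \<phi>: "\<phi> \<in> H10 \<Omega>" "\<phi> \<in> Linfty \<Omega>"
    and nz: "\<not> (AE x in lebesgue_on \<Omega>. \<phi> x = 0)"
  shows "0 < measure lebesgue \<Omega>" "0 < (L2_norm \<Omega> \<phi>)\<^sup>2" "0 < rho \<Omega> \<phi>" "rho \<Omega> \<phi> < 1"
proof -
  define m where "m = measure lebesgue \<Omega>"
  define M where "M = Linfty_norm \<Omega> \<phi>"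
  note M = Linfty_bound[OF \<phi>(2) nz, folded M_def]
  have "\<not> negligible \<Omega>" using open_not_negligible[OF open_\<Omega> ne] .
  then have "m \<noteq> 0" using lmeasurable_\<Omega> by (simp add: m_def negligible_iff_measure)
  then show m: "0 < measure lebesgue \<Omega>" using measure_nonneg[of lebesgue \<Omega>] unfolding m_def by linarith
  have L: "\<phi> \<in> L2 \<Omega>" by (rule H10_L2[OF \<phi>(1)])
  show K: "0 < (L2_norm \<Omega> \<phi>)\<^sup>2" using L2_norm_eq_0_iff[OF L] nz by simp
  show "0 < rho \<Omega> \<phi>" using m K M(1) by (simp add: rho_def M_def)
  have int: "integrable (lebesgue_on \<Omega>) (\<lambda>x. M\<^sup>2 - (norm (\<phi> x))\<^sup>2)"
    using L2_integrable[OF L] integrable_const_lebesgue_on[OF lmeasurable_\<Omega>, of "M\<^sup>2"] by simp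
  have nonneg: "AE x in lebesgue_on \<Omega>. 0 \<le> M\<^sup>2 - (norm (\<phi> x))\<^sup>2"
    using M(2) by eventually_elim (simp add: abs_le_square_iff[symmetric] M(1) less_imp_le)
  have val: "(\<integral>x. M\<^sup>2 - (norm (\<phi> x))\<^sup>2 \<partial>lebesgue_on \<Omega>) = m * M\<^sup>2 - (L2_norm \<Omega> \<phi>)\<^sup>2"
    using L2_integrable[OF L] integrable_const_lebesgue_on[OF lmeasurable_\<Omega>, of "M\<^sup>2"]
    by (simp add: L2_norm_power2 m_def measure_lebesgue_on_\<Omega>)
  have "(\<integral>x. M\<^sup>2 - (norm (\<phi> x))\<^sup>2 \<partial>lebesgue_on \<Omega>) \<noteq> 0"
  proof
    assume "(\<integral>x. M\<^sup>2 - (norm (\<phi> x))\<^sup>2 \<partial>lebesgue_on \<Omega>) = 0"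
    then have "AE x in lebesgue_on \<Omega>. M\<^sup>2 - (norm (\<phi> x))\<^sup>2 = 0"
      using integral_nonneg_eq_0_iff_AE[OF int nonneg] by simp
    then have "AE x in lebesgue_on \<Omega>. \<bar>\<phi> x\<bar> = M"
    proof eventually_elim
      case (elim x)
      then have "\<bar>\<phi> x\<bar>\<^sup>2 = M\<^sup>2" by simp
      then show ?case using M(1) by (simp only: power2_eq_iff) linarith
    qed
    from not_constant_modulus[OF \<phi>(1) M(1) this] m show False by simp
  qed
  then have "0 < (\<integral>x. M\<^sup>2 - (norm (\<phi> x))\<^sup>2 \<partial>lebesgue_on \<Omega>)"
    using integral_nonneg_AE[OF nonneg] by linarith
  then have "(L2_norm \<Omega> \<phi>)\<^sup>2 < m * M\<^sup>2" unfolding val by simp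
  then show "rho \<Omega> \<phi> < 1" using m M(1) by (simp add: rho_def M_def m_def)
qed

text \<open>Up to a unimodular factor, the weak derivative of \<phi> and
  \<open>(p \<bullet> i) * \<phi>\<close> are the real and imaginary part of the gradient, so the
  squares simply add.\<close>

lemma modulated_norm_energy:
  fixes \<phi> :: "'a \<Rightarrow> real" and p :: 'a
  assumes \<phi>: "\<phi> \<in> H10 \<Omega>"
  defines "v \<equiv> \<lambda>x. complex_of_real (\<phi> x) * cis (p \<bullet> x)"
  shows "v \<in> H10 \<Omega>" "(L2_norm \<Omega> v)\<^sup>2 = (L2_norm \<Omega> \<phi>)\<^sup>2"
    "Re (energy v v) = (grad_norm \<Omega> \<phi>)\<^sup>2 + (norm p)\<^sup>2 * (L2_norm \<Omega> \<phi>)\<^sup>2"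
proof -
  note G = grad_approx_modulate[OF H10_grad_approx[OF \<phi>], of p, folded v_def]
  show "v \<in> H10 \<Omega>" unfolding v_def by (rule grad_approx_H10[OF grad_approx_modulate[OF H10_grad_approx[OF \<phi>]]])
  show "(L2_norm \<Omega> v)\<^sup>2 = (L2_norm \<Omega> \<phi>)\<^sup>2"
    by (simp add: L2_norm_power2 v_def norm_mult)
  have "Re (energy v v) = (\<Sum>i\<in>Basis. (L2_norm \<Omega> (\<lambda>x. Complex (weak_partial \<Omega> i \<phi> x) ((p \<bullet> i) * \<phi> x) * cis (p \<bullet> x)))\<^sup>2)"
    unfolding v_def
    by (subst energy_self[OF grad_approx_modulate[OF H10_grad_approx[OF \<phi>]]]) (simp only: Re_complex_of_real)
  also have "\<dots> = (\<Sum>i\<in>Basis. (L2_norm \<Omega> (weak_partial \<Omega> i \<phi>))\<^sup>2 + (p \<bullet> i)\<^sup>2 * (L2_norm \<Omega> \<phi>)\<^sup>2)"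
  proof (rule sum.cong[OF refl])
    fix i :: 'a assume i: "i \<in> Basis"
    have "(norm (Complex a b * cis t))\<^sup>2 = a\<^sup>2 + b\<^sup>2" for a b t
      by (simp add: norm_mult cmod_power2)
    then show "(L2_norm \<Omega> (\<lambda>x. Complex (weak_partial \<Omega> i \<phi> x) ((p \<bullet> i) * \<phi> x) * cis (p \<bullet> x)))\<^sup>2
        = (L2_norm \<Omega> (weak_partial \<Omega> i \<phi>))\<^sup>2 + (p \<bullet> i)\<^sup>2 * (L2_norm \<Omega> \<phi>)\<^sup>2"
      using L2_integrable[OF weak_partial_L2[OF \<phi> i]] L2_integrable[OF H10_L2[OF \<phi>]]
      by (simp add: L2_norm_power2 power_mult_distrib)
  qed
  also have "\<dots> = (grad_norm \<Omega> \<phi>)\<^sup>2 + (norm p)\<^sup>2 * (L2_norm \<Omega> \<phi>)\<^sup>2"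
    by (simp add: sum.distrib grad_norm_def sum_nonneg sum_distrib_right[symmetric] norm_eq_sqrt_inner
        euclidean_inner[of p p] power2_eq_square)
  finally show "Re (energy v v) = (grad_norm \<Omega> \<phi>)\<^sup>2 + (norm p)\<^sup>2 * (L2_norm \<Omega> \<phi>)\<^sup>2" .
qed

lemma Linfty_mult_L2:
  assumes \<phi>: "\<phi> \<in> Linfty \<Omega>" and bd: "AE x in lebesgue_on \<Omega>. \<bar>\<phi> x\<bar> \<le> M" "0 \<le> M" and f: "f \<in> L2 \<Omega>"
  shows "(\<lambda>x. \<phi> x *\<^sub>R f x) \<in> L2 \<Omega>" "L2_norm \<Omega> (\<lambda>x. \<phi> x *\<^sub>R f x) \<le> M * L2_norm \<Omega> f"
proof -
  have [measurable]: "\<phi> \<in> borel_measurable (lebesgue_on \<Omega>)" using \<phi> by (simp add: Linfty_def)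
  have [measurable]: "f \<in> borel_measurable (lebesgue_on \<Omega>)" by (rule L2_measurable[OF f])
  have m: "(\<lambda>x. \<phi> x *\<^sub>R f x) \<in> borel_measurable (lebesgue_on \<Omega>)" by measurable
  have b: "AE x in lebesgue_on \<Omega>. norm (\<phi> x *\<^sub>R f x) \<le> M * norm (f x)"
    using bd(1) by eventually_elim (simp add: mult_right_mono)
  show "(\<lambda>x. \<phi> x *\<^sub>R f x) \<in> L2 \<Omega>" by (rule L2_dominated[OF m f b])
  show "L2_norm \<Omega> (\<lambda>x. \<phi> x *\<^sub>R f x) \<le> M * L2_norm \<Omega> f" by (rule L2_norm_mono[OF m f bd(2) b])
qed

section \<open>Riesz means and averages of eigenvalues\<close>

context
  fixes ev :: "nat \<Rightarrow> real" and u :: "nat \<Rightarrow> 'a \<Rightarrow> complex" and \<phi> :: "'a \<Rightarrow> real"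
  assumes ev: "dirichlet_eigenvalues \<Omega> ev" and u: "orthonormal_eigenfunctions \<Omega> ev u"
    and \<phi>: "\<phi> \<in> H10 \<Omega>" "\<phi> \<in> Linfty \<Omega>" and nz: "\<not> (AE x in lebesgue_on \<Omega>. \<phi> x = 0)"
begin

text \<open>Only the finitely many \<open>j\<close> with \<open>ev j < z\<close> contribute, so the
  infinite sum is a true value and not the default \<open>0\<close> of
  \<open>infsum\<close>.\<close>

lemma riesz_infsum:
  "(\<Sum>\<^sub>\<infinity>j\<in>{1..}. max (z - ev j) 0 * X j) = (\<Sum>j\<in>{j. 1 \<le> j \<and> ev j < z}. (z - ev j) * X j)"
proof -
  have "(\<Sum>\<^sub>\<infinity>j\<in>{1..}. max (z - ev j) 0 * X j) = infsum (\<lambda>j. (z - ev j) * X j) {j. 1 \<le> j \<and> ev j < z}"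
    by (rule infsum_cong_neutral) (auto simp: max_def)
  then show ?thesis
    using finite_eigenvalues_below[OF ev u, of z] by simp
qed

lemma riesz_mean_bound_of_less:
  assumes z: "(grad_norm \<Omega> \<phi>)\<^sup>2 / (L2_norm \<Omega> \<phi>)\<^sup>2 < z"
  shows "2 / (real DIM('a) + 2) * (2 * pi) powr (- real DIM('a)) * unit_ball_vol (real DIM('a)) * (L2_norm \<Omega> \<phi>)\<^sup>2
      * (z - (grad_norm \<Omega> \<phi>)\<^sup>2 / (L2_norm \<Omega> \<phi>)\<^sup>2) powr (real DIM('a) / 2 + 1)
    \<le> (\<Sum>j\<in>{j. 1 \<le> j \<and> ev j < z}. (z - ev j) * (L2_norm \<Omega> (\<lambda>x. \<phi> x *\<^sub>R u j x))\<^sup>2)"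
proof -
  define J where "J = {j. 1 \<le> j \<and> ev j < z}"
  have J: "finite J" using finite_eigenvalues_below[OF ev u] by (simp add: J_def)
  define K where "K = (L2_norm \<Omega> \<phi>)\<^sup>2"
  have K: "K > 0" using L2_norm_eq_0_iff[OF H10_L2[OF \<phi>(1)]] nz by (simp add: K_def)
  define \<Lambda> where "\<Lambda> = (grad_norm \<Omega> \<phi>)\<^sup>2 / K"
  \<comment> \<open>The radius at which the pointwise lower bound
    \<open>K * (R\<^sup>2 - (norm p)\<^sup>2)\<close> changes sign.\<close>
  define R where "R = sqrt (z - \<Lambda>)"
  have R0: "R > 0" and R2: "R\<^sup>2 = z - \<Lambda>" using z by (simp_all add: R_def \<Lambda>_def K_def)
  \<comment> \<open>The conjugate turns the inner product of the trial function with
    \<open>u j\<close> into a Fourier transform; it does not affect the norm.\<close>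
  define f where "f j x = \<phi> x *\<^sub>R cnj (u j x)" for j x
  have uL: "u j \<in> L2 \<Omega>" if "j \<in> J" for j
    using u_H10[OF ev u] that by (auto simp: J_def intro: H10_L2)
  have fL: "f j \<in> L2 \<Omega>" if "j \<in> J" for j
    unfolding f_def using Linfty_bound[OF \<phi>(2) nz]
    by (intro Linfty_mult_L2(1)[OF \<phi>(2)] L2_cnj uL[OF that]) auto
  have f_norm: "L2_norm \<Omega> (f j) = L2_norm \<Omega> (\<lambda>x. \<phi> x *\<^sub>R u j x)" for j
    by (simp add: f_def L2_norm_def)
  have pointwise: "K * (R\<^sup>2 - (norm p)\<^sup>2) \<le> (\<Sum>j\<in>J. (z - ev j) * (cmod (fourier \<Omega> (f j) p))\<^sup>2)" for p
  proof -
    let ?v = "\<lambda>x. complex_of_real (\<phi> x) * cis (p \<bullet> x)"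
    note v = modulated_norm_energy[OF \<phi>(1), of p]
    have "z * (L2_norm \<Omega> ?v)\<^sup>2 - Re (energy ?v ?v) \<le> (\<Sum>j\<in>J. (z - ev j) * (cmod (L2_inner \<Omega> ?v (u j)))\<^sup>2)"
      unfolding J_def by (rule riesz_mean_lower_bound[OF ev u v(1)])
    moreover have "L2_inner \<Omega> ?v (u j) = fourier \<Omega> (f j) p" for j
      by (simp add: L2_inner_def fourier_def f_def scaleR_conv_of_real mult_ac)
    moreover have "z * (L2_norm \<Omega> ?v)\<^sup>2 - Re (energy ?v ?v) = K * (R\<^sup>2 - (norm p)\<^sup>2)"
      unfolding v(2,3) R2 K_def[symmetric] using K by (simp add: \<Lambda>_def algebra_simps)
    ultimately show ?thesis by simp
  qed
  define C where "C = 2 / (real DIM('a) + 2) * unit_ball_vol (real DIM('a)) * R ^ (DIM('a) + 2)"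
  have C0: "C \<ge> 0" using R0 by (simp add: C_def)
  define S where "S = (\<Sum>j\<in>J. (z - ev j) * (L2_norm \<Omega> (\<lambda>x. \<phi> x *\<^sub>R u j x))\<^sup>2)"
  have S0: "0 \<le> S" unfolding S_def J_def by (intro sum_nonneg) auto
  have zJ: "0 \<le> z - ev j" if "j \<in> J" for j using that by (simp add: J_def)
  have fm: "fourier \<Omega> (f j) \<in> borel_measurable borel" if "j \<in> J" for j
    by (rule fourier_measurable[OF fL[OF that]])
  have [measurable]: "cball (0::'a) R \<in> sets borel" by simp
  have "ennreal (K * C) = ennreal K * (\<integral>\<^sup>+p\<in>cball (0::'a) R. ennreal (R\<^sup>2 - (norm p)\<^sup>2) \<partial>lborel)"
    unfolding ball_weight_integral[OF less_imp_le[OF R0]] C_def[symmetric]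
    using K C0 by (intro ennreal_mult) auto
  also have "\<dots> = (\<integral>\<^sup>+p. ennreal K * (ennreal (R\<^sup>2 - (norm p)\<^sup>2) * indicator (cball (0::'a) R) p) \<partial>lborel)"
    by (rule nn_integral_cmult[symmetric]) measurable
  also have "\<dots> \<le> (\<integral>\<^sup>+p. (\<Sum>j\<in>J. ennreal (z - ev j) * (ennreal ((cmod (fourier \<Omega> (f j) p))\<^sup>2) * indicator (cball 0 R) p)) \<partial>lborel)"
  proof (rule nn_integral_mono)
    fix p :: 'a
    show "ennreal K * (ennreal (R\<^sup>2 - (norm p)\<^sup>2) * indicator (cball (0::'a) R) p)
        \<le> (\<Sum>j\<in>J. ennreal (z - ev j) * (ennreal ((cmod (fourier \<Omega> (f j) p))\<^sup>2) * indicator (cball 0 R) p))"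
    proof (cases "p \<in> cball 0 R")
      case True
      have "ennreal K * ennreal (R\<^sup>2 - (norm p)\<^sup>2) = ennreal (K * (R\<^sup>2 - (norm p)\<^sup>2))"
        using K by (simp add: ennreal_mult')
      also have "\<dots> \<le> ennreal (\<Sum>j\<in>J. (z - ev j) * (cmod (fourier \<Omega> (f j) p))\<^sup>2)"
        by (rule ennreal_leI[OF pointwise])
      also have "\<dots> = (\<Sum>j\<in>J. ennreal (z - ev j) * ennreal ((cmod (fourier \<Omega> (f j) p))\<^sup>2))"
        using zJ by (subst sum_ennreal[symmetric]) (auto simp: ennreal_mult)
      finally show ?thesis using True by simp
    qed simp
  qed
  also have "\<dots> = (\<Sum>j\<in>J. \<integral>\<^sup>+p. ennreal (z - ev j) * (ennreal ((cmod (fourier \<Omega> (f j) p))\<^sup>2) * indicator (cball 0 R) p) \<partial>lborel)"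
  proof (rule nn_integral_sum)
    fix j assume "j \<in> J"
    then have [measurable]: "fourier \<Omega> (f j) \<in> borel_measurable borel" by (rule fm)
    show "(\<lambda>p. ennreal (z - ev j) * (ennreal ((cmod (fourier \<Omega> (f j) p))\<^sup>2) * indicator (cball 0 R) p)) \<in> borel_measurable lborel"
      by measurable
  qed
  also have "\<dots> = (\<Sum>j\<in>J. ennreal (z - ev j) * (\<integral>\<^sup>+p\<in>cball 0 R. ennreal ((cmod (fourier \<Omega> (f j) p))\<^sup>2) \<partial>lborel))"
  proof (rule sum.cong[OF refl])
    fix j assume "j \<in> J"
    then have [measurable]: "fourier \<Omega> (f j) \<in> borel_measurable borel" by (rule fm)
    show "(\<integral>\<^sup>+p. ennreal (z - ev j) * (ennreal ((cmod (fourier \<Omega> (f j) p))\<^sup>2) * indicator (cball 0 R) p) \<partial>lborel)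
        = ennreal (z - ev j) * (\<integral>\<^sup>+p\<in>cball 0 R. ennreal ((cmod (fourier \<Omega> (f j) p))\<^sup>2) \<partial>lborel)"
      by (rule nn_integral_cmult) measurable
  qed
  also have "\<dots> \<le> (\<Sum>j\<in>J. ennreal (z - ev j) * ennreal ((2 * pi) ^ DIM('a) * (L2_norm \<Omega> (f j))\<^sup>2))"
    by (intro sum_mono mult_left_mono fourier_bessel fL) auto
  also have "\<dots> = (\<Sum>j\<in>J. ennreal ((2 * pi) ^ DIM('a) * ((z - ev j) * (L2_norm \<Omega> (\<lambda>x. \<phi> x *\<^sub>R u j x))\<^sup>2)))"
    using zJ by (intro sum.cong refl) (simp add: f_norm ennreal_mult[symmetric] mult_ac)
  also have "\<dots> = ennreal ((2 * pi) ^ DIM('a) * S)"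
    using zJ by (subst sum_ennreal) (auto simp: S_def sum_distrib_left)
  finally have "K * C \<le> (2 * pi) ^ DIM('a) * S"
    using S0 by (simp add: ennreal_le_iff)
  then have "K * C / (2 * pi) ^ DIM('a) \<le> S"
    by (simp add: pos_divide_le_eq mult.commute)
  moreover have "(2 * pi) powr (- real DIM('a)) = 1 / (2 * pi) ^ DIM('a)"
    by (simp add: powr_minus powr_realpow divide_inverse)
  moreover have "(z - \<Lambda>) powr (real DIM('a) / 2 + 1) = R ^ (DIM('a) + 2)"
  proof -
    have "(z - \<Lambda>) powr (real DIM('a) / 2 + 1) = (R powr 2) powr (real DIM('a) / 2 + 1)"
      using R0 by (simp add: R2[symmetric])
    also have "\<dots> = R powr (real (DIM('a) + 2))"
      unfolding powr_powr by (rule arg_cong[of _ _ "\<lambda>e. R powr e"]) simp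
    also have "\<dots> = R ^ (DIM('a) + 2)" by (rule powr_realpow[OF R0])
    finally show ?thesis .
  qed
  ultimately show ?thesis
    unfolding S_def J_def K_def[symmetric] \<Lambda>_def[symmetric] C_def by (simp add: mult_ac)
qed

text \<open>For \<open>z\<close> at or below the quotient the left side is \<open>0\<close>, as
  \<open>0 powr a = 0\<close>, and the right side is a sum of nonnegative terms.\<close>

lemma riesz_mean_bound:
  "2 / (real DIM('a) + 2) * (2 * pi) powr (- real DIM('a)) * unit_ball_vol (real DIM('a)) * (L2_norm \<Omega> \<phi>)\<^sup>2
      * max (z - (grad_norm \<Omega> \<phi>)\<^sup>2 / (L2_norm \<Omega> \<phi>)\<^sup>2) 0 powr (real DIM('a) / 2 + 1)
    \<le> (\<Sum>j\<in>{j. 1 \<le> j \<and> ev j < z}. (z - ev j) * (L2_norm \<Omega> (\<lambda>x. \<phi> x *\<^sub>R u j x))\<^sup>2)"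
proof (cases "(grad_norm \<Omega> \<phi>)\<^sup>2 / (L2_norm \<Omega> \<phi>)\<^sup>2 < z")
  case True
  then show ?thesis using riesz_mean_bound_of_less[OF True] by (simp add: max_def)
next
  case False
  then show ?thesis by (auto simp: max_def intro!: sum_nonneg mult_nonneg_nonneg)
qed

text \<open>For \<open>z = ev k\<close> the Riesz mean is at most
  \<open>(k * z - E) * M\<^sup>2\<close>, since each product of \<phi> with \<open>u j\<close> has
  norm at most \<open>M\<close>. From below it is a multiple of \<open>T powr s\<close>, with
  \<open>T\<close> the positive part of \<open>z - \<Lambda>\<close>. Replacing the power by its
  tangent of slope \<open>k\<close> makes \<open>z\<close> cancel.\<close>

lemma eigenvalue_mean_bound:
  assumes ne: "\<Omega> \<noteq> {}" and k: "k \<ge> 1"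
  shows "1 / real k * (\<Sum>j=1..k. ev j)
     \<le> (grad_norm \<Omega> \<phi>)\<^sup>2 / (L2_norm \<Omega> \<phi>)\<^sup>2
       + real DIM('a) / (real DIM('a) + 2) * weyl_const DIM('a)
         * (real k / measure lebesgue \<Omega>) powr (2 / real DIM('a)) * rho \<Omega> \<phi> powr (- 2 / real DIM('a))"
proof -
  define d where "d = real DIM('a)"
  have d: "d > 0" by (simp add: d_def)
  define m where "m = measure lebesgue \<Omega>"
  define K where "K = (L2_norm \<Omega> \<phi>)\<^sup>2"
  define M where "M = Linfty_norm \<Omega> \<phi>"
  define \<Lambda> where "\<Lambda> = (grad_norm \<Omega> \<phi>)\<^sup>2 / K"
  define w where "w = unit_ball_vol d"
  define \<rho> where "\<rho> = rho \<Omega> \<phi>"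
  have m: "m > 0" and K: "K > 0" and \<rho>: "\<rho> > 0"
    using rho_less_1[OF ne \<phi> nz] by (simp_all add: m_def K_def \<rho>_def)
  note M = Linfty_bound[OF \<phi>(2) nz, folded M_def]
  have w: "w > 0" using d by (simp add: w_def)
  have \<Lambda>: "\<Lambda> \<ge> 0" using K by (simp add: \<Lambda>_def)
  \<comment> \<open>Chosen so that the tangent to \<open>A * T powr s\<close> at
    \<open>T = t\<close> has slope \<open>k\<close>, as verified in \<open>key\<close>.\<close>
  define t where "t = weyl_const DIM('a) * (real k / m) powr (2 / d) * \<rho> powr (- 2 / d)"
  have t: "t > 0"
    unfolding t_def weyl_const_def d_def[symmetric] w_def[symmetric] using k m \<rho> w
    by (intro mult_pos_pos) auto
  have mono: "ev i \<le> ev j" if "1 \<le> i" "i \<le> j" for i j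
    using ev that by (auto simp: dirichlet_eigenvalues_def monotone_on_def)
  define z where "z = ev k"
  define E where "E = (\<Sum>j=1..k. ev j)"
  have "E \<le> real k * \<Lambda> + real k * (d / (d + 2) * t)"
  proof (cases "z > 0")
    case False
    have "E \<le> 0" unfolding E_def
      using mono[of _ k] False by (intro sum_nonpos) (force simp: z_def)
    also have "0 \<le> real k * \<Lambda> + real k * (d / (d + 2) * t)" using \<Lambda> t d by simp
    finally show ?thesis .
  next
    case True
    define J where "J = {j. 1 \<le> j \<and> ev j < z}"
    have Jk: "J \<subseteq> {1..k}"
    proof
      fix j assume "j \<in> J"
      then show "j \<in> {1..k}" using mono[of k j] k by (force simp: J_def z_def)
    qed
    have "(\<Sum>j\<in>J. (z - ev j) * (L2_norm \<Omega> (\<lambda>x. \<phi> x *\<^sub>R u j x))\<^sup>2) \<le> (\<Sum>j\<in>J. (z - ev j) * M\<^sup>2)"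
    proof (intro sum_mono mult_left_mono)
      fix j assume j: "j \<in> J"
      then have j1: "1 \<le> j" by (simp add: J_def)
      show "0 \<le> z - ev j" using j by (simp add: J_def)
      have "L2_norm \<Omega> (\<lambda>x. \<phi> x *\<^sub>R u j x) \<le> M * 1"
        using Linfty_mult_L2(2)[OF \<phi>(2) M(2) less_imp_le[OF M(1)] H10_L2[OF u_H10[OF ev u j1]]]
          u_norm[OF ev u j1] by simp
      then show "(L2_norm \<Omega> (\<lambda>x. \<phi> x *\<^sub>R u j x))\<^sup>2 \<le> M\<^sup>2" by (intro power_mono) auto
    qed
    \<comment> \<open>By monotonicity the indices up to \<open>k\<close> outside \<open>J\<close>
      have \<open>ev j = ev k\<close> and contribute \<open>0\<close>.\<close>
    also have "\<dots> = (\<Sum>j=1..k. (z - ev j) * M\<^sup>2)"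
    proof (rule sum.mono_neutral_left[OF _ Jk])
      show "\<forall>j\<in>{1..k} - J. (z - ev j) * M\<^sup>2 = 0"
        using mono[of _ k] by (force simp: J_def z_def)
    qed simp
    also have "\<dots> = (real k * z - E) * M\<^sup>2"
      by (simp add: E_def sum_distrib_right[symmetric] sum_subtractf)
    finally have up: "(\<Sum>j\<in>J. (z - ev j) * (L2_norm \<Omega> (\<lambda>x. \<phi> x *\<^sub>R u j x))\<^sup>2) \<le> (real k * z - E) * M\<^sup>2" .
    define T where "T = max (z - \<Lambda>) 0"
    define s where "s = d / 2 + 1"
    have s: "s > 1" using d by (simp add: s_def)
    \<comment> \<open>Dividing by \<open>M\<^sup>2\<close> brings in \<open>rho\<close>, because
      \<open>K / M\<^sup>2 = m * \<rho>\<close>.\<close>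
    define A where "A = 2 / (d + 2) * (2 * pi) powr (- d) * w * K / M\<^sup>2"
    have "2 / (d + 2) * (2 * pi) powr (- d) * w * K * T powr s \<le> (real k * z - E) * M\<^sup>2"
      using riesz_mean_bound[of z] up by (simp add: d_def w_def K_def \<Lambda>_def T_def s_def J_def)
    then have "2 / (d + 2) * (2 * pi) powr (- d) * w * K * T powr s / M\<^sup>2 \<le> real k * z - E"
      using M(1) by (simp only: pos_divide_le_eq[of "M\<^sup>2"] zero_less_power)
    then have AT: "A * T powr s \<le> real k * z - E" by (simp add: A_def)
    have A: "A > 0" using d w K M(1) by (simp add: A_def)
    have key: "A * s * t powr (s - 1) = real k"
    proof -
      have root_neg: "(x powr (- 2 / d)) powr (d / 2) = 1 / x" if "x > 0" for x :: real
      proof -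
        have "- 2 / d * (d / 2) = - 1" using d by simp
        then show ?thesis using that by (simp only: powr_powr powr_neg_one)
      qed
      have "t powr (s - 1) = (4 * pi\<^sup>2) powr (d / 2) * (w powr (- 2 / d)) powr (d / 2)
          * ((real k / m) powr (2 / d)) powr (d / 2) * (\<rho> powr (- 2 / d)) powr (d / 2)"
        by (simp add: t_def s_def weyl_const_def w_def d_def powr_mult)
      also have "(w powr (- 2 / d)) powr (d / 2) = 1 / w"
        by (rule root_neg[OF w])
      also have "((real k / m) powr (2 / d)) powr (d / 2) = real k / m"
        using d m k by (simp add: powr_powr)
      also have "(\<rho> powr (- 2 / d)) powr (d / 2) = 1 / \<rho>"
        by (rule root_neg[OF \<rho>])
      also have "(4 * pi\<^sup>2) powr (d / 2) = (2 * pi) powr d"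
      proof -
        have "4 * pi\<^sup>2 = (2 * pi) powr 2" by (simp add: power_mult_distrib)
        then show ?thesis by (simp only: powr_powr) simp
      qed
      finally have tp: "t powr (s - 1) = (2 * pi) powr d * (1 / w) * (real k / m) * (1 / \<rho>)" .
      have As: "A * s = (2 * pi) powr (- d) * w * (K / M\<^sup>2)"
      proof -
        have "2 / (d + 2) * s = 1" using d by (simp add: s_def field_simps)
        moreover have "A * s = (2 / (d + 2) * s) * ((2 * pi) powr (- d) * w * (K / M\<^sup>2))" by (simp add: A_def)
        ultimately show ?thesis by simp
      qed
      have "K / M\<^sup>2 = m * \<rho>" using m M(1) by (simp add: \<rho>_def rho_def K_def M_def m_def)
      moreover have "(2 * pi) powr (- d) * (2 * pi) powr d = 1" by (simp add: powr_minus)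
      ultimately have "A * s * t powr (s - 1)
          = ((2 * pi) powr (- d) * (2 * pi) powr d) * (w * (1 / w)) * (m * (1 / m)) * (\<rho> * (1 / \<rho>)) * real k"
        unfolding As tp by (simp add: mult_ac)
      then show ?thesis using w m \<rho> \<open>(2 * pi) powr (- d) * _ = 1\<close> by simp
    qed
    have "t powr s = t powr (s - 1) * t" using t by (simp add: powr_diff)
    then have Ats: "A * (s - 1) * t powr s = real k * t * ((s - 1) / s)"
      using key s by (simp add: field_simps)
    have "A * (s * t powr (s - 1) * T - (s - 1) * t powr s) \<le> A * T powr s"
      using A by (intro mult_left_mono powr_tangent_bound[OF s t]) (auto simp: T_def)
    moreover have "A * (s * t powr (s - 1) * T - (s - 1) * t powr s)
        = (A * s * t powr (s - 1)) * T - A * (s - 1) * t powr s"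
      by (simp add: algebra_simps)
    ultimately have "real k * T - real k * t * ((s - 1) / s) \<le> A * T powr s"
      by (simp only: key Ats)
    also note AT
    finally have "E \<le> real k * z - real k * T + real k * t * ((s - 1) / s)" by simp
    \<comment> \<open>\<open>T\<close> is at least \<open>z - \<Lambda>\<close>, and with this the
      two terms in \<open>T\<close> cancel.\<close>
    also have "real k * z \<le> real k * (\<Lambda> + T)" by (intro mult_left_mono) (auto simp: T_def)
    also have "real k * (\<Lambda> + T) - real k * T + real k * t * ((s - 1) / s) = real k * \<Lambda> + real k * (((s - 1) / s) * t)"
      by (simp add: algebra_simps)
    also have "(s - 1) / s = d / (d + 2)" using d by (simp add: s_def field_simps)
    finally show ?thesis by simp
  qed
  then have "1 / real k * E \<le> 1 / real k * (real k * \<Lambda> + real k * (d / (d + 2) * t))"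
    by (intro mult_left_mono) auto
  also have "\<dots> = \<Lambda> + d / (d + 2) * t" using k by (simp add: distrib_left)
  finally show ?thesis
    by (simp add: E_def \<Lambda>_def K_def d_def t_def m_def \<rho>_def mult.assoc)
qed

end

end

theorem theorem2p1:
  fixes \<Omega> :: "'a::euclidean_space set"
    and ev :: "nat \<Rightarrow> real"
    and u :: "nat \<Rightarrow> 'a \<Rightarrow> complex"
    and \<phi> :: "'a \<Rightarrow> real"
  assumes "DIM('a) \<ge> 2"
    and "open \<Omega>" and "connected \<Omega>" and "\<Omega> \<noteq> {}" and "bounded \<Omega>"
    and "dirichlet_eigenvalues \<Omega> ev"
    and "orthonormal_eigenfunctions \<Omega> ev u"
    and "\<phi> \<in> H10 \<Omega>" and "\<phi> \<in> Linfty \<Omega>"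
    and "\<not> (AE x in lebesgue_on \<Omega>. \<phi> x = 0)"
  shows "(\<forall>z>0.
           (\<Sum>\<^sub>\<infinity>j\<in>{1..}. max (z - ev j) 0 * (L2_norm \<Omega> (\<lambda>x. \<phi> x *\<^sub>R u j x))\<^sup>2)
           \<ge> 2 / (real DIM('a) + 2) * (2 * pi) powr (- real DIM('a)) * unit_ball_vol (real DIM('a))
             * (L2_norm \<Omega> \<phi>)\<^sup>2
             * max (z - (grad_norm \<Omega> \<phi>)\<^sup>2 / (L2_norm \<Omega> \<phi>)\<^sup>2) 0 powr (real DIM('a) / 2 + 1))
       \<and> (\<forall>k::nat. k \<ge> 1 \<longrightarrow>
           1 / real k * (\<Sum>j=1..k. ev j)
           \<le> (grad_norm \<Omega> \<phi>)\<^sup>2 / (L2_norm \<Omega> \<phi>)\<^sup>2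
             + real DIM('a) / (real DIM('a) + 2) * weyl_const DIM('a)
               * (real k / measure lebesgue \<Omega>) powr (2 / real DIM('a))
               * rho \<Omega> \<phi> powr (- 2 / real DIM('a)))
       \<and> rho \<Omega> \<phi> < 1"
proof -
  interpret bounded_open_set \<Omega> using assms by unfold_locales
  note hyps = assms(6-10)
  show ?thesis
  proof (intro conjI allI impI)
    show "(\<Sum>\<^sub>\<infinity>j\<in>{1..}. max (z - ev j) 0 * (L2_norm \<Omega> (\<lambda>x. \<phi> x *\<^sub>R u j x))\<^sup>2)
           \<ge> 2 / (real DIM('a) + 2) * (2 * pi) powr (- real DIM('a)) * unit_ball_vol (real DIM('a))
             * (L2_norm \<Omega> \<phi>)\<^sup>2
             * max (z - (grad_norm \<Omega> \<phi>)\<^sup>2 / (L2_norm \<Omega> \<phi>)\<^sup>2) 0 powr (real DIM('a) / 2 + 1)" for z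
      unfolding riesz_infsum[OF hyps] by (rule riesz_mean_bound[OF hyps])
    show "1 / real k * (\<Sum>j=1..k. ev j)
           \<le> (grad_norm \<Omega> \<phi>)\<^sup>2 / (L2_norm \<Omega> \<phi>)\<^sup>2
             + real DIM('a) / (real DIM('a) + 2) * weyl_const DIM('a)
               * (real k / measure lebesgue \<Omega>) powr (2 / real DIM('a))
               * rho \<Omega> \<phi> powr (- 2 / real DIM('a))" if "k \<ge> 1" for k :: nat
      by (rule eigenvalue_mean_bound[OF hyps assms(4) that])
    show "rho \<Omega> \<phi> < 1" by (rule rho_less_1(4)[OF assms(4) hyps(3-5)])
  qed
qed

end
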